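(* Let $d_u>0$, $d_v\ge 0$, $U_0>0$, $V_0>0$. The unique weak solution $w$ of Problem $(P_1^{limit})$ has a self-similar form: there exist a function $f:\mathbb{R}\to\mathbb{R}$ and a constant $a\in\mathbb{R}$ such that, for every $T>0$, $$w(x,t)=f\left(\frac{x}{\sqrt t}\right),\quad (x,t)\in \mathbb{R}\times(0,T),$$ and the free boundary $x=\xi(t)$ separating the region where $w>0$ (namely $x<\xi(t)$) from the region where $w<0$ (namely $x>\xi(t)$) is $\xi(t)=a\sqrt t$, $t\in[0,T]$. If $d_v>0$, then $a\in\mathbb{R}$ is the unique root of the equation $$d_uU_0\int_a^\infty e^{\frac{a^2-s^2}{4d_v}}\,ds=d_vV_0\int_{-\infty}^a e^{\frac{a^2-s^2}{4d_u}}\,ds,$$ and $$f(\eta)=\begin{cases}U_0\left(1-\dfrac{\int_{-\infty}^{\eta}e^{-\frac{s^2}{4d_u}}\,ds}{\int_{-\infty}^{a}e^{-\frac{s^2}{4d_u}}\,ds}\right), & \eta\le a,\\[3mm] -V_0\left(1-\dfrac{\int_{\eta}^{\infty}e^{-\frac{s^2}{4d_v}}\,ds}{\int_{a}^{\infty}e^{-\frac{s^2}{4d_v}}\,ds}\right), & \eta>a.\end{cases}$$ If $d_v=0$, then $a>0$ is the unique root of the equation $$U_0=\frac{V_0a}{2d_u}\int_{-\infty}^a e^{\frac{a^2-s^2}{4d_u}}\,ds,$$ and $$f(\eta)=\begin{cases}U_0\left(1-\dfrac{\int_{-\infty}^{\eta}e^{-\frac{s^2}{4d_u}}\,ds}{\int_{-\infty}^{a}e^{-\frac{s^2}{4d_u}}\,ds}\right),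 & \eta\le a,\\[3mm] -V_0, & \eta>a.\end{cases}$$
   Context: Here $\mathbb{R}^+=[0,\infty)$ and $Q_T=\mathbb{R}\times(0,T)$. Define $\mathcal{D}(s)=d_us$ if $s\ge0$ and $\mathcal{D}(s)=d_vs$ if $s<0$. Problem $(P_1^{limit})$ is $$w_t=\mathcal{D}(w)_{xx}\ \text{ in }\mathbb{R}\times[0,\infty),\qquad w(x,0)=w_0(x):=\begin{cases}U_0,&x<0,\\-V_0,&x>0.\end{cases}$$ A weak solution of $(P_1^{limit})$ is a function $w\in L^\infty(\mathbb{R}\times\mathbb{R}^+)$ such that for all $T>0$, $$\iint_{Q_T}\bigl(w\psi_t+\mathcal{D}(w)\psi_{xx}\bigr)\,dx\,dt=-\int_{\mathbb{R}}w_0(x)\psi(x,0)\,dx$$ for all $\psi\in\mathcal{F}_T$, the set of functions $\psi$ of class $C^{2,1}$ ($C^2$ in $x$, $C^1$ in $t$) on $\overline{Q_T}$ with $\psi(\cdot,T)=0$ and $\operatorname{supp}\psi\subset[-J,J]\times[0,T]$ for some $J>0$. Equalities of $w$ are almost everywhere. *)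

theory Defs
  imports "HOL-Analysis.Analysis"
begin

definition diffusion :: "real \<Rightarrow> real \<Rightarrow> real \<Rightarrow> real" where
  "diffusion d\<^sub>u d\<^sub>v s = (if s \<ge> 0 then d\<^sub>u * s else d\<^sub>v * s)"

text \<open>The value at \<open>x = 0\<close> is arbitrary: the initial datum only occurs under an integral.\<close>

definition initial_datum :: "real \<Rightarrow> real \<Rightarrow> real \<Rightarrow> real" where
  "initial_datum U\<^sub>0 V\<^sub>0 x = (if x < 0 then U\<^sub>0 else - V\<^sub>0)"

definition Q :: "real \<Rightarrow> (real \<times> real) set" where
  "Q T = UNIV \<times> {0<..<T}"

text \<open>\<open>L\<^sup>\<infinity>(S)\<close>, with functions in place of their classes modulo null sets.\<close>

definition L_infinity :: "'a::euclidean_space set \<Rightarrow> ('a \<Rightarrow> real) set" where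
  "L_infinity S = {w. w \<in> borel_measurable (lebesgue_on S) \<and>
                      (\<exists>C. AE p in lebesgue_on S. \<bar>w p\<bar> \<le> C)}"

text \<open>
  \<open>C21 T \<psi> \<psi>\<^sub>x \<psi>\<^sub>x\<^sub>x \<psi>\<^sub>t\<close>: on \<open>\<real> \<times> [0,T]\<close> the function \<open>\<psi>\<close> is of class \<open>C\<^sup>2\<close> in \<open>x\<close> and \<open>C\<^sup>1\<close> in \<open>t\<close>,
  and \<open>\<psi>\<^sub>x\<close>, \<open>\<psi>\<^sub>x\<^sub>x\<close>, \<open>\<psi>\<^sub>t\<close> are its derivatives there (for \<open>T > 0\<close> they are uniquely determined on
  this set).  At \<open>t = 0\<close> and \<open>t = T\<close> the time derivative is one-sided.
\<close>

definition C21 ::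
  "real \<Rightarrow> (real \<times> real \<Rightarrow> real) \<Rightarrow> (real \<times> real \<Rightarrow> real) \<Rightarrow> (real \<times> real \<Rightarrow> real)
     \<Rightarrow> (real \<times> real \<Rightarrow> real) \<Rightarrow> bool" where
  "C21 T \<psi> \<psi>\<^sub>x \<psi>\<^sub>x\<^sub>x \<psi>\<^sub>t \<longleftrightarrow>
     (\<forall>x. \<forall>t\<in>{0..T}.
        ((\<lambda>y. \<psi> (y, t)) has_real_derivative \<psi>\<^sub>x (x, t)) (at x) \<and>
        ((\<lambda>y. \<psi>\<^sub>x (y, t)) has_real_derivative \<psi>\<^sub>x\<^sub>x (x, t)) (at x) \<and>
        ((\<lambda>\<tau>. \<psi> (x, \<tau>)) has_real_derivative \<psi>\<^sub>t (x, t)) (at t within {0..T})) \<and>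
     (\<forall>g\<in>{\<psi>, \<psi>\<^sub>x, \<psi>\<^sub>x\<^sub>x, \<psi>\<^sub>t}. continuous_on (UNIV \<times> {0..T}) g)"

text \<open>Membership of \<open>\<psi>\<close> in \<open>\<F>\<^sub>T\<close>; the derivatives are carried along as in \<open>C21\<close>.\<close>

definition test_function ::
  "real \<Rightarrow> (real \<times> real \<Rightarrow> real) \<Rightarrow> (real \<times> real \<Rightarrow> real) \<Rightarrow> (real \<times> real \<Rightarrow> real)
     \<Rightarrow> (real \<times> real \<Rightarrow> real) \<Rightarrow> bool" where
  "test_function T \<psi> \<psi>\<^sub>x \<psi>\<^sub>x\<^sub>x \<psi>\<^sub>t \<longleftrightarrow>
     C21 T \<psi> \<psi>\<^sub>x \<psi>\<^sub>x\<^sub>x \<psi>\<^sub>t \<and>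
     (\<forall>x. \<psi> (x, T) = 0) \<and>
     (\<exists>J>0. closure {p \<in> UNIV \<times> {0..T}. \<psi> p \<noteq> 0} \<subseteq> {-J..J} \<times> {0..T})"

definition weak_solution ::
  "real \<Rightarrow> real \<Rightarrow> real \<Rightarrow> real \<Rightarrow> (real \<times> real \<Rightarrow> real) \<Rightarrow> bool" where
  "weak_solution d\<^sub>u d\<^sub>v U\<^sub>0 V\<^sub>0 w \<longleftrightarrow>
     w \<in> L_infinity (UNIV \<times> {0..}) \<and>
     (\<forall>T>0. \<forall>\<psi> \<psi>\<^sub>x \<psi>\<^sub>x\<^sub>x \<psi>\<^sub>t. test_function T \<psi> \<psi>\<^sub>x \<psi>\<^sub>x\<^sub>x \<psi>\<^sub>t \<longrightarrow>
        (LINT p:Q T|lebesgue. w p * \<psi>\<^sub>t p + diffusion d\<^sub>u d\<^sub>v (w p) * \<psi>\<^sub>x\<^sub>x p)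
          = - (LINT x|lebesgue. initial_datum U\<^sub>0 V\<^sub>0 x * \<psi> (x, 0)))"

text \<open>
  As \<open>w\<close> is only determined almost everywhere, so are its positivity and negativity regions.
  Continuity on the closed interval is what makes \<open>\<xi>\<close> unique at every time, including \<open>t = 0\<close>.
\<close>

definition free_boundary :: "real \<Rightarrow> (real \<times> real \<Rightarrow> real) \<Rightarrow> (real \<Rightarrow> real) \<Rightarrow> bool" where
  "free_boundary T w \<xi> \<longleftrightarrow>
     continuous_on {0..T} \<xi> \<and>
     (AE (x, t) in lebesgue_on (Q T).
        (w (x, t) > 0 \<longleftrightarrow> x < \<xi> t) \<and> (w (x, t) < 0 \<longleftrightarrow> x > \<xi> t))"

definition interface_eq :: "real \<Rightarrow> real \<Rightarrow> real \<Rightarrow> real \<Rightarrow> real \<Rightarrow> bool" where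
  "interface_eq d\<^sub>u d\<^sub>v U\<^sub>0 V\<^sub>0 a \<longleftrightarrow>
     d\<^sub>u * U\<^sub>0 * (LBINT s:{a..}. exp ((a\<^sup>2 - s\<^sup>2) / (4 * d\<^sub>v)))
       = d\<^sub>v * V\<^sub>0 * (LBINT s:{..a}. exp ((a\<^sup>2 - s\<^sup>2) / (4 * d\<^sub>u)))"

definition interface_eq_degenerate :: "real \<Rightarrow> real \<Rightarrow> real \<Rightarrow> real \<Rightarrow> bool" where
  "interface_eq_degenerate d\<^sub>u U\<^sub>0 V\<^sub>0 a \<longleftrightarrow>
     U\<^sub>0 = V\<^sub>0 * a / (2 * d\<^sub>u) * (LBINT s:{..a}. exp ((a\<^sup>2 - s\<^sup>2) / (4 * d\<^sub>u)))"

definition left_profile :: "real \<Rightarrow> real \<Rightarrow> real \<Rightarrow> real \<Rightarrow> real" where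
  "left_profile d\<^sub>u U\<^sub>0 a \<eta> =
     U\<^sub>0 * (1 - (LBINT s:{..\<eta>}. exp (- s\<^sup>2 / (4 * d\<^sub>u))) / (LBINT s:{..a}. exp (- s\<^sup>2 / (4 * d\<^sub>u))))"

definition right_profile :: "real \<Rightarrow> real \<Rightarrow> real \<Rightarrow> real \<Rightarrow> real" where
  "right_profile d\<^sub>v V\<^sub>0 a \<eta> =
     - V\<^sub>0 * (1 - (LBINT s:{\<eta>..}. exp (- s\<^sup>2 / (4 * d\<^sub>v))) / (LBINT s:{a..}. exp (- s\<^sup>2 / (4 * d\<^sub>v))))"

end

theory Submission
  imports Defs "HOL-Probability.Probability"
begin

text \<open>
  Existence: with \<open>\<eta> = x / sqrt t\<close> the equation becomes \<open>- \<eta> f' / 2 = \<D>(f)''\<close>, which the profile \<open>f\<close>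
  solves on both sides of \<open>a\<close>; the equation for \<open>a\<close> is the Rankine-Hugoniot condition there.  It has
  exactly one root because \<open>exp (a\<^sup>2 / 4d) \<integral>\<^sub>-\<^sub>\<infinity>\<^sup>a exp (- s\<^sup>2 / 4d) ds\<close> is strictly increasing in \<open>a\<close> and
  tends to \<open>0\<close> at \<open>-\<infinity>\<close>.

  Uniqueness: let \<open>z = w\<^sub>1 - w\<^sub>2\<close> and \<open>q = \<D>(w\<^sub>1) - \<D>(w\<^sub>2)\<close> for two weak solutions, so \<open>c q\<^sup>2 \<le> z q\<close> for some
  \<open>c > 0\<close>.  The function \<open>P = \<integral>\<^sub>0\<^sup>t q\<^sub>x ds\<close> satisfies \<open>P\<^sub>x = z\<close> and \<open>P\<^sub>t = q\<^sub>x\<close>; it is bounded, as it is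
  Lipschitz in \<open>x\<close> with bounded averages over unit intervals.  The energy \<open>\<integral> P\<^sup>2 / (1 + x\<^sup>2) dx\<close>
  over \<open>[-R, R]\<close> obeys a Gronwall inequality with boundary terms of order \<open>1 / R\<^sup>2\<close>.  As \<open>R \<rightarrow> \<infinity>\<close> this
  gives \<open>P = 0\<close>, hence \<open>z = 0\<close>.  The computation is carried out for mollifications of \<open>z\<close> and \<open>q\<close>.
\<close>

section \<open>The equation for the interface\<close>

text \<open>The degenerate case shapes the uniqueness proof. If \<open>dv = 0\<close>, then
  \<open>diffusion\<close> vanishes on the negative axis, so \<open>q = 0\<close> does not give
  \<open>z = 0\<close>. What survives is the inequality between \<open>c q\<^sup>2\<close> and
  \<open>z q\<close>, with \<open>c = 1 / max du dv\<close>, as \<open>diffusion\<close> is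
  nondecreasing and Lipschitz. Hence the energy is that of the potential \<open>P\<close>, whose
  vanishing does recover \<open>z\<close>. Solutions are bounded but need not decay. The weight
  makes a bounded \<open>P\<close> square integrable, and the derivative of the weight is dominated
  by the weight itself, which is what the Gronwall argument requires. Mollification respects the
  linear weak equation but spoils the pointwise inequality, in which products occur. The loss
  (\<open>defect\<close>) becomes small only in the mean over bounded boxes. So \<open>R\<close>
  must be fixed before the kernel width, and all other constants must be uniform in that width. On
  the existence side the profile may jump at \<open>a\<close> (from \<open>0\<close> to
  \<open>-V\<close> if \<open>dv = 0\<close>). The weak formulation is therefore verified by
  integrating along the curves on which x / sqrt t is constant: there \<open>f\<close> is constant
  and only the test function is differentiated in time.\<close>

lemma pos_deriv_imp_strict_mono:
  fixes f f' :: "real \<Rightarrow> real"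
  assumes "\<And>x. (f has_real_derivative f' x) (at x)" "\<And>x. f' x > 0"
  shows "strict_mono f"
proof (rule strict_monoI)
  fix x y :: real assume "x < y"
  then show "f x < f y" by (rule DERIV_pos_imp_increasing) (use assms in blast)
qed

section \<open>Gaussian tails and the Mills ratio\<close>

lemma gauss_integrable:
  assumes "d > (0::real)"
  shows "integrable lborel (\<lambda>s. exp (- s\<^sup>2 / (4 * d)))"
proof -
  have "integrable lborel (\<lambda>s. sqrt (2 * pi * (sqrt (2*d))\<^sup>2) * normal_density 0 (sqrt (2*d)) s)"
    by (intro integrable_mult_right integrable_normal_density) (use assms in auto)
  then show ?thesis
    using assms by (simp add: normal_density_def)
qed

definition gauss_tail :: "real \<Rightarrow> real \<Rightarrow> real" where
  "gauss_tail d a = (LBINT s:{..a}. exp (- s\<^sup>2 / (4 * d)))"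

lemma gauss_set_integrable:
  assumes "d > (0::real)" "A \<in> sets borel"
  shows "set_integrable lborel A (\<lambda>s. exp (- s\<^sup>2 / (4 * d)))"
  using integrable_mult_indicator[OF _ gauss_integrable[OF assms(1)], of A] assms(2)
  by (simp add: set_integrable_def)

lemma gauss_tail_reflect:
  "(LBINT s:{a..}. exp (- s\<^sup>2 / (4 * d))) = gauss_tail d (- a)"
proof -
  have "(LBINT s:{a..}. exp (- s\<^sup>2 / (4 * d)))
      = (\<integral>s. indicator {a..} (- s) * exp (- (- s)\<^sup>2 / (4 * d)) \<partial>lborel)"
    using lborel_integral_real_affine[of "-1" "\<lambda>s. indicator {a..} s * exp (- s\<^sup>2 / (4 * d))" 0]
    by (simp add: set_lebesgue_integral_def)
  also have "\<dots> = gauss_tail d (- a)"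
    unfolding gauss_tail_def set_lebesgue_integral_def
    by (intro Bochner_Integration.integral_cong) (auto simp: indicator_def)
  finally show ?thesis .
qed

lemma gauss_tail_diff:
  assumes "d > (0::real)" "b \<le> a"
  shows "gauss_tail d a = gauss_tail d b + integral {b..a} (\<lambda>s. exp (- s\<^sup>2 / (4 * d)))"
proof -
  have "{..a} = {..b} \<union> {b<..a}" using assms by auto
  then have "gauss_tail d a = gauss_tail d b + (LBINT s:{b<..a}. exp (- s\<^sup>2 / (4 * d)))"
    unfolding gauss_tail_def
    by (simp only:, intro set_integral_Un gauss_set_integrable assms) auto
  also have "(LBINT s:{b<..a}. exp (- s\<^sup>2 / (4 * d))) = (LBINT s:{b..a}. exp (- s\<^sup>2 / (4 * d)))"
    unfolding set_lebesgue_integral_def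
    by (rule integral_cong_AE; (rule AE_mp[OF AE_lborel_singleton[of b]])?) (auto simp: indicator_def)
  also have "\<dots> = integral {b..a} (\<lambda>s. exp (- s\<^sup>2 / (4 * d)))"
    by (intro set_borel_integral_eq_integral gauss_set_integrable assms) auto
  finally show ?thesis .
qed

lemma gauss_tail_deriv:
  assumes "d > (0::real)"
  shows "(gauss_tail d has_real_derivative exp (- x\<^sup>2 / (4 * d))) (at x)"
proof -
  have "((\<lambda>u. integral {x-1..u} (\<lambda>s. exp (- s\<^sup>2 / (4 * d)))) has_real_derivative exp (- x\<^sup>2 / (4 * d)))
        (at x within {x-1..x+1})"
    using assms by (intro integral_has_real_derivative) (auto intro!: continuous_intros)
  then have "((\<lambda>u. gauss_tail d (x-1) + integral {x-1..u} (\<lambda>s. exp (- s\<^sup>2 / (4 * d)))) has_real_derivative exp (- x\<^sup>2 / (4 * d)))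
        (at x within {x-1..x+1})"
    by (auto intro!: derivative_eq_intros)
  note 1 = this
  have diff: "gauss_tail d (x-1) + integral {x-1..u} (\<lambda>s. exp (- s\<^sup>2 / (4 * d))) = gauss_tail d u" if "x - 1 \<le> u" for u
    using gauss_tail_diff[OF assms that] by simp
  from 1 have "(gauss_tail d has_real_derivative exp (- x\<^sup>2 / (4 * d))) (at x within {x-1..x+1})"
    by (rule has_field_derivative_transform_within[where d=1])
       (use diff in auto)
  moreover have "at x within {x-1..x+1} = at x"
    by (rule at_within_Icc_at) auto
  ultimately show ?thesis by simp
qed

lemma gauss_tail_strict_mono:
  assumes "d > (0::real)"
  shows "strict_mono (gauss_tail d)"
  by (rule pos_deriv_imp_strict_mono[OF gauss_tail_deriv[OF assms]]) simp

lemma gauss_tail_pos: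
  assumes "d > (0::real)"
  shows "gauss_tail d a > 0"
proof -
  have "gauss_tail d (a - 1) \<ge> 0"
    unfolding gauss_tail_def set_lebesgue_integral_def by simp
  moreover have "gauss_tail d (a - 1) < gauss_tail d a"
    using gauss_tail_strict_mono[OF assms] by (simp add: strict_mono_def)
  ultimately show ?thesis by linarith
qed

lemma gauss_tail_at_bot:
  assumes "d > (0::real)"
  shows "(gauss_tail d \<longlongrightarrow> 0) at_bot"
proof -
  have "((\<lambda>x. gauss_tail d (- x)) \<longlongrightarrow> (LINT s::real|lborel. 0)) at_top"
    unfolding gauss_tail_def set_lebesgue_integral_def
  proof (rule integral_dominated_convergence_at_top[where w="\<lambda>s. exp (- s\<^sup>2 / (4 * d))"])
    show "AE s in lborel. ((\<lambda>x. indicat_real {..- x} s *\<^sub>R exp (- s\<^sup>2 / (4 * d))) \<longlongrightarrow> 0) at_top"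
    proof (rule AE_I2)
      fix s :: real
      have "\<forall>\<^sub>F x in at_top. indicat_real {..- x} s *\<^sub>R exp (- s\<^sup>2 / (4 * d)) = 0"
        using eventually_gt_at_top[of "- s"] by eventually_elim (auto simp: indicator_def)
      then show "((\<lambda>x. indicat_real {..- x} s *\<^sub>R exp (- s\<^sup>2 / (4 * d))) \<longlongrightarrow> 0) at_top"
        by (simp add: tendsto_eventually)
    qed
  qed (use gauss_integrable[OF assms] in \<open>auto simp: indicator_def\<close>)
  then show ?thesis
    by (simp add: filterlim_at_bot_mirror)
qed

text \<open>The bound is \<open>\<integral> (s / a) exp (- s\<^sup>2 / 4d) ds\<close> over \<open>s < a\<close>, where \<open>s / a > 1\<close>.\<close>

lemma gauss_tail_less:
  assumes "d > (0::real)" "a < 0"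
  shows "gauss_tail d a < - (2 * d / a) * exp (- a\<^sup>2 / (4 * d))"
proof -
  \<comment> \<open>\<open>K\<close> is the right side minus the left side. It increases on the
    negative axis and tends to 0 at -infinity. The limit alone gives
    \<open>K (a - 1) \<ge> 0\<close>; the step from \<open>a - 1\<close> to \<open>a\<close>
    restores strictness.\<close>
  define K where "K = (\<lambda>x. - (2 * d / x) * exp (- x\<^sup>2 / (4 * d)) - gauss_tail d x)"
  have K': "(K has_real_derivative 2 * d / x\<^sup>2 * exp (- x\<^sup>2 / (4 * d))) (at x)" if "x < 0" for x
    unfolding K_def
    by (rule derivative_eq_intros gauss_tail_deriv refl | use assms that in \<open>simp; fail\<close>)+
       (use assms that in \<open>simp add: field_simps power2_eq_square\<close>)
  have mono: "K x < K y" if "x < y" "y < 0" for x y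
    by (rule DERIV_pos_imp_increasing[OF that(1)]) (use that assms in \<open>auto intro!: exI K'\<close>)
  have "((\<lambda>x. 2 * d / x) \<longlongrightarrow> 0) at_bot"
    by (rule tendsto_divide_0[OF tendsto_const]) (simp add: filterlim_at_bot_imp_at_infinity filterlim_ident)
  then have 1: "((\<lambda>x. (2 * d / x) * exp (- x\<^sup>2 / (4 * d))) \<longlongrightarrow> 0) at_bot"
  proof (rule tendsto_0_le[where K=1])
    show "\<forall>\<^sub>F x in at_bot. norm (2 * d / x * exp (- x\<^sup>2 / (4 * d))) \<le> norm (2 * d / x) * 1"
      using assms by (intro always_eventually allI) (auto simp: abs_mult simp del: times_divide_eq_left times_divide_eq_right intro!: mult_left_le)
  qed
  have "(K \<longlongrightarrow> 0) at_bot"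
    unfolding K_def using tendsto_diff[OF tendsto_minus[OF 1] gauss_tail_at_bot[OF assms(1)]] by simp
  moreover have "\<forall>\<^sub>F x in at_bot. K x \<le> K (a - 1)"
    using eventually_le_at_bot[of "a - 2"] by eventually_elim (use mono[of _ "a-1"] assms in \<open>auto intro!: less_imp_le\<close>)
  ultimately have "0 \<le> K (a - 1)"
    by (intro tendsto_upperbound[of K]) auto
  also have "\<dots> < K a" using mono[of "a-1" a] assms by auto
  finally show ?thesis unfolding K_def by simp
qed

text \<open>Up to reflection and scaling this is the Mills ratio of the normal distribution. Both
  integrals of the interface equation are values of it, one at \<open>a\<close> and one at
  \<open>- a\<close>, which turns that equation into a comparison of two monotone functions.\<close>

definition mills :: "real \<Rightarrow> real \<Rightarrow> real" where
  "mills d a = exp (a\<^sup>2 / (4 * d)) * gauss_tail d a"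

lemma mills_integral:
  "(LBINT s:{..a}. exp ((a\<^sup>2 - s\<^sup>2) / (4 * d))) = mills d a"
  "(LBINT s:{a..}. exp ((a\<^sup>2 - s\<^sup>2) / (4 * d))) = mills d (- a)"
proof -
  have *: "exp ((a\<^sup>2 - s\<^sup>2) / (4 * d)) = exp (a\<^sup>2 / (4 * d)) * exp (- s\<^sup>2 / (4 * d))" for s
    by (simp add: diff_divide_distrib flip: exp_add)
  show "(LBINT s:{..a}. exp ((a\<^sup>2 - s\<^sup>2) / (4 * d))) = mills d a"
    unfolding * set_integral_mult_right mills_def gauss_tail_def ..
  show "(LBINT s:{a..}. exp ((a\<^sup>2 - s\<^sup>2) / (4 * d))) = mills d (- a)"
    unfolding * set_integral_mult_right mills_def gauss_tail_reflect by simp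
qed

lemma mills_pos: "d > 0 \<Longrightarrow> mills d a > 0"
  by (simp add: mills_def gauss_tail_pos)

lemma mills_less:
  assumes "d > 0" "a < 0"
  shows "mills d a < - (2 * d / a)"
proof -
  have "mills d a < exp (a\<^sup>2 / (4 * d)) * (- (2 * d / a) * exp (- a\<^sup>2 / (4 * d)))"
    unfolding mills_def by (intro mult_strict_left_mono gauss_tail_less assms) auto
  also have "\<dots> = - (2 * d / a) * (exp (a\<^sup>2 / (4 * d)) * exp (- a\<^sup>2 / (4 * d)))"
    by simp
  also have "\<dots> = - (2 * d / a)"
    unfolding exp_add[symmetric] by simp
  finally show ?thesis .
qed

lemma mills_deriv:
  assumes "d > 0"
  shows "(mills d has_real_derivative 1 + a / (2 * d) * mills d a) (at a)"
proof -
  have "((\<lambda>a. exp (a\<^sup>2 / (4 * d))) has_real_derivative exp (a\<^sup>2 / (4 * d)) * (a / (2 * d))) (at a)"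
    using assms by (auto intro!: derivative_eq_intros)
  from DERIV_mult[OF this gauss_tail_deriv[OF assms, of a]]
  have "(mills d has_real_derivative exp (a\<^sup>2 / (4 * d)) * (a / (2 * d)) * gauss_tail d a
      + exp (- a\<^sup>2 / (4 * d)) * exp (a\<^sup>2 / (4 * d))) (at a)"
    unfolding mills_def by simp
  moreover have "exp (- a\<^sup>2 / (4 * d)) * exp (a\<^sup>2 / (4 * d)) = 1"
    unfolding exp_add[symmetric] by simp
  ultimately show ?thesis
    by (simp add: mills_def mult_ac add.commute)
qed

text \<open>For a negative argument, positivity of the derivative in \<open>mills_deriv\<close> is
  the bound \<open>mills_less\<close> rearranged. For the others both summands of the derivative
  have the right sign.\<close>

lemma mills_strict_mono:
  assumes "d > 0"
  shows "strict_mono (mills d)"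
proof (rule pos_deriv_imp_strict_mono[OF mills_deriv[OF assms]])
  fix x :: real
  show "1 + x / (2 * d) * mills d x > 0"
  proof (cases "x < 0")
    case True
    then have "x / (2 * d) * mills d x > x / (2 * d) * (- (2 * d / x))"
      using mills_less[OF assms True] assms by (intro mult_strict_left_mono_neg) (auto simp: field_simps)
    then show ?thesis using assms True by simp
  qed (use assms mills_pos[OF assms, of x] in \<open>auto intro!: add_pos_nonneg mult_nonneg_nonneg\<close>)
qed

lemma mills_continuous [continuous_intros]:
  "d > 0 \<Longrightarrow> continuous_on S g \<Longrightarrow> continuous_on S (\<lambda>x. mills d (g x))"
  by (rule continuous_on_compose2[where t=UNIV and g="mills d",
        OF DERIV_continuous_on[OF has_field_derivative_at_within[OF mills_deriv]]]) auto

text \<open>An explicit point at which the ratio falls below a given level. It supplies the end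
  points for the intermediate value theorem in \<open>interface_eq_ex1\<close>.\<close>

lemma mills_small:
  assumes "d > 0" "e > 0"
  shows "mills d (- (2 * d / e)) < e"
  using mills_less[OF assms(1), of "- (2 * d / e)"] assms by (simp add: field_simps)

lemma interface_eq_mills:
  "interface_eq du dv U V a \<longleftrightarrow> du * U * mills dv (- a) = dv * V * mills du a"
  by (simp add: interface_eq_def mills_integral)

lemma interface_eq_degenerate_mills:
  "interface_eq_degenerate du U V a \<longleftrightarrow> U = V * a / (2 * du) * mills du a"
  by (simp add: interface_eq_degenerate_def mills_integral)

lemma interface_eq_ex1:
  assumes "du > 0" "dv > 0" "U > 0" "V > 0"
  shows "\<exists>!a. interface_eq du dv U V a"
proof -
  define h where "h = (\<lambda>a. dv * V * mills du a - du * U * mills dv (- a))"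
  have eq: "interface_eq du dv U V a \<longleftrightarrow> h a = 0" for a
    unfolding interface_eq_mills h_def by auto
  have "mills du x < mills du y" "mills dv (-y) < mills dv (-x)" if "x < y" for x y
    using mills_strict_mono[OF assms(1)] mills_strict_mono[OF assms(2)] that by (auto simp: strict_mono_def)
  then have mono: "h x < h y" if "x < y" for x y
    unfolding h_def using assms that by (intro diff_strict_mono mult_strict_left_mono) auto
  have mono0: "mills du x \<le> mills du y" "mills dv x \<le> mills dv y" if "x \<le> y" for x y
    using mills_strict_mono[OF assms(1)] mills_strict_mono[OF assms(2)] that
    by (auto simp: strict_mono_less_eq)
  \<comment> \<open>At \<open>- a1\<close> the first term of \<open>h\<close> lies below
    \<open>dv * V * e1\<close>, which by the choice of \<open>e1\<close> is the second term at 0;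
    monotonicity of that second term then gives a negative sign. \<open>e2\<close> and
    \<open>a2\<close> do the same with the roles exchanged.\<close>
  define e1 where "e1 = du * U * mills dv 0 / (dv * V)"
  define e2 where "e2 = dv * V * mills du 0 / (du * U)"
  have e: "e1 > 0" "e2 > 0"
    unfolding e1_def e2_def using assms mills_pos by (auto intro!: divide_pos_pos mult_pos_pos)
  define a1 where "a1 = 2 * du / e1"
  define a2 where "a2 = 2 * dv / e2"
  have a: "a1 > 0" "a2 > 0" unfolding a1_def a2_def using assms e by auto
  have "h (- a1) < 0"
  proof -
    have "dv * V * mills du (- a1) < dv * V * e1"
      using mills_small[OF assms(1) e(1)] assms by (auto simp: a1_def)
    also have "\<dots> = du * U * mills dv 0" using assms by (simp add: e1_def)
    also have "\<dots> \<le> du * U * mills dv (- (- a1))"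
      using assms a by (intro mult_left_mono mono0) auto
    finally show ?thesis unfolding h_def by simp
  qed
  moreover have "h a2 > 0"
  proof -
    have "du * U * mills dv (- a2) < du * U * e2"
      using mills_small[OF assms(2) e(2)] assms by (auto simp: a2_def)
    also have "\<dots> = dv * V * mills du 0" using assms by (simp add: e2_def)
    also have "\<dots> \<le> dv * V * mills du a2"
      using assms a by (intro mult_left_mono mono0) auto
    finally show ?thesis unfolding h_def by simp
  qed
  moreover have "continuous_on {- a1..a2} h"
    unfolding h_def using assms by (intro continuous_intros) auto
  ultimately obtain x where "h x = 0"
    using IVT'[of h "- a1" 0 a2] a by auto
  then show ?thesis
    unfolding eq using mono by (metis less_irrefl linorder_neqE)
qed

text \<open>For arguments at most 0 the right side of the equation is not positive and cannot equal
  \<open>U\<close>, so every root is positive. On the nonnegative axis the right side is a product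
  of two increasing factors.\<close>

lemma interface_eq_degenerate_ex1:
  assumes "du > 0" "U > 0" "V > 0"
  shows "\<exists>a>0. interface_eq_degenerate du U V a \<and> (\<forall>b. interface_eq_degenerate du U V b \<longrightarrow> b = a)"
proof -
  define h where "h = (\<lambda>a. V * a / (2 * du) * mills du a)"
  have eq: "interface_eq_degenerate du U V a \<longleftrightarrow> h a = U" for a
    unfolding interface_eq_degenerate_mills h_def by auto
  have mono0: "mills du x < mills du y" if "x < y" for x y
    using mills_strict_mono[OF assms(1)] that by (auto simp: strict_mono_def)
  have mono: "h x < h y" if "x < y" "x \<ge> 0" for x y
    unfolding h_def using assms that mono0[of x y] mills_pos[of du x]
    by (intro mult_strict_mono') (auto simp: divide_strict_right_mono intro!: less_imp_le)
  have neg: "h x \<le> 0" if "x \<le> 0" for x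
    unfolding h_def using assms that mills_pos[of du x]
    by (auto simp: mult_le_0_iff zero_le_mult_iff divide_le_0_iff)
  \<comment> \<open>Replacing \<open>mills du a\<close> by the smaller value
    \<open>mills du 0\<close> makes the equation linear in \<open>a\<close>; \<open>a1\<close> is
    the root of that linear equation, so \<open>h\<close> has already reached \<open>U\<close>
    there.\<close>
  define a1 where "a1 = 2 * du * U / (V * mills du 0)"
  have a1: "a1 > 0" unfolding a1_def using assms mills_pos[of du 0] by auto
  have "U = V * a1 / (2 * du) * mills du 0"
    unfolding a1_def using assms mills_pos[of du 0] by (simp add: field_simps)
  also have "\<dots> \<le> h a1"
    unfolding h_def using assms a1 mono0[of 0 a1] by (intro mult_left_mono) auto
  finally have "h a1 \<ge> U" .
  moreover have "continuous_on {0..a1} h"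
    unfolding h_def using assms by (intro continuous_intros) auto
  ultimately obtain x where x: "h x = U"
    using IVT'[of h 0 U a1] a1 neg[of 0] assms by auto
  have pos: "y > 0" if "h y = U" for y
    using neg[of y] that assms by force
  have "b = x" if "h b = U" for b
    using mono[of b x] mono[of x b] pos[of b] pos[of x] that x by (cases b x rule: linorder_cases) auto
  then show ?thesis unfolding eq using x pos by blast
qed

section \<open>The energy inequality\<close>

lemma integral_upper_deriv:
  fixes f :: "real \<Rightarrow> real"
  assumes "continuous_on UNIV f" "a < t"
  shows "((\<lambda>t. integral {a..t} f) has_real_derivative f t) (at t)"
proof -
  have "((\<lambda>t. integral {a..t} f) has_real_derivative f t) (at t within {a..t+1})"
    by (intro integral_has_real_derivative continuous_on_subset[OF assms(1)]) (use assms in auto)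
  then show ?thesis
    using at_within_Icc_at[of a t "t+1"] assms by simp
qed

text \<open>
  Since \<open>P\<^sub>t = q\<^sub>x\<close> and \<open>P\<^sub>x = z\<close>, integration by parts in \<open>\<integral> P q\<^sub>x / (1 + x\<^sup>2)\<close> produces
  \<open>- \<integral> z q / (1 + x\<^sup>2)\<close>; if \<open>z q\<close> dominates \<open>c q\<^sup>2\<close>, up to the error term of the bound, this absorbs
  the other term \<open>\<integral> 2 x P q / (1 + x\<^sup>2)\<^sup>2\<close>, and Gronwall's argument applies.
\<close>

lemma weighted_energy_bound:
  fixes P z q qx :: "real \<times> real \<Rightarrow> real"
  assumes P_x: "\<And>x t. ((\<lambda>x. P (x, t)) has_real_derivative z (x, t)) (at x)"
    and P_t: "\<And>x t. ((\<lambda>t. P (x, t)) has_real_derivative qx (x, t)) (at t)"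
    and q_x: "\<And>x t. ((\<lambda>x. q (x, t)) has_real_derivative qx (x, t)) (at x)"
    and cP: "continuous_on UNIV P" and cz: "continuous_on UNIV z"
    and cq: "continuous_on UNIV q" and cqx: "continuous_on UNIV qx"
    and P0: "\<And>x. P (x, t0) = 0"
    and B: "\<And>x t. t \<in> {t0..T} \<Longrightarrow> \<bar>P (x, t)\<bar> \<le> B"
    and A: "\<And>x t. t \<in> {t0..T} \<Longrightarrow> \<bar>q (x, t)\<bar> \<le> A"
    and c: "c > 0" and R: "R > 0" and t: "t \<in> {t0..T}"
  shows "integral {-R..R} (\<lambda>x. (P (x, t))\<^sup>2 / (1 + x\<^sup>2))
     \<le> 2 * exp ((t - t0) / (2 * c)) * (2 * A * B / (1 + R\<^sup>2) * (t - t0)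
         + integral {t0..t} (\<lambda>t. integral {-R..R} (\<lambda>x. max 0 (c * (q (x, t))\<^sup>2 - z (x, t) * q (x, t)))))"
proof -
  define E where "E = (\<lambda>t. integral {-R..R} (\<lambda>x. (P (x, t))\<^sup>2 / (1 + x\<^sup>2)))"
  \<comment> \<open>\<open>E'\<close> is half of the derivative of \<open>E\<close>.\<close>
  define E' where "E' = (\<lambda>t. integral {-R..R} (\<lambda>x. P (x, t) * qx (x, t) / (1 + x\<^sup>2)))"
  define er where "er = (\<lambda>t. integral {-R..R} (\<lambda>x. max 0 (c * (q (x, t))\<^sup>2 - z (x, t) * q (x, t))))"
  define b where "b = 2 * A * B / (1 + R\<^sup>2)"
  note cc = continuous_on_compose2[OF cP] continuous_on_compose2[OF cz]
    continuous_on_compose2[OF cq] continuous_on_compose2[OF cqx]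
  have nz: "1 + x\<^sup>2 > 0" "1 + x\<^sup>2 \<noteq> 0" for x :: real
    by (auto simp: add_pos_nonneg add_nonneg_eq_0_iff)
  have AB: "0 \<le> A" "0 \<le> B" using A[OF t, of 0] B[OF t, of 0] by linarith+
  have b0: "b \<ge> 0" unfolding b_def using AB nz by (auto intro!: divide_nonneg_pos)
  have er0: "er t \<ge> 0" for t
    unfolding er_def by (intro integral_nonneg integrable_continuous_real continuous_intros cc) auto
  have E: "(E has_real_derivative 2 * E' t) (at t)" for t
  proof -
    have "((\<lambda>t. integral (cbox (-R) R) (\<lambda>x. (P (x, t))\<^sup>2 / (1 + x\<^sup>2))) has_real_derivative
       integral (cbox (-R) R) (\<lambda>x. 2 * (P (x, t) * qx (x, t) / (1 + x\<^sup>2)))) (at t within UNIV)"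
    proof (rule leibniz_rule_field_derivative)
      fix t x
      show "((\<lambda>t. (P (x, t))\<^sup>2 / (1 + x\<^sup>2)) has_real_derivative 2 * (P (x, t) * qx (x, t) / (1 + x\<^sup>2))) (at t within UNIV)"
        by (auto intro!: derivative_eq_intros P_t simp: nz)
      show "(\<lambda>x. (P (x, t))\<^sup>2 / (1 + x\<^sup>2)) integrable_on cbox (-R) R"
        by (intro integrable_continuous continuous_intros cc) (auto simp: nz)
      show "continuous_on (UNIV \<times> cbox (-R) R) (\<lambda>(t, x). 2 * (P (x, t) * qx (x, t) / (1 + x\<^sup>2)))"
        unfolding split_beta by (intro continuous_intros cc) (auto simp: nz)
    qed auto
    then show ?thesis unfolding E_def E'_def by (simp only: integral_mult_right cbox_interval)
  qed
  have cer: "continuous_on UNIV er"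
  proof -
    have "continuous_on UNIV (\<lambda>t. integral (cbox (-R) R) (\<lambda>x. max 0 (c * (q (x, t))\<^sup>2 - z (x, t) * q (x, t))))"
      by (intro integral_continuous_on_param)
        (unfold split_beta, intro continuous_intros cc, auto)
    then show ?thesis unfolding er_def by simp
  qed
  have ineq: "E' t \<le> b + er t + E t / (4 * c)" if t: "t \<in> {t0..T}" for t
  proof -
    \<comment> \<open>\<open>?g\<close> is the boundary term of the integration by parts and
      \<open>?g'\<close> its derivative; \<open>?r\<close> is chosen such that
      \<open>?g' + ?r\<close> is the integrand of \<open>E'\<close>.\<close>
    let ?g = "\<lambda>x. P (x, t) * q (x, t) / (1 + x\<^sup>2)"
    let ?g' = "\<lambda>x. P (x, t) * qx (x, t) / (1 + x\<^sup>2) + (z (x, t) * q (x, t) / (1 + x\<^sup>2)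
         - 2 * x * (P (x, t) * q (x, t)) / (1 + x\<^sup>2)\<^sup>2)"
    let ?r = "\<lambda>x. 2 * x * (P (x, t) * q (x, t)) / (1 + x\<^sup>2)\<^sup>2 - z (x, t) * q (x, t) / (1 + x\<^sup>2)"
    have "(?g has_real_derivative ?g' x) (at x)" for x
      by (rule derivative_eq_intros P_x q_x refl nz)+
         (simp add: nz divide_simps power2_eq_square, simp add: algebra_simps)
    then have ftc: "(?g' has_integral ?g R - ?g (- R)) {-R..R}"
      using R by (intro fundamental_theorem_of_calculus)
        (auto simp: has_real_derivative_iff_has_vector_derivative[symmetric] intro: DERIV_subset)
    have i2: "?r integrable_on {-R..R}"
      and i3: "(\<lambda>x. max 0 (c * (q (x, t))\<^sup>2 - z (x, t) * q (x, t))) integrable_on {-R..R}"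
      and i4: "(\<lambda>x. (P (x, t))\<^sup>2 / (1 + x\<^sup>2)) integrable_on {-R..R}"
      by (intro integrable_continuous_real continuous_intros cc; auto simp: nz)+
    have i5: "(\<lambda>x. (P (x, t))\<^sup>2 / (1 + x\<^sup>2) / (4 * c)) integrable_on {-R..R}"
      using i4 by (rule integrable_on_divide)
    have "E' t = integral {-R..R} (\<lambda>x. ?g' x + ?r x)"
      unfolding E'_def by simp
    also have "\<dots> = (?g R - ?g (- R)) + integral {-R..R} ?r"
      using ftc i2 by (subst Henstock_Kurzweil_Integration.integral_add) (auto simp: integral_unique)
    also have "?g R - ?g (- R) \<le> b"
    proof -
      have g: "\<bar>P (x, t) * q (x, t) / (1 + R\<^sup>2)\<bar> \<le> A * B / (1 + R\<^sup>2)" for x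
        using mult_mono[OF A[OF t, of x] B[OF t, of x]] AB nz(1)[of R]
        by (auto simp: abs_mult divide_right_mono mult.commute)
      have "?g R - ?g (- R) \<le> A * B / (1 + R\<^sup>2) + A * B / (1 + R\<^sup>2)"
        using g[of R] g[of "-R"] unfolding abs_le_iff power2_minus by linarith
      then show ?thesis unfolding b_def by simp
    qed
    also have "integral {-R..R} ?r \<le> integral {-R..R} (\<lambda>x. max 0 (c * (q (x, t))\<^sup>2 - z (x, t) * q (x, t))
         + (P (x, t))\<^sup>2 / (1 + x\<^sup>2) / (4 * c))"
    proof (rule integral_le[OF i2])
      show "(\<lambda>x. max 0 (c * (q (x, t))\<^sup>2 - z (x, t) * q (x, t)) + (P (x, t))\<^sup>2 / (1 + x\<^sup>2) / (4 * c)) integrable_on {-R..R}"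
        by (intro integrable_add i3 i5)
      fix x
      let ?p = "P (x, t)" and ?q = "q (x, t)" and ?z = "z (x, t)" and ?w = "1 + x\<^sup>2"
      \<comment> \<open>The square of |x| - 1 is nonnegative. This is the place where the particular
        weight matters: differentiating it costs no more than the weight itself.\<close>
      have "\<bar>2 * x\<bar> \<le> ?w"
        using sum_power2_ge_zero[of "\<bar>x\<bar> - 1" 0] by (simp add: power2_diff)
      then have "2 * x * (?p * ?q) \<le> ?w * (\<bar>?p\<bar> * \<bar>?q\<bar>)"
        using mult_right_mono[of "\<bar>2*x\<bar>" ?w "\<bar>?p\<bar> * \<bar>?q\<bar>"] abs_le_D1[of "2 * x * (?p * ?q)"]
        by (auto simp: abs_mult)
      then have "2 * x * (?p * ?q) / ?w\<^sup>2 \<le> ?w * (\<bar>?p\<bar> * \<bar>?q\<bar>) / ?w\<^sup>2"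
        by (intro divide_right_mono) auto
      also have "\<dots> = (\<bar>?p\<bar> * \<bar>?q\<bar>) / ?w"
        using nz[of x] by (simp add: power2_eq_square)
      \<comment> \<open>Young's inequality, balanced so that the coefficient of
        \<open>?q\<^sup>2\<close> is the \<open>c\<close> that the product of \<open>?z\<close> and
        \<open>?q\<close> can absorb.\<close>
      also have "\<bar>?p\<bar> * \<bar>?q\<bar> \<le> c * ?q\<^sup>2 + ?p\<^sup>2 / (4 * c)"
      proof -
        have "0 \<le> (2 * c * \<bar>?q\<bar> - \<bar>?p\<bar>)\<^sup>2" by simp
        also have "\<dots> = 4 * c * (c * ?q\<^sup>2 + ?p\<^sup>2 / (4 * c) - \<bar>?p\<bar> * \<bar>?q\<bar>)"
          using c by (simp add: power2_diff algebra_simps power_mult_distrib) (simp add: power2_eq_square)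
        finally show ?thesis using c by (simp add: zero_le_mult_iff)
      qed
      finally have "2 * x * (?p * ?q) / ?w\<^sup>2 \<le> (c * ?q\<^sup>2 + ?p\<^sup>2 / (4 * c)) / ?w"
        using nz[of x] by (simp add: divide_right_mono)
      then have "?r x \<le> (c * ?q\<^sup>2 - ?z * ?q) / ?w + ?p\<^sup>2 / (4 * c) / ?w"
        by (simp add: add_divide_distrib diff_divide_distrib)
      \<comment> \<open>Dividing by \<open>?w\<close>, which is at least 1, only helps when the
        numerator is nonnegative; the truncation at 0 takes care of the other sign.\<close>
      also have "(c * ?q\<^sup>2 - ?z * ?q) / ?w \<le> max 0 (c * ?q\<^sup>2 - ?z * ?q)"
      proof (cases "c * ?q\<^sup>2 - ?z * ?q \<ge> 0")
        case True
        then have "(c * ?q\<^sup>2 - ?z * ?q) / ?w \<le> c * ?q\<^sup>2 - ?z * ?q"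
          by (intro mult_imp_div_pos_le nz) (simp add: mult_le_cancel_left1)
        then show ?thesis by simp
      next
        case False
        then show ?thesis using nz(1)[of x] by (simp add: divide_le_0_iff max_def)
      qed
      finally show "?r x \<le> max 0 (c * ?q\<^sup>2 - ?z * ?q) + ?p\<^sup>2 / ?w / (4 * c)"
        by (simp add: mult.commute mult.left_commute)
    qed
    also have "\<dots> = er t + E t / (4 * c)"
      unfolding er_def E_def Henstock_Kurzweil_Integration.integral_add[OF i3 i5] integral_divide ..
    finally show ?thesis by simp
  qed
  \<comment> \<open>Gronwall's integrating factor times \<open>E\<close>, minus the claimed bound,
    is nonincreasing. The integral of \<open>er\<close> starts at \<open>t0 - 1\<close> so that it
    has a two-sided derivative at \<open>t0\<close> as well; the surplus piece cancels when
    \<open>h t\<close> is compared with \<open>h t0\<close>.\<close>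
  define h where "h = (\<lambda>t. exp (- ((t - t0) / (2 * c))) * E t - 2 * (b * (t - t0) + integral {t0-1..t} er))"
  define h' where "h' = (\<lambda>t. exp (- ((t - t0) / (2 * c))) * (2 * E' t - E t / (2 * c)) - 2 * (b + er t))"
  have hd: "(h has_real_derivative h' s) (at s)" if "s \<in> {t0..T}" for s
  proof -
    have "((\<lambda>t. exp (- ((t - t0) / (2 * c)))) has_real_derivative exp (- ((s - t0) / (2 * c))) * (- 1 / (2 * c))) (at s)"
      using c by (auto intro!: derivative_eq_intros)
    from DERIV_mult[OF this E[of s]] 
    have "((\<lambda>t. exp (- ((t - t0) / (2 * c))) * E t) has_real_derivative
        exp (- ((s - t0) / (2 * c))) * (2 * E' s - E s / (2 * c))) (at s)"
      by (rule DERIV_cong) (simp add: algebra_simps)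
    moreover have "((\<lambda>t. b * (t - t0)) has_real_derivative b) (at s)"
      by (auto intro!: derivative_eq_intros)
    ultimately show ?thesis
      unfolding h_def h'_def
      by (intro DERIV_diff DERIV_cmult DERIV_add integral_upper_deriv cer) (use that in auto)
  qed
  have "h' s \<le> 0" if "s \<in> {t0..T}" for s
  proof -
    have "exp (- ((s - t0) / (2 * c))) * (2 * E' s - E s / (2 * c)) \<le> exp (- ((s - t0) / (2 * c))) * (2 * (b + er s))"
      using ineq[OF that] by (intro mult_left_mono) auto
    also have "\<dots> \<le> 1 * (2 * (b + er s))"
      using b0 er0[of s] that c by (intro mult_right_mono) auto
    finally show ?thesis unfolding h'_def by simp
  qed
  then have "h t \<le> h t0"
    using t hd by (intro DERIV_nonpos_imp_nonincreasing[of t0 t h]) (force+)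
  moreover have "E t0 = 0" unfolding E_def by (simp add: P0)
  moreover have "integral {t0-1..t} er = integral {t0-1..t0} er + integral {t0..t} er"
    using t by (intro Henstock_Kurzweil_Integration.integral_combine[symmetric] integrable_continuous_real continuous_on_subset[OF cer]) auto
  ultimately have "exp (- ((t - t0) / (2 * c))) * E t \<le> 2 * (b * (t - t0) + integral {t0..t} er)"
    unfolding h_def by simp
  then have "E t \<le> 2 * exp ((t - t0) / (2 * c)) * (b * (t - t0) + integral {t0..t} er)"
    by (simp add: exp_minus field_simps)
  then show ?thesis unfolding er_def b_def E_def by simp
qed

section \<open>Mollification\<close>

lemma tendsto_integral_dominated:
  fixes f :: "'c::first_countable_topology \<Rightarrow> 'a \<Rightarrow> real"
  assumes lim: "\<And>y. ((\<lambda>x. f x y) \<longlongrightarrow> g y) (at x0)"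
    and bound: "\<forall>\<^sub>F x in at x0. \<forall>y. \<bar>f x y\<bar> \<le> w y"
    and w: "integrable M w"
    and meas: "\<And>x. f x \<in> borel_measurable M" "g \<in> borel_measurable M"
  shows "((\<lambda>x. \<integral>y. f x y \<partial>M) \<longlongrightarrow> (\<integral>y. g y \<partial>M)) (at x0)"
  unfolding tendsto_at_iff_sequentially
proof (intro allI impI)
  fix X :: "nat \<Rightarrow> 'c"
  assume X: "\<forall>i. X i \<in> UNIV - {x0}" "X \<longlonglongrightarrow> x0"
  then have F: "filterlim X (at x0) sequentially"
    by (auto simp: filterlim_at)
  obtain N where N: "\<And>n y. n \<ge> N \<Longrightarrow> \<bar>f (X n) y\<bar> \<le> w y"
    using filterlim_iff[THEN iffD1, OF F, rule_format, OF bound]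
    unfolding eventually_sequentially by blast
  have "(\<lambda>n. \<integral>y. f (X (n + N)) y \<partial>M) \<longlonglongrightarrow> (\<integral>y. g y \<partial>M)"
  proof (rule integral_dominated_convergence[OF _ _ w])
    show "AE y in M. (\<lambda>n. f (X (n + N)) y) \<longlonglongrightarrow> g y"
    proof (rule AE_I2)
      fix y show "(\<lambda>n. f (X (n + N)) y) \<longlonglongrightarrow> g y"
        using LIMSEQ_ignore_initial_segment[OF filterlim_compose[OF lim F], of N y] by simp
    qed
    show "AE y in M. norm (f (X (n + N)) y) \<le> w y" for n
      using N[of "n + N"] by simp
  qed (use meas in auto)
  then show "((\<lambda>x. \<integral>y. f x y \<partial>M) \<circ> X) \<longlonglongrightarrow> (\<integral>y. g y \<partial>M)"
    unfolding o_def by (rule LIMSEQ_offset)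
qed

text \<open>By the mean value theorem each difference quotient is a value of \<open>f'\<close> at an
  intermediate point, so \<open>w\<close> dominates it and dominated convergence applies.\<close>

lemma has_real_derivative_integral:
  fixes f f' :: "real \<Rightarrow> 'a \<Rightarrow> real"
  assumes deriv: "\<And>x y. ((\<lambda>x. f x y) has_real_derivative f' x y) (at x)"
    and int: "\<And>x. integrable M (f x)"
    and meas: "f' x0 \<in> borel_measurable M"
    and w: "integrable M w"
    and bound: "\<And>x y. \<bar>x - x0\<bar> \<le> 1 \<Longrightarrow> \<bar>f' x y\<bar> \<le> w y"
  shows "((\<lambda>x. \<integral>y. f x y \<partial>M) has_real_derivative (\<integral>y. f' x0 y \<partial>M)) (at x0)"
proof -
  have "((\<lambda>x. \<integral>y. (f x y - f x0 y) / (x - x0) \<partial>M) \<longlongrightarrow> (\<integral>y. f' x0 y \<partial>M)) (at x0)"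
  proof (rule tendsto_integral_dominated[OF _ _ w])
    show "((\<lambda>x. (f x y - f x0 y) / (x - x0)) \<longlongrightarrow> f' x0 y) (at x0)" for y
      using deriv[of y x0] by (simp add: has_field_derivative_iff)
    have "\<bar>(f x y - f x0 y) / (x - x0)\<bar> \<le> w y" if x: "x \<noteq> x0" "dist x x0 < 1" for x y
    proof -
      have "\<exists>\<xi>. \<bar>\<xi> - x0\<bar> \<le> 1 \<and> f x y - f x0 y = (x - x0) * f' \<xi> y"
      proof (cases "x < x0")
        case True
        from MVT2[OF this deriv] obtain \<xi> where "x < \<xi>" "\<xi> < x0" "f x0 y - f x y = (x0 - x) * f' \<xi> y"
          by blast
        then show ?thesis using x by (intro exI[of _ \<xi>]) (auto simp: dist_real_def algebra_simps)
      next
        case False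
        then have "x0 < x" using x by auto
        from MVT2[OF this deriv] obtain \<xi> where "x0 < \<xi>" "\<xi> < x" "f x y - f x0 y = (x - x0) * f' \<xi> y"
          by blast
        then show ?thesis using x by (intro exI[of _ \<xi>]) (auto simp: dist_real_def algebra_simps)
      qed
      then obtain \<xi> where "\<bar>\<xi> - x0\<bar> \<le> 1" "f x y - f x0 y = (x - x0) * f' \<xi> y" by blast
      then show ?thesis using bound[of \<xi> y] x by simp
    qed
    then show "\<forall>\<^sub>F x in at x0. \<forall>y. \<bar>(f x y - f x0 y) / (x - x0)\<bar> \<le> w y"
      unfolding eventually_at by (intro exI[of _ 1]) auto
  qed (use int meas in auto)
  moreover have "(\<integral>y. (f x y - f x0 y) / (x - x0) \<partial>M) = ((\<integral>y. f x y \<partial>M) - (\<integral>y. f x0 y \<partial>M)) / (x - x0)" for x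
    unfolding integral_divide_zero Bochner_Integration.integral_diff[OF int int] ..
  ultimately show ?thesis unfolding has_field_derivative_iff by (simp only:)
qed

lemma integrable_bounded_support:
  fixes g :: "'a::euclidean_space \<Rightarrow> real"
  assumes "g \<in> borel_measurable borel" and le: "\<And>x. \<bar>g x\<bar> \<le> C * indicator (cbox a b) x"
  shows "integrable lborel g"
proof (rule Bochner_Integration.integrable_bound)
  show "integrable lborel (\<lambda>x. C * indicator (cbox a b) x)"
    using emeasure_lborel_cbox_finite[of a b] by (intro integrable_mult_right integrable_real_indicator) auto
  show "AE x in lborel. norm (g x) \<le> norm (C * indicator (cbox a b) x)"
    by (intro AE_I2 order_trans[OF _ abs_ge_self[of "C * indicator (cbox a b) x" for x], folded real_norm_def]) (simp add: le)
qed (use assms in simp)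

lemma set_integrable_cbox_bounded:
  fixes g :: "'a::euclidean_space \<Rightarrow> real"
  assumes [measurable]: "g \<in> borel_measurable borel" and le: "\<And>x. \<bar>g x\<bar> \<le> C"
  shows "set_integrable lborel (cbox a b) g"
  unfolding set_integrable_def
  by (rule integrable_bounded_support[where C=C and a=a and b=b]) (use le in \<open>auto simp: indicator_def\<close>)

section \<open>Space-time convolutions with product kernels\<close>

definition conv :: "(real \<Rightarrow> real) \<Rightarrow> (real \<Rightarrow> real) \<Rightarrow> (real \<times> real \<Rightarrow> real) \<Rightarrow> real \<times> real \<Rightarrow> real" where
  "conv a b g p = (LINT p'|lborel. g p' * (a (fst p - fst p') * b (snd p - snd p')))"

definition compact_kernel :: "(real \<Rightarrow> real) \<Rightarrow> bool" where
  "compact_kernel a \<longleftrightarrow> continuous_on UNIV a \<and> (\<forall>r. \<bar>r\<bar> \<ge> 1 \<longrightarrow> a r = 0)"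

text \<open>Vanishing is demanded on one side only, so that a smoothed step function qualifies.
  Against a function that is zero up to time 0, such a kernel sees at time \<open>t\<close> only the
  times between 0 and \<open>t + 1\<close>. The margin 1 leaves room for kernels centred at
  0.\<close>

definition causal_kernel :: "(real \<Rightarrow> real) \<Rightarrow> bool" where
  "causal_kernel b \<longleftrightarrow> continuous_on UNIV b \<and> (\<forall>r\<le>-1. b r = 0)"

lemma compact_imp_causal_kernel: "compact_kernel a \<Longrightarrow> causal_kernel a"
  by (auto simp: compact_kernel_def causal_kernel_def)

lemma compact_kernel_bounded:
  assumes "compact_kernel a"
  obtains C where "C \<ge> 0" "\<And>r. \<bar>a r\<bar> \<le> C"
proof -
  have "compact (a ` {-1..1})"
    by (intro compact_continuous_image) (use assms in \<open>auto simp: compact_kernel_def intro: continuous_on_subset\<close>)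
  then obtain C where C: "\<And>r. r \<in> {-1..1} \<Longrightarrow> \<bar>a r\<bar> \<le> C"
    by (meson bounded_real compact_imp_bounded imageI)
  have "\<bar>a r\<bar> \<le> max C 0" for r
    using C[of r] assms by (cases "r \<in> {-1..1}") (auto simp: compact_kernel_def abs_if)
  then show thesis by (intro that[of "max C 0"]) auto
qed

lemma causal_kernel_bounded:
  assumes "causal_kernel b"
  obtains C where "C \<ge> 0" "\<And>r. r \<le> t \<Longrightarrow> \<bar>b r\<bar> \<le> C"
proof -
  have "compact (b ` {-1..t})"
    by (intro compact_continuous_image) (use assms in \<open>auto simp: causal_kernel_def intro: continuous_on_subset\<close>)
  then obtain C where C: "\<And>r. r \<in> {-1..t} \<Longrightarrow> \<bar>b r\<bar> \<le> C"
    by (meson bounded_real compact_imp_bounded imageI)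
  have "\<bar>b r\<bar> \<le> max C 0" if "r \<le> t" for r
    using C[of r] that assms by (cases "r \<le> -1") (auto simp: causal_kernel_def)
  then show thesis by (intro that[of "max C 0"]) auto
qed

locale bounded_forward =
  fixes g :: "real \<times> real \<Rightarrow> real" and M :: real
  assumes g_meas [measurable]: "g \<in> borel_measurable borel"
    and g_bound: "\<bar>g p\<bar> \<le> M"
    and g_past: "snd p \<le> 0 \<Longrightarrow> g p = 0"
begin

lemma M_nonneg: "M \<ge> 0"
  using g_bound[of 0] by linarith

lemma conv_meas:
  assumes "continuous_on UNIV a" "continuous_on UNIV b"
  shows "(\<lambda>p'. g p' * (a (fst p - fst p') * b (snd p - snd p'))) \<in> borel_measurable borel"
  by (intro borel_measurable_times g_meas borel_measurable_continuous_onI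
    continuous_on_compose2[OF assms(1)] continuous_on_compose2[OF assms(2)] continuous_intros) auto

text \<open>A single majorant for all \<open>p\<close> whose coordinates are within 1 of those of
  \<open>p0\<close>. In space the support of \<open>a\<close> confines \<open>p'\<close>; in time
  the zero past of \<open>g\<close> and the one-sided support of \<open>b\<close> do. The 2 in the
  box is 1 for moving \<open>p\<close> and 1 for the kernel. Continuity and both differentiations
  rest on this majorant.\<close>

lemma conv_dominated:
  assumes "compact_kernel a" "causal_kernel b"
  obtains w where "integrable lborel w"
    "\<And>p p'. \<bar>fst p - fst p0\<bar> \<le> 1 \<Longrightarrow> \<bar>snd p - snd p0\<bar> \<le> 1
      \<Longrightarrow> \<bar>g p' * (a (fst p - fst p') * b (snd p - snd p'))\<bar> \<le> w p'"
proof -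
  obtain A where A: "A \<ge> 0" "\<And>r. \<bar>a r\<bar> \<le> A" using compact_kernel_bounded[OF assms(1)] by blast
  obtain B where B: "B \<ge> 0" "\<And>r. r \<le> snd p0 + 1 \<Longrightarrow> \<bar>b r\<bar> \<le> B" using causal_kernel_bounded[OF assms(2)] by blast
  let ?K = "cbox (fst p0 - 2, 0) (fst p0 + 2, snd p0 + 2)"
  let ?w = "\<lambda>p'. (M * (A * B)) * indicator ?K p'"
  show thesis
  proof (rule that[of ?w])
    show "integrable lborel ?w"
      by (intro integrable_mult_right integrable_real_indicator) (auto simp: emeasure_lborel_cbox_eq)
    fix p p' :: "real \<times> real"
    assume p: "\<bar>fst p - fst p0\<bar> \<le> 1" "\<bar>snd p - snd p0\<bar> \<le> 1"
    show "\<bar>g p' * (a (fst p - fst p') * b (snd p - snd p'))\<bar> \<le> ?w p'"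
    proof (cases "p' \<in> ?K")
      case True
      then have "snd p - snd p' \<le> snd p0 + 1" using p by (cases p') auto
      then show ?thesis
        using A B g_bound[of p'] M_nonneg True
        by (auto simp: abs_mult intro!: mult_mono)
    next
      case False
      then consider "\<bar>fst p - fst p'\<bar> \<ge> 1" | "snd p' \<le> 0" | "snd p - snd p' \<le> -1"
        using p by (cases p') (auto simp: abs_if split: if_splits)
      then have "g p' * (a (fst p - fst p') * b (snd p - snd p')) = 0"
        using assms g_past[of p'] by cases (auto simp: compact_kernel_def causal_kernel_def)
      then show ?thesis using False by simp
    qed
  qed
qed

lemma conv_integrable:
  assumes "compact_kernel a" "causal_kernel b"
  shows "integrable lborel (\<lambda>p'. g p' * (a (fst p - fst p') * b (snd p - snd p')))"
proof -
  obtain w where w: "integrable lborel w" "\<And>p'. \<bar>g p' * (a (fst p - fst p') * b (snd p - snd p'))\<bar> \<le> w p'"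
    using conv_dominated[OF assms, of p] by (metis abs_zero diff_self zero_le_one)
  have "(\<lambda>p'. g p' * (a (fst p - fst p') * b (snd p - snd p'))) \<in> borel_measurable borel"
    using assms by (intro conv_meas) (auto simp: compact_kernel_def causal_kernel_def)
  then show ?thesis
    by (intro Bochner_Integration.integrable_bound[OF w(1)]) (use w(2) in \<open>auto intro!: AE_I2 order_trans[OF w(2)]\<close>)
qed

lemma conv_continuous:
  assumes "compact_kernel a" "causal_kernel b"
  shows "continuous_on UNIV (conv a b g)"
proof -
  have ab: "continuous_on UNIV a" "continuous_on UNIV b"
    using assms by (auto simp: compact_kernel_def causal_kernel_def)
  have "(conv a b g \<longlongrightarrow> conv a b g p0) (at p0)" for p0
  proof -
    obtain w where w: "integrable lborel w"
      "\<And>p p'. \<bar>fst p - fst p0\<bar> \<le> 1 \<Longrightarrow> \<bar>snd p - snd p0\<bar> \<le> 1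
      \<Longrightarrow> \<bar>g p' * (a (fst p - fst p') * b (snd p - snd p'))\<bar> \<le> w p'"
      using conv_dominated[OF assms, of p0] by metis
    show ?thesis
      unfolding conv_def[abs_def]
    proof (rule tendsto_integral_dominated[OF _ _ w(1)])
      fix p'
      have "continuous_on UNIV (\<lambda>p. g p' * (a (fst p - fst p') * b (snd p - snd p')))"
        by (intro continuous_intros continuous_on_compose2[OF ab(1)] continuous_on_compose2[OF ab(2)]) auto
      then show "((\<lambda>p. g p' * (a (fst p - fst p') * b (snd p - snd p'))) \<longlongrightarrow> g p' * (a (fst p0 - fst p') * b (snd p0 - snd p'))) (at p0)"
        unfolding continuous_on_def by (cases p0) auto
    next
      have "\<forall>p'. \<bar>g p' * (a (fst p - fst p') * b (snd p - snd p'))\<bar> \<le> w p'" if "dist p p0 < 1" for p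
      proof -
        have "dist (fst p) (fst p0) \<le> 1" "dist (snd p) (snd p0) \<le> 1"
          using that dist_fst_le[of p p0] dist_snd_le[of p p0] by linarith+
        then show ?thesis by (intro allI w(2)) (auto simp: dist_real_def)
      qed
      then show "\<forall>\<^sub>F p in at p0. \<forall>p'. \<bar>g p' * (a (fst p - fst p') * b (snd p - snd p'))\<bar> \<le> w p'"
        unfolding eventually_at by (intro exI[of _ 1]) auto
    qed (use conv_meas[OF ab] in auto)
  qed
  then show ?thesis by (auto simp: continuous_on_def)
qed

lemma conv_deriv_fst:
  assumes a: "\<And>r. (a has_real_derivative a' r) (at r)"
    and "compact_kernel a" "compact_kernel a'" "causal_kernel b"
  shows "((\<lambda>x. conv a b g (x, t)) has_real_derivative conv a' b g (x, t)) (at x)"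
proof -
  obtain w where w: "integrable lborel w"
      "\<And>p p'. \<bar>fst p - x\<bar> \<le> 1 \<Longrightarrow> \<bar>snd p - t\<bar> \<le> 1
      \<Longrightarrow> \<bar>g p' * (a' (fst p - fst p') * b (snd p - snd p'))\<bar> \<le> w p'"
    using conv_dominated[OF assms(3,4), of "(x, t)"] by (metis fst_conv snd_conv)
  show ?thesis
    unfolding conv_def fst_conv snd_conv
  proof (rule has_real_derivative_integral[OF _ _ _ w(1)])
    fix x and p' :: "real \<times> real"
    have "((\<lambda>x. x - fst p') has_real_derivative 1) (at x)"
      by (auto intro!: derivative_eq_intros)
    from DERIV_chain2[OF a this] have "((\<lambda>x. a (x - fst p')) has_real_derivative a' (x - fst p')) (at x)"
      by simp
    then show "((\<lambda>x. g p' * (a (x - fst p') * b (t - snd p'))) has_real_derivative g p' * (a' (x - fst p') * b (t - snd p'))) (at x)"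
      by (intro DERIV_cmult DERIV_cmult_right)
  next
    show "integrable lborel (\<lambda>p'. g p' * (a (x - fst p') * b (t - snd p')))" for x
      using conv_integrable[OF assms(2,4), of "(x, t)"] by simp
    show "(\<lambda>p'. g p' * (a' (x - fst p') * b (t - snd p'))) \<in> borel_measurable lborel"
      using borel_measurable_integrable[OF conv_integrable[OF assms(3,4), of "(x, t)"]] by simp
    show "\<bar>g p' * (a' (y - fst p') * b (t - snd p'))\<bar> \<le> w p'" if "\<bar>y - x\<bar> \<le> 1" for y p'
      using w(2)[of "(y, t)" p'] that by simp
  qed
qed

lemma conv_deriv_snd:
  assumes b: "\<And>r. (b has_real_derivative b' r) (at r)"
    and "compact_kernel a" "causal_kernel b" "causal_kernel b'"
  shows "((\<lambda>t. conv a b g (x, t)) has_real_derivative conv a b' g (x, t)) (at t)"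
proof -
  obtain w where w: "integrable lborel w"
      "\<And>p p'. \<bar>fst p - x\<bar> \<le> 1 \<Longrightarrow> \<bar>snd p - t\<bar> \<le> 1
      \<Longrightarrow> \<bar>g p' * (a (fst p - fst p') * b' (snd p - snd p'))\<bar> \<le> w p'"
    using conv_dominated[OF assms(2,4), of "(x, t)"] by (metis fst_conv snd_conv)
  show ?thesis
    unfolding conv_def fst_conv snd_conv
  proof (rule has_real_derivative_integral[OF _ _ _ w(1)])
    fix t and p' :: "real \<times> real"
    have "((\<lambda>t. t - snd p') has_real_derivative 1) (at t)"
      by (auto intro!: derivative_eq_intros)
    from DERIV_chain2[OF b this] have "((\<lambda>t. b (t - snd p')) has_real_derivative b' (t - snd p')) (at t)"
      by simp
    then show "((\<lambda>t. g p' * (a (x - fst p') * b (t - snd p'))) has_real_derivative g p' * (a (x - fst p') * b' (t - snd p'))) (at t)"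
      by (intro DERIV_cmult)
  next
    show "integrable lborel (\<lambda>p'. g p' * (a (x - fst p') * b (t - snd p')))" for t
      using conv_integrable[OF assms(2,3), of "(x, t)"] by simp
    show "(\<lambda>p'. g p' * (a (x - fst p') * b' (t - snd p'))) \<in> borel_measurable lborel"
      using borel_measurable_integrable[OF conv_integrable[OF assms(2,4), of "(x, t)"]] by simp
    show "\<bar>g p' * (a (x - fst p') * b' (y - snd p'))\<bar> \<le> w p'" if "\<bar>y - t\<bar> \<le> 1" for y p'
      using w(2)[of "(x, y)" p'] that by simp
  qed
qed

end

section \<open>Smooth kernels of unit mass\<close>

locale mollifier =
  fixes \<delta> :: real and k k1 k2 :: "real \<Rightarrow> real"
  assumes \<delta>: "0 < \<delta>" "\<delta> \<le> 1"
    and k_deriv: "(k has_real_derivative k1 r) (at r)"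
    and k1_deriv: "(k1 has_real_derivative k2 r) (at r)"
    and k2_cont: "continuous_on UNIV k2"
    and k_supp: "\<bar>r\<bar> \<ge> \<delta> \<Longrightarrow> k r = 0" "\<bar>r\<bar> \<ge> \<delta> \<Longrightarrow> k1 r = 0" "\<bar>r\<bar> \<ge> \<delta> \<Longrightarrow> k2 r = 0"
    and k_nonneg: "k r \<ge> 0"
    and k_int: "(\<integral>\<^sup>+r. ennreal (k r) \<partial>lborel) = 1"
begin

lemma k_cont: "continuous_on UNIV k"
  by (rule DERIV_continuous_on[OF has_field_derivative_at_within[OF k_deriv]])

lemma k1_cont: "continuous_on UNIV k1"
  by (rule DERIV_continuous_on[OF has_field_derivative_at_within[OF k1_deriv]])

lemma k_meas [measurable]: "k \<in> borel_measurable borel"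
  by (rule borel_measurable_continuous_onI[OF k_cont])

lemma compact_kernels: "compact_kernel k" "compact_kernel k1" "compact_kernel k2"
  using k_supp k_cont k1_cont k2_cont \<delta> by (auto simp: compact_kernel_def)

text \<open>A smoothed Heaviside function: convolving with it in time is a smoothed integration over
  the past. The lower limit lies at least 1 to the left of the support of \<open>k\<close>, so the
  two regions treated separately in \<open>H_deriv\<close> overlap.\<close>

definition H :: "real \<Rightarrow> real" where
  "H r = integral {-2..r} k"

lemma H_past: "r \<le> -1 \<Longrightarrow> H r = 0"
  unfolding H_def by (rule integral_unique, rule has_integral_is_0) (use k_supp \<delta> in auto)

lemma H_deriv: "(H has_real_derivative k r) (at r)"
proof (cases "r > -2")
  case True
  then show ?thesis
    unfolding H_def[abs_def] by (intro integral_upper_deriv k_cont) simp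
next
  case False
  then have "((\<lambda>_. 0) has_real_derivative k r) (at r)"
    using k_supp(1)[of r] \<delta> by simp
  then show ?thesis
    by (rule has_field_derivative_transform_within_open[where S="{..< -1}"]) (use False H_past in auto)
qed

lemma causal_kernels: "causal_kernel k" "causal_kernel H"
proof -
  have "continuous_on UNIV H"
    by (rule DERIV_continuous_on[OF has_field_derivative_at_within[OF H_deriv]])
  then show "causal_kernel H" using H_past by (auto simp: causal_kernel_def)
qed (rule compact_imp_causal_kernel[OF compact_kernels(1)])

lemma k_nn_integral_left: "(\<integral>\<^sup>+r. ennreal (k (x - r)) \<partial>lborel) = 1"
  using nn_integral_real_affine[of "\<lambda>r. ennreal (k r)" "-1" x] k_int by simp

lemma k_nn_integral_right: "(\<integral>\<^sup>+r. ennreal (k (r - x)) \<partial>lborel) = 1"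
  using nn_integral_real_affine[of "\<lambda>r. ennreal (k r)" "1" "-x"] k_int by simp

lemma kk_nn_integral:
  assumes [measurable]: "a \<in> borel_measurable borel" "b \<in> borel_measurable borel"
   and "(\<integral>\<^sup>+r. ennreal (a r) \<partial>lborel) = 1" "(\<integral>\<^sup>+r. ennreal (b r) \<partial>lborel) = 1" "\<And>r. a r \<ge> 0" "\<And>r. b r \<ge> (0::real)"
  shows "(\<integral>\<^sup>+p. ennreal (a (fst p) * b (snd p)) \<partial>(lborel :: (real \<times> real) measure)) = 1"
proof -
  have "(\<integral>\<^sup>+p. ennreal (a (fst p) * b (snd p)) \<partial>(lborel :: (real \<times> real) measure))
      = (\<integral>\<^sup>+p. ennreal (a (fst p)) * ennreal (b (snd p)) \<partial>(lborel \<Otimes>\<^sub>M lborel))"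
    unfolding lborel_prod using assms by (simp add: ennreal_mult)
  also have "\<dots> = (\<integral>\<^sup>+x. (\<integral>\<^sup>+y. ennreal (a x) * ennreal (b y) \<partial>lborel) \<partial>lborel)"
    by (subst lborel.nn_integral_fst[symmetric]) auto
  also have "\<dots> = 1"
    using assms by (simp add: nn_integral_cmult)
  finally show ?thesis .
qed

lemma kk_measurable [measurable]:
  "(\<lambda>p'. ennreal (k (fst p - fst p') * k (snd p - snd p'))) \<in> borel_measurable borel"
  "(\<lambda>p. ennreal (k (fst p - fst p') * k (snd p - snd p'))) \<in> borel_measurable borel"
  "(\<lambda>x. ennreal (k (fst (fst x) - fst (snd x)) * k (snd (fst x) - snd (snd x))))
     \<in> borel_measurable (lborel \<Otimes>\<^sub>M lborel)"
  unfolding lborel_prod measurable_lborel2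
  by (intro measurable_compose[OF _ measurable_ennreal] borel_measurable_continuous_onI
      continuous_on_mult continuous_on_compose2[OF k_cont] continuous_intros; simp)+

lemma kk_nn_integral_left:
  "(\<integral>\<^sup>+p'. ennreal (k (fst p - fst p') * k (snd p - snd p')) \<partial>lborel) = 1"
  by (rule kk_nn_integral[of "\<lambda>r. k (fst p - r)" "\<lambda>r. k (snd p - r)"])
     (auto simp: k_nn_integral_left k_nonneg)

lemma kk_nn_integral_right:
  "(\<integral>\<^sup>+p'. ennreal (k (fst p' - fst p) * k (snd p' - snd p)) \<partial>lborel) = 1"
  by (rule kk_nn_integral[of "\<lambda>r. k (r - fst p)" "\<lambda>r. k (r - snd p)"])
     (auto simp: k_nn_integral_right k_nonneg)

lemma kk_has_integral:
  "has_bochner_integral lborel (\<lambda>p'. k (fst p - fst p') * k (snd p - snd p')) 1"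
proof (rule has_bochner_integral_nn_integral)
  show "(\<lambda>p'. k (fst p - fst p') * k (snd p - snd p')) \<in> borel_measurable lborel"
    by (simp, intro borel_measurable_continuous_onI continuous_on_mult continuous_on_compose2[OF k_cont] continuous_intros) auto
  show "(\<integral>\<^sup>+p'. ennreal (k (fst p - fst p') * k (snd p - snd p')) \<partial>lborel) = ennreal 1"
    using kk_nn_integral_left by simp
qed (auto simp: k_nonneg)

lemma conv_kk_bound:
  assumes g [measurable]: "g \<in> borel_measurable borel" and M: "\<And>p. \<bar>g p\<bar> \<le> M"
  shows "\<bar>conv k k g p\<bar> \<le> M"
proof -
  let ?K = "\<lambda>p'. k (fst p - fst p') * k (snd p - snd p')"
  have i: "integrable lborel ?K" "(LINT p'|lborel. ?K p') = 1"
    using has_bochner_integral_iff kk_has_integral[of p] by blast+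
  have le: "norm (g p' * ?K p') \<le> M * ?K p'" for p'
    using M[of p'] k_nonneg by (auto simp: abs_mult intro!: mult_right_mono)
  have "integrable lborel (\<lambda>p'. g p' * ?K p')"
    by (rule Bochner_Integration.integrable_bound[OF integrable_mult_right[OF i(1), of M]])
      (use borel_measurable_integrable[OF i(1)] in simp, intro AE_I2 order_trans[OF le], simp)
  then have "norm (conv k k g p) \<le> (LINT p'|lborel. M * ?K p')"
    unfolding conv_def by (intro Bochner_Integration.integral_norm_bound_integral integrable_mult_right i(1) le)
  then show ?thesis using i(2) by simp
qed

end

text \<open>At 0 the difference quotient is at most \<open>\<bar>y\<bar> ^ Suc n\<close>. Used with
  exponents 3 and 2, this gives the truncated cube in \<open>mollifier_exists\<close> its two
  derivatives.\<close>

lemma max_0_power_deriv: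
  "((\<lambda>u::real. (max 0 u) ^ Suc (Suc n)) has_real_derivative real (Suc (Suc n)) * (max 0 u) ^ Suc n) (at u)"
proof -
  consider "u > 0" | "u < 0" | "u = 0" by linarith
  then show ?thesis
  proof cases
    case 1
    have "((\<lambda>u::real. u ^ Suc (Suc n)) has_real_derivative real (Suc (Suc n)) * (max 0 u) ^ Suc n) (at u)"
      using 1 DERIV_pow[of "Suc (Suc n)" u] by simp
    then show ?thesis
      by (rule has_field_derivative_transform_within_open[where S="{0<..}"]) (use 1 in auto)
  next
    case 2
    have "((\<lambda>u::real. 0) has_real_derivative real (Suc (Suc n)) * (max 0 u) ^ Suc n) (at u)"
      using 2 by simp
    then show ?thesis
      by (rule has_field_derivative_transform_within_open[where S="{..<0}"]) (use 2 in auto)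
  next
    case 3
    have "((\<lambda>y::real. (max 0 y) ^ Suc (Suc n) / y) \<longlongrightarrow> 0) (at 0)"
    proof (rule tendsto_0_le[where K=1])
      have "isCont (\<lambda>y::real. y ^ Suc n) 0" by (intro continuous_intros)
      then show "((\<lambda>y::real. y ^ Suc n) \<longlongrightarrow> 0) (at 0)" by (simp add: isCont_def)
      have le: "norm ((max 0 y) ^ Suc (Suc n) / y) \<le> norm (y ^ Suc n) * 1" for y :: real
        by (cases "y > 0") (auto simp: max_def)
      show "\<forall>\<^sub>F y::real in at 0. norm ((max 0 y) ^ Suc (Suc n) / y) \<le> norm (y ^ Suc n) * 1"
        by (intro always_eventually allI le)
    qed
    then show ?thesis using 3 by (simp add: has_field_derivative_iff)
  qed
qed

text \<open>The kernel is a multiple of \<open>(\<delta>\<^sup>2 - r\<^sup>2) ^ 3\<close>, cut off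
  at 0. The exponent 3 is the least integer for which the second derivative is still continuous at
  the ends of the support, and a polynomial can be normalised by an explicit antiderivative.\<close>

lemma mollifier_exists:
  assumes "0 < \<delta>" "\<delta> \<le> (1::real)"
  obtains k k1 k2 where "mollifier \<delta> k k1 k2"
proof -
  \<comment> \<open>The integral of \<open>(\<delta>\<^sup>2 - r\<^sup>2) ^ 3\<close> from
    \<open>- \<delta>\<close> to \<open>\<delta>\<close> is
    \<open>32 / 35 * \<delta> ^ 7\<close>.\<close>
  define c where "c = 35 / (32 * \<delta> ^ 7)"
  define m where "m = (\<lambda>r. max 0 (\<delta>\<^sup>2 - r\<^sup>2))"
  define k where "k = (\<lambda>r. c * m r ^ 3)"
  define k1 where "k1 = (\<lambda>r. c * (3 * m r ^ 2 * (- 2 * r)))"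
  define k2 where "k2 = (\<lambda>r. c * (3 * (2 * m r * (- 2 * r)) * (- 2 * r) + 3 * m r ^ 2 * (- 2)))"
  have c: "c > 0" unfolding c_def using assms by simp
  have i: "((\<lambda>r. \<delta>\<^sup>2 - r\<^sup>2) has_real_derivative - 2 * r) (at r)" for r
    by (auto intro!: derivative_eq_intros)
  have m3: "((\<lambda>r. m r ^ 3) has_real_derivative 3 * m r ^ 2 * (- 2 * r)) (at r)" for r
    using DERIV_chain2[OF max_0_power_deriv[of 1] i] by (simp add: m_def numeral_eq_Suc)
  have m2: "((\<lambda>r. m r ^ 2) has_real_derivative 2 * m r * (- 2 * r)) (at r)" for r
    using DERIV_chain2[OF max_0_power_deriv[of 0] i] by (simp add: m_def numeral_eq_Suc)
  have m0: "m r = 0" if "\<bar>r\<bar> \<ge> \<delta>" for r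
    using power_mono[OF that, of 2] assms by (simp add: m_def)
  have "mollifier \<delta> k k1 k2"
  proof
    show "(k has_real_derivative k1 r) (at r)" for r
      unfolding k_def k1_def by (intro DERIV_cmult m3)
    have 1: "((\<lambda>r. 3 * m r ^ 2) has_real_derivative 3 * (2 * m r * (- 2 * r))) (at r)" for r
      by (intro DERIV_cmult m2)
    have 2: "((\<lambda>r. - 2 * r) has_real_derivative - 2) (at r)" for r :: real
      by (auto intro!: derivative_eq_intros)
    have "((\<lambda>r. 3 * m r ^ 2 * (- 2 * r)) has_real_derivative
        3 * (2 * m r * (- 2 * r)) * (- 2 * r) + (- 2) * (3 * m r ^ 2)) (at r)" for r
      by (rule DERIV_mult[OF 1 2])
    then show "(k1 has_real_derivative k2 r) (at r)" for r
      unfolding k1_def k2_def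
      by (intro DERIV_cmult) (simp add: mult_ac)
    show "continuous_on UNIV k2"
      unfolding k2_def m_def by (intro continuous_intros)
    show "k r = 0" "k1 r = 0" "k2 r = 0" if "\<bar>r\<bar> \<ge> \<delta>" for r
      using m0[OF that] by (auto simp: k_def k1_def k2_def)
    show "k r \<ge> 0" for r
      using c by (simp add: k_def m_def)
    define F where "F = (\<lambda>r. c * (\<delta> ^ 6 * r - \<delta> ^ 4 * r ^ 3 + 3 / 5 * \<delta>\<^sup>2 * r ^ 5 - r ^ 7 / 7))"
    have "(\<integral>\<^sup>+r. ennreal (k r) \<partial>lborel) = (\<integral>\<^sup>+r. ennreal (c * (\<delta>\<^sup>2 - r\<^sup>2) ^ 3) * indicator {-\<delta>..\<delta>} r \<partial>lborel)"
    proof (rule nn_integral_cong)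
      fix r
      show "ennreal (k r) = ennreal (c * (\<delta>\<^sup>2 - r\<^sup>2) ^ 3) * indicator {-\<delta>..\<delta>} r"
      proof (cases "\<bar>r\<bar> \<le> \<delta>")
        case True
        then have "r\<^sup>2 \<le> \<delta>\<^sup>2" using power_mono[OF True, of 2] by simp
        then show ?thesis using True by (simp add: k_def m_def abs_le_iff indicator_def)
      next
        case False
        then show ?thesis using m0[of r] by (auto simp: k_def indicator_def)
      qed
    qed
    also have "\<dots> = F \<delta> - F (- \<delta>)"
    proof (rule nn_integral_FTC_Icc)
      fix r assume "r \<in> {- \<delta>..\<delta>}"
      then have r: "- \<delta> \<le> r" "r \<le> \<delta>" by auto
      have "DERIV F r :> c * (\<delta> ^ 6 - \<delta> ^ 4 * (3 * r\<^sup>2) + 3 / 5 * \<delta>\<^sup>2 * (5 * r ^ 4) - 7 * r ^ 6 / 7)"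
        unfolding F_def by (auto intro!: derivative_eq_intros)
      also have "c * (\<delta> ^ 6 - \<delta> ^ 4 * (3 * r\<^sup>2) + 3 / 5 * \<delta>\<^sup>2 * (5 * r ^ 4) - 7 * r ^ 6 / 7) = c * (\<delta>\<^sup>2 - r\<^sup>2) ^ 3"
        by (simp add: power3_eq_cube power2_eq_square algebra_simps numeral_eq_Suc)
      finally show "DERIV F r :> c * (\<delta>\<^sup>2 - r\<^sup>2) ^ 3" .
      have "r\<^sup>2 \<le> \<delta>\<^sup>2" using r power_mono[of "\<bar>r\<bar>" \<delta> 2] by (simp add: abs_le_iff)
      then show "0 \<le> c * (\<delta>\<^sup>2 - r\<^sup>2) ^ 3" using c by simp
    qed (use assms in auto)
    also have "F \<delta> - F (- \<delta>) = 1"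
    proof -
      have "F \<delta> - F (- \<delta>) = c * (32 / 35 * \<delta> ^ 7)"
        unfolding F_def by (simp add: algebra_simps numeral_eq_Suc)
      then show ?thesis using assms by (simp add: c_def)
    qed
    finally show "(\<integral>\<^sup>+r. ennreal (k r) \<partial>lborel) = 1" by simp
  qed (use assms in auto)
  then show thesis by (rule that)
qed

section \<open>Convergence of mollifications in the mean on boxes\<close>

lemma continuous_L1_approx:
  fixes g :: "real \<times> real \<Rightarrow> real"
  assumes g [measurable]: "g \<in> borel_measurable borel" and M: "\<And>p. \<bar>g p\<bar> \<le> M" and e: "e > 0"
  obtains \<phi> where "continuous_on UNIV \<phi>" "(\<integral>\<^sup>+p. ennreal \<bar>g p - \<phi> p\<bar> * indicator (cbox a b) p \<partial>lborel) < ennreal e"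
proof -
  \<comment> \<open>\<open>measurable_on\<close> provides continuous functions that converge to
    \<open>g\<close> off a negligible set. Clamping them to the range from \<open>- M\<close> to
    \<open>M\<close> does not change the limit and gives a majorant on the box.\<close>
  have "g measurable_on UNIV"
    by (rule lebesgue_measurable_imp_measurable_on_real) (auto intro: measurable_completion)
  then obtain N G where N: "negligible N" and G: "\<And>n. continuous_on UNIV (G n)"
    "\<And>x. x \<notin> N \<Longrightarrow> (\<lambda>n. G n x) \<longlonglongrightarrow> g x"
    unfolding measurable_on_def by auto
  define \<phi> where "\<phi> = (\<lambda>(n::nat) p. max (- M) (min M (G n p)))"
  have M0: "M \<ge> 0" using M[of 0] by linarith
  have c: "continuous_on UNIV (\<phi> n)" for n
    unfolding \<phi>_def by (intro continuous_intros G)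
  have [measurable]: "\<phi> n \<in> borel_measurable borel" for n
    by (rule borel_measurable_continuous_onI[OF c])
  have lim: "(\<lambda>n. \<phi> n p) \<longlonglongrightarrow> g p" if "p \<notin> N" for p
  proof -
    have "(\<lambda>n. \<phi> n p) \<longlonglongrightarrow> max (- M) (min M (g p))"
      unfolding \<phi>_def by (intro tendsto_intros G that)
    moreover have "max (- M) (min M (g p)) = g p" using M[of p] by (auto simp: abs_le_iff max_def min_def)
    ultimately show ?thesis by simp
  qed
  have ae: "AE p in lborel. p \<notin> N"
    using N AE_not_in[of N lebesgue] by (simp add: negligible_iff_null_sets AE_completion_iff)
  have "(\<lambda>n. \<integral>\<^sup>+p. ennreal (\<bar>g p - \<phi> n p\<bar> * indicator (cbox a b) p) \<partial>lborel) \<longlonglongrightarrow> (\<integral>\<^sup>+p. ennreal 0 \<partial>(lborel :: (real \<times> real) measure))"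
  proof (rule nn_integral_dominated_convergence[where w="\<lambda>p. ennreal (2 * M) * indicator (cbox a b) p"])
    show "AE p in lborel. ennreal (\<bar>g p - \<phi> n p\<bar> * indicator (cbox a b) p) \<le> ennreal (2 * M) * indicator (cbox a b) p" for n
    proof (rule AE_I2)
      fix p
      have "\<bar>g p - \<phi> n p\<bar> \<le> 2 * M" using M[of p] M0 unfolding \<phi>_def by (auto simp: abs_le_iff)
      then show "ennreal (\<bar>g p - \<phi> n p\<bar> * indicator (cbox a b) p) \<le> ennreal (2 * M) * indicator (cbox a b) p"
        by (auto simp: indicator_def intro: ennreal_leI)
    qed
    show "(\<integral>\<^sup>+p. ennreal (2 * M) * indicator (cbox a b) p \<partial>lborel) < \<infinity>"
      using emeasure_lborel_cbox_finite[of a b]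
      by (simp add: nn_integral_cmult_indicator ennreal_mult_less_top)
    show "AE p in lborel. (\<lambda>n. ennreal (\<bar>g p - \<phi> n p\<bar> * indicator (cbox a b) p)) \<longlonglongrightarrow> ennreal 0"
      using ae
    proof eventually_elim
      case (elim p)
      have "(\<lambda>n. \<bar>g p - \<phi> n p\<bar> * indicator (cbox a b) p) \<longlonglongrightarrow> \<bar>g p - g p\<bar> * indicator (cbox a b) p"
        by (intro tendsto_intros lim elim)
      then show ?case by (intro tendsto_ennrealI) simp
    qed
  qed auto
  then have "\<forall>\<^sub>F n in sequentially. (\<integral>\<^sup>+p. ennreal (\<bar>g p - \<phi> n p\<bar> * indicator (cbox a b) p) \<partial>lborel) < ennreal e"
    using e by (intro order_tendstoD(2)) auto
  then obtain n where "(\<integral>\<^sup>+p. ennreal (\<bar>g p - \<phi> n p\<bar> * indicator (cbox a b) p) \<partial>lborel) < ennreal e"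
    by (auto simp: eventually_sequentially)
  then show thesis
    by (intro that[OF c[of n]]) (simp add: ennreal_mult'' ennreal_indicator)
qed

text \<open>After exchanging the integrals, the inner one is at most the unit mass of the kernel. A
  point of the box is influenced only by points within \<open>\<delta>\<close> of it in each
  coordinate; since \<open>\<delta> \<le> 1\<close>, enlarging the box by 1 suffices for every
  kernel.\<close>

lemma (in mollifier) kk_tonelli:
  fixes h :: "real \<times> real \<Rightarrow> ennreal"
  assumes [measurable]: "h \<in> borel_measurable borel"
  shows "(\<integral>\<^sup>+p. (\<integral>\<^sup>+p'. h p' * ennreal (k (fst p - fst p') * k (snd p - snd p')) \<partial>lborel) * indicator (cbox (\<alpha>, s) (\<beta>, t)) p \<partial>lborel)
    \<le> (\<integral>\<^sup>+p'. h p' * indicator (cbox (\<alpha> - 1, s - 1) (\<beta> + 1, t + 1)) p' \<partial>lborel)"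
proof -
  let ?K = "cbox (\<alpha>, s) (\<beta>, t)" and ?K' = "cbox (\<alpha> - 1, s - 1) (\<beta> + 1, t + 1)"
  let ?kk = "\<lambda>p p'. ennreal (k (fst p - fst p') * k (snd p - snd p'))"
  have [measurable]: "?K \<in> sets borel" by simp
  have "(\<integral>\<^sup>+p. (\<integral>\<^sup>+p'. h p' * ?kk p p' \<partial>lborel) * indicator ?K p \<partial>lborel)
      = (\<integral>\<^sup>+p. (\<integral>\<^sup>+p'. h p' * ?kk p p' * indicator ?K p \<partial>lborel) \<partial>lborel)"
    by (intro nn_integral_cong nn_integral_multc[symmetric]) (use kk_measurable(1) in simp)
  also have "\<dots> = (\<integral>\<^sup>+p'. (\<integral>\<^sup>+p. h p' * ?kk p p' * indicator ?K p \<partial>lborel) \<partial>lborel)"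
  proof (rule lborel_pair.Fubini'[symmetric])
    show "(\<lambda>(p, p'). h p' * ?kk p p' * indicator ?K p) \<in> borel_measurable (lborel \<Otimes>\<^sub>M lborel)"
      unfolding split_beta'
      by (intro borel_measurable_times_ennreal kk_measurable(3) measurable_compose[OF measurable_fst]
          measurable_compose[OF measurable_snd]) auto
  qed
  also have "\<dots> \<le> (\<integral>\<^sup>+p'. h p' * indicator ?K' p' \<partial>lborel)"
  proof (rule nn_integral_mono)
    fix p' :: "real \<times> real"
    have "(\<integral>\<^sup>+p. h p' * ?kk p p' * indicator ?K p \<partial>lborel) \<le> (\<integral>\<^sup>+p. (h p' * indicator ?K' p') * ?kk p p' \<partial>lborel)"
    proof (rule nn_integral_mono)
      fix p
      show "h p' * ?kk p p' * indicator ?K p \<le> h p' * indicator ?K' p' * ?kk p p'"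
      proof (cases "p \<in> ?K \<and> p' \<notin> ?K'")
        case True
        then have "\<bar>fst p - fst p'\<bar> \<ge> \<delta> \<or> \<bar>snd p - snd p'\<bar> \<ge> \<delta>"
          using \<delta> by (cases p; cases p') (auto simp: abs_if split: if_splits)
        then have "?kk p p' = 0" using k_supp(1) by auto
        then show ?thesis by simp
      qed (auto simp: indicator_def mult_ac)
    qed
    also have "\<dots> = (h p' * indicator ?K' p') * (\<integral>\<^sup>+p. ?kk p p' \<partial>lborel)"
      by (rule nn_integral_cmult) simp
    finally show "(\<integral>\<^sup>+p. h p' * ?kk p p' * indicator ?K p \<partial>lborel) \<le> h p' * indicator ?K' p'"
      by (simp add: kk_nn_integral_right)
  qed
  finally show ?thesis .
qed

text \<open>The continuous \<open>\<phi>\<close> mediates between \<open>g p'\<close> and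
  \<open>g p\<close>: two approximation errors, at \<open>p'\<close> and at \<open>p\<close>, plus
  the oscillation \<open>e\<close> of \<open>\<phi>\<close> over the support of the kernel. The
  error at \<open>p'\<close> is left as an extended nonnegative integral, ready for
  \<open>kk_tonelli\<close>.\<close>

lemma (in mollifier) conv_kk_diff_le:
  assumes g [measurable]: "g \<in> borel_measurable borel" and M: "\<And>p. \<bar>g p\<bar> \<le> M"
    and \<phi>c: "continuous_on UNIV \<phi>"
    and \<phi>: "\<And>p'. \<bar>fst p - fst p'\<bar> < \<delta> \<Longrightarrow> \<bar>snd p - snd p'\<bar> < \<delta> \<Longrightarrow> \<bar>\<phi> p - \<phi> p'\<bar> \<le> e"
  shows "ennreal \<bar>conv k k g p - g p\<bar> \<le>
    (\<integral>\<^sup>+p'. ennreal \<bar>g p' - \<phi> p'\<bar> * ennreal (k (fst p - fst p') * k (snd p - snd p')) \<partial>lborel)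
      + ennreal (e + \<bar>g p - \<phi> p\<bar>)"
proof -
  let ?K = "\<lambda>p'. k (fst p - fst p') * k (snd p - snd p')"
  have i: "integrable lborel ?K" "(LINT p'|lborel. ?K p') = 1"
    using has_bochner_integral_iff kk_has_integral[of p] by blast+
  have [measurable]: "?K \<in> borel_measurable borel"
    using borel_measurable_integrable[OF i(1)] by simp
  have [measurable]: "\<phi> \<in> borel_measurable borel"
    by (rule borel_measurable_continuous_onI[OF \<phi>c])
  have le: "norm (g p' * ?K p') \<le> M * ?K p'" for p'
    using M[of p'] k_nonneg by (auto simp: abs_mult intro!: mult_right_mono)
  have j: "integrable lborel (\<lambda>p'. g p' * ?K p')"
    by (rule Bochner_Integration.integrable_bound[OF integrable_mult_right[OF i(1), of M]])
      (simp, intro AE_I2 order_trans[OF le], simp)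
  have jd: "integrable lborel (\<lambda>p'. (g p' - g p) * ?K p')"
    using Bochner_Integration.integrable_diff[OF j integrable_mult_right[OF i(1), of "g p"]] by (simp add: algebra_simps)
  have "conv k k g p - g p = (LINT p'|lborel. g p' * ?K p') - (LINT p'|lborel. g p * ?K p')"
    unfolding conv_def using i(2) by simp
  also have "\<dots> = (LINT p'|lborel. (g p' - g p) * ?K p')"
    using j i(1) by (subst Bochner_Integration.integral_diff[symmetric]) (auto simp: algebra_simps)
  finally have eq: "conv k k g p - g p = (LINT p'|lborel. (g p' - g p) * ?K p')" .
  have e: "e \<ge> 0" using \<phi>[of p] \<delta> by simp
  have "ennreal \<bar>conv k k g p - g p\<bar> \<le> (\<integral>\<^sup>+p'. ennreal (norm ((g p' - g p) * ?K p')) \<partial>lborel)"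
    unfolding eq real_norm_def[symmetric] by (rule integral_norm_bound_ennreal[OF jd])
  also have "\<dots> \<le> (\<integral>\<^sup>+p'. ennreal \<bar>g p' - \<phi> p'\<bar> * ennreal (?K p') + ennreal (e + \<bar>g p - \<phi> p\<bar>) * ennreal (?K p') \<partial>lborel)"
  proof (rule nn_integral_mono)
    fix p'
    have "\<bar>g p' - g p\<bar> * ?K p' \<le> (\<bar>g p' - \<phi> p'\<bar> + (e + \<bar>g p - \<phi> p\<bar>)) * ?K p'"
    proof (cases "?K p' = 0")
      case False
      then have "\<bar>fst p - fst p'\<bar> < \<delta>" "\<bar>snd p - snd p'\<bar> < \<delta>"
        using False k_supp(1)[of "fst p - fst p'"] k_supp(1)[of "snd p - snd p'"] by force+
      from \<phi>[OF this] have "\<bar>g p' - g p\<bar> \<le> \<bar>g p' - \<phi> p'\<bar> + (e + \<bar>g p - \<phi> p\<bar>)" by linarith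
      then show ?thesis by (intro mult_right_mono) (auto simp: k_nonneg)
    next
      case True
      then show ?thesis by (simp only: mult_zero_right)
    qed
    then have "norm ((g p' - g p) * ?K p') \<le> (\<bar>g p' - \<phi> p'\<bar> + (e + \<bar>g p - \<phi> p\<bar>)) * ?K p'"
      by (simp add: abs_mult k_nonneg)
    then have "ennreal (norm ((g p' - g p) * ?K p')) \<le> ennreal ((\<bar>g p' - \<phi> p'\<bar> + (e + \<bar>g p - \<phi> p\<bar>)) * ?K p')"
      by (rule ennreal_leI)
    also have "\<dots> = ennreal \<bar>g p' - \<phi> p'\<bar> * ennreal (?K p') + ennreal (e + \<bar>g p - \<phi> p\<bar>) * ennreal (?K p')"
      using ennreal_mult[of "\<bar>g p' - \<phi> p'\<bar> + (e + \<bar>g p - \<phi> p\<bar>)" "?K p'"]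
        ennreal_plus[of "\<bar>g p' - \<phi> p'\<bar>" "e + \<bar>g p - \<phi> p\<bar>"] e k_nonneg
      by (simp del: ennreal_plus add: distrib_right)
    finally show "ennreal (norm ((g p' - g p) * ?K p')) \<le> \<dots>" .
  qed
  also have "\<dots> = (\<integral>\<^sup>+p'. ennreal \<bar>g p' - \<phi> p'\<bar> * ennreal (?K p') \<partial>lborel) + ennreal (e + \<bar>g p - \<phi> p\<bar>)"
    by (simp add: nn_integral_add nn_integral_cmult kk_nn_integral_left)
  finally show ?thesis .
qed

lemma mollifier_L1_convergence:
  fixes g :: "real \<times> real \<Rightarrow> real"
  assumes g [measurable]: "g \<in> borel_measurable borel" and M: "\<And>p. \<bar>g p\<bar> \<le> M" and e: "e > 0"
  obtains d where "d > 0" "\<And>\<delta> k k1 k2. mollifier \<delta> k k1 k2 \<Longrightarrow> \<delta> \<le> d \<Longrightarrow>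
    (\<integral>\<^sup>+p. ennreal \<bar>conv k k g p - g p\<bar> * indicator (cbox (\<alpha>, s) (\<beta>, t)) p \<partial>lborel) \<le> ennreal e"
proof -
  let ?K = "cbox (\<alpha>, s) (\<beta>, t)" and ?K' = "cbox (\<alpha> - 1, s - 1) (\<beta> + 1, t + 1)"
  define V where "V = measure lborel ?K"
  have V: "V \<ge> 0" "emeasure lborel ?K = ennreal V"
    unfolding V_def
    by (simp, intro emeasure_eq_ennreal_measure) (metis emeasure_lborel_cbox_finite infinity_ennreal_def less_irrefl)
  \<comment> \<open>One third of \<open>e\<close> is allotted to the oscillation of
    \<open>\<phi>\<close> over the box; the \<open>+ 1\<close> keeps the quotient meaningful for
    boxes of measure 0.\<close>
  define e' where "e' = e / (3 * (V + 1))"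
  have e': "e' > 0" unfolding e'_def using e V by simp
  have "e' * V \<le> e / 3" unfolding e'_def using e V by (simp add: field_simps)
  obtain \<phi> where \<phi>: "continuous_on UNIV \<phi>" "(\<integral>\<^sup>+p. ennreal \<bar>g p - \<phi> p\<bar> * indicator ?K' p \<partial>lborel) < ennreal (e / 3)"
    by (rule continuous_L1_approx[OF g M, of "e / 3" "(\<alpha> - 1, s - 1)" "(\<beta> + 1, t + 1)"]) (use e in auto)
  have [measurable]: "\<phi> \<in> borel_measurable borel"
    by (rule borel_measurable_continuous_onI[OF \<phi>(1)])
  have "uniformly_continuous_on ?K' \<phi>"
    by (intro compact_uniformly_continuous continuous_on_subset[OF \<phi>(1)]) auto
  then obtain d where d: "d > 0" "\<And>p p'. p \<in> ?K' \<Longrightarrow> p' \<in> ?K' \<Longrightarrow> dist p' p < d \<Longrightarrow> dist (\<phi> p') (\<phi> p) < e'"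
    unfolding uniformly_continuous_on_def using e' by metis
  show thesis
  \<comment> \<open>Two points whose coordinates differ by less than \<open>\<delta>\<close> have
    distance below \<open>2 * \<delta>\<close>, hence the half.\<close>
  proof (rule that[of "d / 2"])
    fix \<delta> k k1 k2 assume "mollifier \<delta> k k1 k2" and \<delta>d: "\<delta> \<le> d / 2"
    then interpret mollifier \<delta> k k1 k2 by simp
    let ?h = "\<lambda>p. ennreal \<bar>g p - \<phi> p\<bar>"
    let ?N = "\<lambda>p. \<integral>\<^sup>+p'. ?h p' * ennreal (k (fst p - fst p') * k (snd p - snd p')) \<partial>lborel"
    have [measurable]: "?N \<in> borel_measurable lborel"
      by (rule lborel.borel_measurable_nn_integral) (simp add: split_beta')
    have pw: "ennreal \<bar>conv k k g p - g p\<bar> * indicator ?K p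
      \<le> ?N p * indicator ?K p + (ennreal e' * indicator ?K p + ?h p * indicator ?K' p)" for p
    proof (cases "p \<in> ?K")
      case True
      have "\<bar>\<phi> p - \<phi> p'\<bar> \<le> e'" if "\<bar>fst p - fst p'\<bar> < \<delta>" "\<bar>snd p - snd p'\<bar> < \<delta>" for p'
      proof -
        have "dist p p' \<le> dist (fst p) (fst p') + dist (snd p) (snd p')"
          unfolding dist_prod_def by (rule sqrt_sum_squares_le_sum) auto
        then have "dist p p' < d" using that \<delta>d by (auto simp: dist_real_def)
        moreover have "p \<in> ?K'" "p' \<in> ?K'"
          using True that \<delta> by (cases p; cases p'; auto simp: abs_if split: if_splits)+
        ultimately show ?thesis using d(2)[of p' p] by (simp add: dist_real_def)
      qed
      from conv_kk_diff_le[OF g M \<phi>(1) this]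
      have "ennreal \<bar>conv k k g p - g p\<bar> \<le> ?N p + ennreal (e' + \<bar>g p - \<phi> p\<bar>)" by simp
      also have "ennreal (e' + \<bar>g p - \<phi> p\<bar>) = ennreal e' + ?h p" using e' by simp
      moreover have "p \<in> ?K'" using True by (cases p) auto
      ultimately show ?thesis using True by simp
    qed simp
    have "(\<integral>\<^sup>+p. ennreal \<bar>conv k k g p - g p\<bar> * indicator ?K p \<partial>lborel)
      \<le> (\<integral>\<^sup>+p. ?N p * indicator ?K p + (ennreal e' * indicator ?K p + ?h p * indicator ?K' p) \<partial>lborel)"
      by (rule nn_integral_mono[OF pw])
    also have "\<dots> = (\<integral>\<^sup>+p. ?N p * indicator ?K p \<partial>lborel) + (ennreal e' * emeasure lborel ?K + (\<integral>\<^sup>+p. ?h p * indicator ?K' p \<partial>lborel))"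
      by (subst nn_integral_add; (subst nn_integral_add)?) (auto simp: nn_integral_cmult_indicator)
    also have "\<dots> \<le> ennreal (e / 3) + (ennreal (e / 3) + ennreal (e / 3))"
    proof (intro add_mono)
      have "?h \<in> borel_measurable borel" by measurable
      from kk_tonelli[OF this] \<phi>(2)
      show "(\<integral>\<^sup>+p. ?N p * indicator ?K p \<partial>lborel) \<le> ennreal (e / 3)"
        by (meson less_imp_le order_trans)
      show "ennreal e' * emeasure lborel ?K \<le> ennreal (e / 3)"
        unfolding V(2) using \<open>e' * V \<le> e / 3\<close> e' V by (simp add: ennreal_leI flip: ennreal_mult)
    qed (use \<phi>(2) in auto)
    also have "\<dots> = ennreal e" using e by (simp flip: ennreal_plus)
    finally show "(\<integral>\<^sup>+p. ennreal \<bar>conv k k g p - g p\<bar> * indicator ?K p \<partial>lborel) \<le> ennreal e" .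
  qed (use d in auto)
qed

section \<open>Uniqueness of weak solutions\<close>

text \<open>Put p = \<open>\<bar>P x0\<bar>\<close>. The Lipschitz bound keeps the modulus of
  \<open>P\<close> above p / 2 on an interval of length p / (2 M) to the right of \<open>x0\<close>.
  Its contribution to the integral is at least p^3 / (8 M D), with D a bound for
  \<open>1 + x\<^sup>2\<close> there. Since p is at most \<open>B\<close>, the interval stays inside
  the range of integration.\<close>

lemma lipschitz_sup_le_weighted_L2:
  fixes P :: "real \<Rightarrow> real"
  assumes cont: "continuous_on UNIV P" and lip: "\<And>x y. \<bar>P x - P y\<bar> \<le> M * \<bar>x - y\<bar>" and M: "M > 0"
    and B: "\<And>x. \<bar>P x\<bar> \<le> B" and x0: "\<bar>x0\<bar> \<le> X" and R: "R \<ge> X + B / M"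
  shows "\<bar>P x0\<bar> ^ 3 \<le> 8 * M * (1 + (X + B / M)\<^sup>2) * integral {-R..R} (\<lambda>x. (P x)\<^sup>2 / (1 + x\<^sup>2))"
proof -
  define p where "p = \<bar>P x0\<bar>"
  define D where "D = 1 + (X + B / M)\<^sup>2"
  define h where "h = p / (2 * M)"
  have p: "p \<ge> 0" "p \<le> B" unfolding p_def using B by auto
  have h: "h \<ge> 0" "h \<le> B / M" "M * h = p / 2"
    using p M by (auto simp: h_def field_simps)
  have BM: "B / M \<ge> 0" using p M by simp
  have D: "D > 0" unfolding D_def by (simp add: add_pos_nonneg)
  have nz: "1 + x\<^sup>2 > 0" "1 + x\<^sup>2 \<noteq> 0" for x :: real
    by (auto simp: add_pos_nonneg add_nonneg_eq_0_iff)
  have int: "(\<lambda>x. (P x)\<^sup>2 / (1 + x\<^sup>2)) integrable_on {a..b}" for a b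
    by (intro integrable_continuous_real continuous_intros continuous_on_subset[OF cont]) (auto simp: nz)
  have sub: "{x0..x0 + h} \<subseteq> {-R..R}" using x0 R h BM by auto
  have "p ^ 3 / (8 * M * D) = integral {x0..x0 + h} (\<lambda>x. (p / 2)\<^sup>2 / D)"
    using h M D by (simp add: h_def power2_eq_square power3_eq_cube field_simps)
  also have "\<dots> \<le> integral {x0..x0 + h} (\<lambda>x. (P x)\<^sup>2 / (1 + x\<^sup>2))"
  proof (rule integral_le[OF _ int])
    fix x assume x: "x \<in> {x0..x0 + h}"
    have "M * \<bar>x - x0\<bar> \<le> M * h" using x M by (intro mult_left_mono) auto
    then have "\<bar>P x - P x0\<bar> \<le> p / 2" using lip[of x x0] h by linarith
    then have "p / 2 \<le> \<bar>P x\<bar>" unfolding p_def by linarith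
    then have 1: "(p / 2)\<^sup>2 \<le> (P x)\<^sup>2" using p power_mono[of "p/2" "\<bar>P x\<bar>" 2] by simp
    have "\<bar>x\<bar> \<le> X + B / M" using x x0 h by auto
    then have 2: "1 + x\<^sup>2 \<le> D" unfolding D_def using power_mono[of "\<bar>x\<bar>" "X + B / M" 2] by simp
    show "(p / 2)\<^sup>2 / D \<le> (P x)\<^sup>2 / (1 + x\<^sup>2)"
      using 1 2 nz(1)[of x] by (intro frac_le) auto
  qed auto
  also have "\<dots> \<le> integral {-R..R} (\<lambda>x. (P x)\<^sup>2 / (1 + x\<^sup>2))"
    by (intro integral_subset_le[OF sub int int]) (simp add: nz(1) less_imp_le)
  finally have "p ^ 3 \<le> integral {-R..R} (\<lambda>x. (P x)\<^sup>2 / (1 + x\<^sup>2)) * (8 * M * D)"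
    using M D by (subst (asm) pos_divide_le_eq) auto
  then show ?thesis unfolding p_def D_def by (simp only: mult.commute)
qed

text \<open>The right side of \<open>weak\<close> is 0 because two solutions share their initial
  datum. Test functions that do not vanish at time 0 thus see no source there, and continuing
  \<open>z\<close> and \<open>q\<close> by 0 to earlier times is consistent with the equation. This
  is what makes mollification in time harmless.\<close>

locale weak_difference = z: bounded_forward z M + q: bounded_forward q A
  for z q :: "real \<times> real \<Rightarrow> real" and M A :: real +
  fixes c :: real
  assumes M_pos: "M > 0" and c_pos: "c > 0"
    and monotone: "c * (q p)\<^sup>2 \<le> z p * q p"
    and weak: "T > 0 \<Longrightarrow> test_function T \<psi> \<psi>x \<psi>xx \<psi>t \<Longrightarrow>
      (LINT p|lborel. indicator (Q T) p * (z p * \<psi>t p + q p * \<psi>xx p)) = 0"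

locale mollified_difference = weak_difference + mollifier
begin

text \<open>
  The weak formulation with the test function \<open>k (x - y) * H (t - s)\<close> says that the mollified
  \<open>\<integral>\<^sub>0\<^sup>t q\<^sub>x ds\<close> has the mollified \<open>z\<close> as its derivative in \<open>x\<close>.
\<close>

lemma conv_k2_H_eq: "conv k2 H q p = conv k k z p"
proof -
  obtain x t where p: "p = (x, t)" by (metis surj_pair)
  \<comment> \<open>\<open>H (t - s)\<close> vanishes as soon as \<open>s\<close> is at least
    \<open>t + 1\<close>, so beyond that time the test function is 0; the \<open>max\<close> keeps
    \<open>T\<close> positive.\<close>
  define T where "T = max t 0 + 2"
  have T: "T > 0" "t - T \<le> -1" unfolding T_def by auto
  define \<psi> where "\<psi> = (\<lambda>p'. k (x - fst p') * H (t - snd p'))"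
  define \<psi>x where "\<psi>x = (\<lambda>p'. - k1 (x - fst p') * H (t - snd p'))"
  define \<psi>xx where "\<psi>xx = (\<lambda>p'. k2 (x - fst p') * H (t - snd p'))"
  define \<psi>t where "\<psi>t = (\<lambda>p'. - (k (x - fst p') * k (t - snd p')))"
  have Hc: "continuous_on UNIV H" using causal_kernels by (simp add: causal_kernel_def)
  have sh: "((\<lambda>y. x - y) has_real_derivative - 1) (at y)" for x y :: real
    by (auto intro!: derivative_eq_intros)
  have d0: "((\<lambda>y. k (x - y)) has_real_derivative - k1 (x - y)) (at y)" for x y
    using DERIV_chain2[OF k_deriv sh] by simp
  have d1: "((\<lambda>y. - k1 (x - y)) has_real_derivative k2 (x - y)) (at y)" for x y
    using DERIV_minus[OF DERIV_chain2[OF k1_deriv sh]] by simp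
  have d2: "((\<lambda>y. H (t - y)) has_real_derivative - k (t - y)) (at y)" for t y
    using DERIV_chain2[OF H_deriv sh] by simp
  have "test_function T \<psi> \<psi>x \<psi>xx \<psi>t"
    unfolding test_function_def C21_def
  proof (intro conjI allI ballI)
    fix y s
    show "((\<lambda>y. \<psi> (y, s)) has_real_derivative \<psi>x (y, s)) (at y)"
      unfolding \<psi>_def \<psi>x_def fst_conv snd_conv by (rule DERIV_cmult_right[OF d0])
    show "((\<lambda>y. \<psi>x (y, s)) has_real_derivative \<psi>xx (y, s)) (at y)"
      unfolding \<psi>xx_def \<psi>x_def fst_conv snd_conv by (rule DERIV_cmult_right[OF d1])
    have "((\<lambda>s. \<psi> (y, s)) has_real_derivative \<psi>t (y, s)) (at s)"
      unfolding \<psi>_def \<psi>t_def fst_conv snd_conv using DERIV_cmult[OF d2, of "k (x - y)"] by simp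
    then show "((\<lambda>s. \<psi> (y, s)) has_real_derivative \<psi>t (y, s)) (at s within {0..T})"
      by (rule has_field_derivative_at_within)
  next
    fix g assume "g \<in> {\<psi>, \<psi>x, \<psi>xx, \<psi>t}"
    moreover have "continuous_on S \<psi>" "continuous_on S \<psi>x" "continuous_on S \<psi>xx" "continuous_on S \<psi>t" for S
      unfolding \<psi>_def \<psi>x_def \<psi>xx_def \<psi>t_def
      by (intro continuous_intros continuous_on_compose2[OF k_cont] continuous_on_compose2[OF k1_cont]
        continuous_on_compose2[OF k2_cont] continuous_on_compose2[OF Hc]; simp)+
    ultimately show "continuous_on (UNIV \<times> {0..T}) g" by auto
  next
    show "\<psi> (y, T) = 0" for y
      unfolding \<psi>_def using H_past[OF T(2)] by simp
    have "{p \<in> UNIV \<times> {0..T}. \<psi> p \<noteq> 0} \<subseteq> {- (\<bar>x\<bar> + 2)..\<bar>x\<bar> + 2} \<times> {0..T}"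
    proof
      fix p assume p: "p \<in> {p \<in> UNIV \<times> {0..T}. \<psi> p \<noteq> 0}"
      then have "\<not> \<bar>x - fst p\<bar> \<ge> \<delta>" using k_supp(1)[of "x - fst p"] by (auto simp: \<psi>_def)
      then show "p \<in> {- (\<bar>x\<bar> + 2)..\<bar>x\<bar> + 2} \<times> {0..T}" using p \<delta> by (cases p) auto
    qed
    then have "closure {p \<in> UNIV \<times> {0..T}. \<psi> p \<noteq> 0} \<subseteq> {- (\<bar>x\<bar> + 2)..\<bar>x\<bar> + 2} \<times> {0..T}"
      by (rule closure_minimal) (intro closed_Times; simp)
    then show "\<exists>J>0. closure {p \<in> UNIV \<times> {0..T}. \<psi> p \<noteq> 0} \<subseteq> {-J..J} \<times> {0..T}"
      by (intro exI[of _ "\<bar>x\<bar> + 2"]) auto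
  qed
  from weak[OF T(1) this]
  have "0 = (LINT p'|lborel. indicator (Q T) p' * (z p' * \<psi>t p' + q p' * \<psi>xx p'))" by simp
  also have "\<dots> = (LINT p'|lborel. q p' * (k2 (x - fst p') * H (t - snd p')) - z p' * (k (x - fst p') * k (t - snd p')))"
  proof (rule Bochner_Integration.integral_cong[OF refl])
    fix p' :: "real \<times> real"
    show "indicator (Q T) p' * (z p' * \<psi>t p' + q p' * \<psi>xx p')
      = q p' * (k2 (x - fst p') * H (t - snd p')) - z p' * (k (x - fst p') * k (t - snd p'))"
    proof (cases "p' \<in> Q T")
      case True
      then show ?thesis by (simp add: \<psi>t_def \<psi>xx_def)
    next
      case False
      then consider "snd p' \<le> 0" | "t - snd p' \<le> -1"
        using T by (cases p') (auto simp: Q_def)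
      then show ?thesis
      proof cases
        case 1
        then show ?thesis using z.g_past q.g_past False by simp
      next
        case 2
        then show ?thesis using False H_past[OF 2] k_supp(1)[of "t - snd p'"] \<delta> by simp
      qed
    qed
  qed
  also have "\<dots> = conv k2 H q (x, t) - conv k k z (x, t)"
    unfolding conv_def
    using q.conv_integrable[OF compact_kernels(3) causal_kernels(2), of "(x, t)"]
      z.conv_integrable[OF compact_kernels(1) causal_kernels(1), of "(x, t)"]
    by (subst Bochner_Integration.integral_diff[symmetric]) auto
  finally show ?thesis using p by simp
qed

abbreviation P where "P \<equiv> conv k1 H q"

lemma P_deriv_fst: "((\<lambda>x. P (x, t)) has_real_derivative conv k k z (x, t)) (at x)"
  using q.conv_deriv_fst[OF k1_deriv compact_kernels(2,3) causal_kernels(2), of t x]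
  by (simp add: conv_k2_H_eq)

lemma P_deriv_snd: "((\<lambda>t. P (x, t)) has_real_derivative conv k1 k q (x, t)) (at t)"
  by (rule q.conv_deriv_snd[OF H_deriv compact_kernels(2) causal_kernels(2,1)])

lemma conv_H_past:
  assumes "t \<le> -1"
  shows "conv a H q (x, t) = 0"
proof -
  have "q p' * (a (x - fst p') * H (t - snd p')) = 0" for p'
    using assms H_past[of "t - snd p'"] q.g_past[of p'] by (cases "snd p' \<le> 0") auto
  then show ?thesis unfolding conv_def fst_conv snd_conv by (simp only: integral_zero)
qed

lemma z_bound: "\<bar>conv k k z p\<bar> \<le> M"
  by (rule conv_kk_bound[OF z.g_meas z.g_bound])

lemma q_bound: "\<bar>conv k k q p\<bar> \<le> A"
  by (rule conv_kk_bound[OF q.g_meas q.g_bound])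

lemma P_lipschitz: "\<bar>P (x, t) - P (y, t)\<bar> \<le> M * \<bar>x - y\<bar>"
  using field_differentiable_bound[of UNIV "\<lambda>x. P (x, t)" "\<lambda>x. conv k k z (x, t)" M x y]
    P_deriv_fst z_bound
  by auto

lemma P_bound:
  assumes "t \<le> T" "T \<ge> 0"
  shows "\<bar>P (x, t)\<bar> \<le> M + 2 * A * (T + 1)"
proof (cases "t \<le> -1")
  case True
  then show ?thesis using conv_H_past[OF True] M_pos q.M_nonneg assms by simp
next
  case False
  \<comment> \<open>\<open>conv k H q\<close> is an antiderivative of \<open>P\<close> in the space
    variable. It vanishes at time -1 and changes in time at a rate of at most
    \<open>A\<close>.\<close>
  have S: "\<bar>conv k H q (y, t)\<bar> \<le> A * (T + 1)" for y
  proof -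
    have "\<bar>conv k H q (y, t) - conv k H q (y, -1)\<bar> \<le> A * \<bar>t - (-1)\<bar>"
      using field_differentiable_bound[of UNIV "\<lambda>t. conv k H q (y, t)" "\<lambda>t. conv k k q (y, t)" A t "-1"]
        q.conv_deriv_snd[OF H_deriv compact_kernels(1) causal_kernels(2,1)] q_bound
      by auto
    also have "\<dots> \<le> A * (T + 1)" using assms False q.M_nonneg by (intro mult_left_mono) auto
    finally show ?thesis using conv_H_past[of "-1" k y] by simp
  qed
  have "x < x + 1" by simp
  from MVT2[OF this q.conv_deriv_fst[OF k_deriv compact_kernels(1,2) causal_kernels(2)], of t]
  obtain y where y: "x < y" "y < x + 1" "conv k H q (x + 1, t) - conv k H q (x, t) = P (y, t)"
    by auto
  then have "\<bar>P (y, t)\<bar> \<le> 2 * A * (T + 1)"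
    using S[of x] S[of "x + 1"] by linarith
  moreover have "\<bar>P (x, t) - P (y, t)\<bar> \<le> M * 1"
    using y M_pos by (intro order_trans[OF P_lipschitz] mult_left_mono) auto
  ultimately show ?thesis by linarith
qed

lemma continuous_convs:
  "continuous_on UNIV P" "continuous_on UNIV (conv k k z)"
  "continuous_on UNIV (conv k k q)" "continuous_on UNIV (conv k1 k q)"
  by (intro q.conv_continuous z.conv_continuous compact_kernels causal_kernels)+

text \<open>What mollification loses in the inequality \<open>monotone\<close>: both of its sides
  are quadratic in the pair of functions and do not commute with averaging.\<close>

definition defect :: "real \<times> real \<Rightarrow> real" where
  "defect p = max 0 (c * (conv k k q p)\<^sup>2 - conv k k z p * conv k k q p)"

lemma continuous_defect: "continuous_on UNIV defect"
  unfolding defect_def[abs_def] by (intro continuous_intros continuous_convs)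

text \<open>Subtracting \<open>monotone\<close> at the same point leaves differences of quadratic
  expressions. These factor into one difference between a function and its mollification times a
  factor bounded in terms of \<open>A\<close> and \<open>M\<close>, so convergence in the mean is
  enough to make the defect small.\<close>

lemma defect_le:
  "defect p \<le> (2 * c * A + M) * \<bar>conv k k q p - q p\<bar> + A * \<bar>conv k k z p - z p\<bar>"
proof -
  let ?q = "conv k k q p" and ?z = "conv k k z p"
  have "c * ?q\<^sup>2 - ?z * ?q \<le> c * (?q\<^sup>2 - (q p)\<^sup>2) - (?z * ?q - z p * q p)"
    using monotone[of p] by (simp add: algebra_simps)
  also have "\<dots> = c * ((?q + q p) * (?q - q p)) - z p * (?q - q p) - ?q * (?z - z p)"
    by (simp add: algebra_simps power2_eq_square)
  also have "\<dots> \<le> c * (2 * A * \<bar>?q - q p\<bar>) + M * \<bar>?q - q p\<bar> + A * \<bar>?z - z p\<bar>"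
  proof -
    have 1: "a * b \<le> C * \<bar>b\<bar>" "- (a * b) \<le> C * \<bar>b\<bar>" if "\<bar>a\<bar> \<le> C" for a b C :: real
      using mult_right_mono[OF that, of "\<bar>b\<bar>"] by (simp_all flip: abs_mult add: abs_le_iff)
    have "(?q + q p) * (?q - q p) \<le> 2 * A * \<bar>?q - q p\<bar>"
      using q_bound[of p] q.g_bound[of p] by (intro 1) linarith
    then have "c * ((?q + q p) * (?q - q p)) \<le> c * (2 * A * \<bar>?q - q p\<bar>)"
      using c_pos by (intro mult_left_mono) auto
    moreover have "- (z p * (?q - q p)) \<le> M * \<bar>?q - q p\<bar>" using z.g_bound by (rule 1)
    moreover have "- (?q * (?z - z p)) \<le> A * \<bar>?z - z p\<bar>" using q_bound by (rule 1)
    ultimately show ?thesis by linarith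
  qed
  finally have "c * ?q\<^sup>2 - ?z * ?q \<le> (2 * c * A + M) * \<bar>?q - q p\<bar> + A * \<bar>?z - z p\<bar>"
    by (simp add: algebra_simps)
  moreover have "0 \<le> (2 * c * A + M) * \<bar>?q - q p\<bar> + A * \<bar>?z - z p\<bar>"
    using c_pos M_pos q.M_nonneg by simp
  ultimately show ?thesis unfolding defect_def by simp
qed

text \<open>The energy is started at time -1, since the kernels blur the initial time 0 by at most 1
  and \<open>P\<close> vanishes up to -1. This is the source of \<open>T + 1\<close>.\<close>

lemma P_energy:
  assumes R: "R > 0" and t: "t \<in> {-1..T}" and T: "T \<ge> 0"
  shows "integral {-R..R} (\<lambda>x. (P (x, t))\<^sup>2 / (1 + x\<^sup>2))
     \<le> 2 * exp ((T + 1) / (2 * c)) * (2 * A * (M + 2 * A * (T + 1)) / (1 + R\<^sup>2) * (T + 1)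
         + integral (cbox (-R, -1) (R, T)) defect)"
proof -
  let ?er = "\<lambda>t. integral {-R..R} (\<lambda>x. defect (x, t))"
  let ?B = "M + 2 * A * (T + 1)"
  have B0: "?B \<ge> 0" using M_pos q.M_nonneg T by simp
  have "integral {-R..R} (\<lambda>x. (P (x, t))\<^sup>2 / (1 + x\<^sup>2))
    \<le> 2 * exp ((t - (-1)) / (2 * c)) * (2 * A * ?B / (1 + R\<^sup>2) * (t - (-1)) + integral {-1..t} ?er)"
    unfolding defect_def
    by (rule weighted_energy_bound[OF P_deriv_fst P_deriv_snd _ continuous_convs(1,2,3,4) _ _ _ c_pos R t])
      (use P_bound T q_bound in \<open>auto intro!: conv_H_past q.conv_deriv_fst[OF k_deriv compact_kernels(1,2) causal_kernels(1)]\<close>)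
  also have "\<dots> \<le> 2 * exp ((T + 1) / (2 * c)) * (2 * A * ?B / (1 + R\<^sup>2) * (T + 1) + integral (cbox (-R, -1) (R, T)) defect)"
  proof (intro mult_mono add_mono)
    have er0: "?er t \<ge> 0" for t
      by (intro integral_nonneg integrable_continuous_real continuous_on_compose2[OF continuous_defect] continuous_intros)
        (auto simp: defect_def)
    have "continuous_on UNIV (\<lambda>t. integral (cbox (-R) R) (\<lambda>x. defect (x, t)))"
      by (intro integral_continuous_on_param continuous_on_compose2[OF continuous_defect, of _ "\<lambda>x. (snd x, fst x)", unfolded split_beta]) 
         (unfold split_beta, intro continuous_on_compose2[OF continuous_defect] continuous_intros, auto)
    then have cer: "continuous_on UNIV ?er" by simp
    have "integral {-1..t} ?er \<le> integral {-1..T} ?er"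
      using t er0 by (intro integral_subset_le integrable_continuous_real continuous_on_subset[OF cer]) auto
    also have "\<dots> = integral (cbox (-R) R) (\<lambda>x. integral (cbox (-1) T) (\<lambda>t. defect (x, t)))"
      using integral_swap_continuous[of "-R" "-1" R T "\<lambda>x t. defect (x, t)"]
      by (simp add: continuous_on_subset[OF continuous_defect])
    also have "\<dots> = integral (cbox (-R, -1) (R, T)) defect"
      by (rule integral_prod_continuous[symmetric]) (rule continuous_on_subset[OF continuous_defect], simp)
    finally show *: "integral {-1..t} ?er \<le> integral (cbox (-R, -1) (R, T)) defect" .
    have "0 \<le> integral {-1..t} ?er"
      by (rule integral_nonneg) (intro integrable_continuous_real continuous_on_subset[OF cer] subset_UNIV, rule er0)
    then show "0 \<le> 2 * A * ?B / (1 + R\<^sup>2) * (t - (-1)) + integral {-1..t} ?er"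
      using t B0 q.M_nonneg by (auto intro!: add_nonneg_nonneg mult_nonneg_nonneg divide_nonneg_nonneg)
  qed (use t T c_pos B0 q.M_nonneg in \<open>auto intro!: divide_right_mono mult_nonneg_nonneg divide_nonneg_nonneg\<close>)
  finally show ?thesis .
qed

lemma defect_nonneg: "defect p \<ge> 0"
  by (simp add: defect_def)

text \<open>Turns the energy bound into a pointwise one. The kernel enters the right side only
  through \<open>\<eta>\<close>, so all other constants can be fixed before the kernel is
  chosen.\<close>

lemma P_cube_le:
  fixes T X :: real
  defines "B \<equiv> M + 2 * A * (T + 1)"
  assumes "R > 0" "T \<ge> 0" "\<bar>x\<bar> \<le> X" "t \<le> T" "R \<ge> X + B / M" "integral (cbox (-R, -1) (R, T)) defect \<le> \<eta>"
  shows "\<bar>P (x, t)\<bar> ^ 3 \<le> 8 * M * (1 + (X + B / M)\<^sup>2) * (2 * exp ((T + 1) / (2 * c)) * (2 * A * B / (1 + R\<^sup>2) * (T + 1) + \<eta>))"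
proof -
  have B0: "B \<ge> 0" unfolding B_def using M_pos q.M_nonneg assms by simp
  have "0 \<le> integral (cbox (-R, -1) (R, T)) defect"
    by (intro integral_nonneg integrable_continuous continuous_on_subset[OF continuous_defect]) (auto simp: defect_def)
  then have rhs: "0 \<le> 2 * A * B / (1 + R\<^sup>2) * (T + 1) + \<eta>"
    using assms(3,7) B0 q.M_nonneg by (intro add_nonneg_nonneg mult_nonneg_nonneg divide_nonneg_nonneg) auto
  have k: "0 \<le> 8 * M * (1 + (X + B / M)\<^sup>2)" using M_pos by simp
  show ?thesis
  proof (cases "t \<le> -1")
    case True
    have "0 \<le> 8 * M * (1 + (X + B / M)\<^sup>2) * (2 * exp ((T + 1) / (2 * c)) * (2 * A * B / (1 + R\<^sup>2) * (T + 1) + \<eta>))"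
      by (intro mult_nonneg_nonneg[OF k] mult_nonneg_nonneg[OF _ rhs]) simp
    then show ?thesis using conv_H_past[OF True, of k1 x] by simp
  next
    case False
    have "\<bar>P (x, t)\<bar> ^ 3 \<le> 8 * M * (1 + (X + B / M)\<^sup>2) * integral {-R..R} (\<lambda>x. (P (x, t))\<^sup>2 / (1 + x\<^sup>2))"
      by (rule lipschitz_sup_le_weighted_L2[OF _ P_lipschitz M_pos _ assms(4,6)])
        (use P_bound assms in \<open>auto simp: B_def intro!: continuous_on_compose2[OF continuous_convs(1)] continuous_intros\<close>)
    also have "\<dots> \<le> 8 * M * (1 + (X + B / M)\<^sup>2) * (2 * exp ((T + 1) / (2 * c)) * (2 * A * B / (1 + R\<^sup>2) * (T + 1)
         + integral (cbox (-R, -1) (R, T)) defect))"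
      unfolding B_def by (intro mult_left_mono P_energy k[unfolded B_def]) (use assms False in auto)
    also have "\<dots> \<le> 8 * M * (1 + (X + B / M)\<^sup>2) * (2 * exp ((T + 1) / (2 * c)) * (2 * A * B / (1 + R\<^sup>2) * (T + 1) + \<eta>))"
      using assms(7) by (intro mult_left_mono add_left_mono k) auto
    finally show ?thesis .
  qed
qed

lemma defect_integral_le:
  assumes "(\<integral>\<^sup>+p. ennreal \<bar>conv k k q p - q p\<bar> * indicator (cbox a b) p \<partial>lborel) \<le> ennreal e"
    and "(\<integral>\<^sup>+p. ennreal \<bar>conv k k z p - z p\<bar> * indicator (cbox a b) p \<partial>lborel) \<le> ennreal e"
    and e: "e \<ge> 0"
  shows "integral (cbox a b) defect \<le> (2 * c * A + M + A) * e"
proof -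
  have [measurable]: "conv k k q \<in> borel_measurable borel" "conv k k z \<in> borel_measurable borel"
    using continuous_convs by (auto intro: borel_measurable_continuous_onI)
  have cA: "0 \<le> 2 * c * A + M" "0 \<le> A" using c_pos M_pos q.M_nonneg by auto
  have "(defect has_integral integral (cbox a b) defect) (cbox a b)"
    by (intro integrable_integral integrable_continuous continuous_on_subset[OF continuous_defect]) auto
  then have "ennreal (integral (cbox a b) defect) = (\<integral>\<^sup>+p. ennreal (defect p) * indicator (cbox a b) p \<partial>lborel)"
    by (rule nn_integral_has_integral_lebesgue'[OF defect_nonneg, symmetric])
  also have "\<dots> \<le> (\<integral>\<^sup>+p. ennreal (2 * c * A + M) * (ennreal \<bar>conv k k q p - q p\<bar> * indicator (cbox a b) p)
      + ennreal A * (ennreal \<bar>conv k k z p - z p\<bar> * indicator (cbox a b) p) \<partial>lborel)"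
  proof (rule nn_integral_mono)
    fix p
    have "ennreal (defect p) \<le> ennreal ((2 * c * A + M) * \<bar>conv k k q p - q p\<bar> + A * \<bar>conv k k z p - z p\<bar>)"
      by (rule ennreal_leI[OF defect_le])
    also have "\<dots> = ennreal (2 * c * A + M) * ennreal \<bar>conv k k q p - q p\<bar> + ennreal A * ennreal \<bar>conv k k z p - z p\<bar>"
      using cA by (subst ennreal_plus) (auto simp: ennreal_mult simp del: ennreal_plus)
    finally show "ennreal (defect p) * indicator (cbox a b) p \<le> ennreal (2 * c * A + M) * (ennreal \<bar>conv k k q p - q p\<bar> * indicator (cbox a b) p)
      + ennreal A * (ennreal \<bar>conv k k z p - z p\<bar> * indicator (cbox a b) p)"
      by (simp add: indicator_def)
  qed
  also have "\<dots> = ennreal (2 * c * A + M) * (\<integral>\<^sup>+p. ennreal \<bar>conv k k q p - q p\<bar> * indicator (cbox a b) p \<partial>lborel)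
      + ennreal A * (\<integral>\<^sup>+p. ennreal \<bar>conv k k z p - z p\<bar> * indicator (cbox a b) p \<partial>lborel)"
    by (subst nn_integral_add; (subst nn_integral_cmult)?; (subst nn_integral_cmult)?) auto
  also have "\<dots> \<le> ennreal (2 * c * A + M) * ennreal e + ennreal A * ennreal e"
    by (intro add_mono mult_left_mono assms) auto
  also have "\<dots> = ennreal ((2 * c * A + M + A) * e)"
    using ennreal_plus[of "(2 * c * A + M) * e" "A * e"] ennreal_mult[OF cA(1) e] ennreal_mult[OF cA(2) e] cA e
    by (simp add: distrib_right[of "2 * c * A + M" A] del: ennreal_plus)
  finally show ?thesis
    using cA e by (subst (asm) ennreal_le_iff) auto
qed

text \<open>In the space variable the mollified \<open>z\<close> is the derivative of
  \<open>P\<close>, so its integral over a box is the time integral of the difference of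
  \<open>P\<close> between the two lateral sides.\<close>

lemma conv_box_integral_le:
  assumes "\<alpha> \<le> \<beta>" "s \<le> t" "e \<ge> 0"
    and P: "\<And>\<tau>. \<tau> \<le> t \<Longrightarrow> \<bar>P (\<alpha>, \<tau>)\<bar> \<le> e" "\<And>\<tau>. \<tau> \<le> t \<Longrightarrow> \<bar>P (\<beta>, \<tau>)\<bar> \<le> e"
  shows "\<bar>integral (cbox (\<alpha>, s) (\<beta>, t)) (conv k k z)\<bar> \<le> 2 * e * (t - s)"
proof -
  have ftc: "integral {\<alpha>..\<beta>} (\<lambda>x. conv k k z (x, \<tau>)) = P (\<beta>, \<tau>) - P (\<alpha>, \<tau>)" for \<tau>
    by (rule integral_unique, rule fundamental_theorem_of_calculus[OF assms(1)])
      (use P_deriv_fst[of \<tau>] in \<open>auto simp: has_real_derivative_iff_has_vector_derivative intro: has_vector_derivative_at_within\<close>)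
  have "integral (cbox (\<alpha>, s) (\<beta>, t)) (conv k k z) = integral (cbox \<alpha> \<beta>) (\<lambda>x. integral (cbox s t) (\<lambda>\<tau>. conv k k z (x, \<tau>)))"
    by (rule integral_prod_continuous) (rule continuous_on_subset[OF continuous_convs(2)], simp)
  also have "\<dots> = integral (cbox s t) (\<lambda>\<tau>. integral (cbox \<alpha> \<beta>) (\<lambda>x. conv k k z (x, \<tau>)))"
    using integral_swap_continuous[of \<alpha> s \<beta> t "\<lambda>x \<tau>. conv k k z (x, \<tau>)"]
    by (simp add: continuous_on_subset[OF continuous_convs(2)])
  also have "\<dots> = integral {s..t} (\<lambda>\<tau>. P (\<beta>, \<tau>) - P (\<alpha>, \<tau>))"
    by (simp add: ftc)
  also have "norm \<dots> \<le> integral {s..t} (\<lambda>\<tau>. 2 * e)"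
  proof (rule integral_norm_bound_integral)
    show "(\<lambda>\<tau>. P (\<beta>, \<tau>) - P (\<alpha>, \<tau>)) integrable_on {s..t}"
      by (intro integrable_continuous_real continuous_intros continuous_on_compose2[OF continuous_convs(1)]) auto
    show "norm (P (\<beta>, \<tau>) - P (\<alpha>, \<tau>)) \<le> 2 * e" if "\<tau> \<in> {s..t}" for \<tau>
      using P[of \<tau>] that by auto
  qed auto
  also have "\<dots> = 2 * e * (t - s)" using assms by simp
  finally show ?thesis by simp
qed

lemma box_integral_diff_le:
  assumes "(\<integral>\<^sup>+p. ennreal \<bar>conv k k z p - z p\<bar> * indicator (cbox a b) p \<partial>lborel) \<le> ennreal e" "e \<ge> 0"
  shows "\<bar>(LINT p:cbox a b|lborel. z p) - integral (cbox a b) (conv k k z)\<bar> \<le> e"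
proof -
  have [measurable]: "conv k k z \<in> borel_measurable borel"
    using continuous_convs by (auto intro: borel_measurable_continuous_onI)
  have i1: "set_integrable lborel (cbox a b) z"
    by (rule set_integrable_cbox_bounded[OF z.g_meas z.g_bound])
  have i2: "set_integrable lborel (cbox a b) (conv k k z)"
    by (rule set_integrable_cbox_bounded[OF _ z_bound]) simp
  have i3: "integrable lborel (\<lambda>p. indicator (cbox a b) p *\<^sub>R (z p - conv k k z p))"
    using set_integral_diff(1)[OF i1 i2] by (simp add: set_integrable_def)
  have "(LINT p:cbox a b|lborel. z p) - integral (cbox a b) (conv k k z) = (LINT p:cbox a b|lborel. z p - conv k k z p)"
    using set_borel_integral_eq_integral(2)[OF i2] set_integral_diff(2)[OF i1 i2] by simp
  then have "ennreal \<bar>(LINT p:cbox a b|lborel. z p) - integral (cbox a b) (conv k k z)\<bar>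
     \<le> (\<integral>\<^sup>+p. ennreal (norm (indicator (cbox a b) p *\<^sub>R (z p - conv k k z p))) \<partial>lborel)"
    using integral_norm_bound_ennreal[OF i3] by (simp add: set_lebesgue_integral_def)
  also have "\<dots> = (\<integral>\<^sup>+p. ennreal \<bar>conv k k z p - z p\<bar> * indicator (cbox a b) p \<partial>lborel)"
    by (intro nn_integral_cong) (auto simp: indicator_def abs_minus_commute)
  also note assms(1)
  finally show ?thesis using assms(2) by (subst (asm) ennreal_le_iff) auto
qed

end

context weak_difference
begin

lemma box_integral_small:
  assumes "\<alpha> \<le> \<beta>" "s \<le> t" and e: "e > 0"
  shows "\<bar>LINT p:cbox (\<alpha>, s) (\<beta>, t)|lborel. z p\<bar> \<le> 2 * e * (t - s) + e"
proof -
  define T where "T = max t 0"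
  define X where "X = max \<bar>\<alpha>\<bar> \<bar>\<beta>\<bar>"
  define B where "B = M + 2 * A * (T + 1)"
  \<comment> \<open>\<open>K\<close> collects the factors in \<open>P_cube_le\<close>, and
    \<open>\<eta>\<close> is such that two errors of size \<open>\<eta>\<close>, the boundary term
    and the defect, add up to \<open>e ^ 3\<close>. \<open>R\<close> makes the boundary term small
    by way of \<open>R \<le> 1 + R\<^sup>2\<close>; none of these depends on a kernel.\<close>
  define K where "K = 8 * M * (1 + (X + B / M)\<^sup>2) * (2 * exp ((T + 1) / (2 * c)))"
  define \<eta> where "\<eta> = e ^ 3 / (2 * K)"
  define R where "R = max 1 (max (X + B / M) (2 * A * B * (T + 1) / \<eta>))"
  have T: "T \<ge> 0" "t \<le> T" unfolding T_def by auto
  have B: "B \<ge> 0" unfolding B_def using M_pos q.M_nonneg T by simp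
  have K: "K > 0" unfolding K_def using M_pos by (auto intro!: mult_pos_pos add_pos_nonneg)
  have \<eta>: "\<eta> > 0" unfolding \<eta>_def using K e by simp
  have R: "R \<ge> 1" "R \<ge> X + B / M" "R \<ge> 2 * A * B * (T + 1) / \<eta>" unfolding R_def by auto
  have "2 * A * B / (1 + R\<^sup>2) * (T + 1) \<le> \<eta>"
  proof -
    have "2 * A * B * (T + 1) \<le> R * \<eta>" using R(3) \<eta> by (simp add: divide_le_eq)
    also have "\<dots> \<le> (1 + R\<^sup>2) * \<eta>"
      using R(1) \<eta> self_le_power[of R 2] by (intro mult_right_mono) auto
    finally show ?thesis by (simp add: divide_le_eq add_pos_nonneg mult.commute)
  qed
  then have bd: "K * (2 * A * B / (1 + R\<^sup>2) * (T + 1) + \<eta>) \<le> K * (\<eta> + \<eta>)"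
    using K by (intro mult_left_mono) auto
  have K\<eta>: "K * (\<eta> + \<eta>) = e ^ 3" unfolding \<eta>_def using K by (simp add: field_simps)
  define C where "C = 2 * c * A + M + A"
  have C: "C > 0" unfolding C_def using c_pos M_pos q.M_nonneg by (simp add: add_pos_nonneg add_nonneg_pos)
  have \<eta>C: "\<eta> / C > 0" using \<eta> C by simp
  \<comment> \<open>\<open>d1\<close> and \<open>d2\<close> control the defect on the large box,
    with \<open>C\<close> the constant of \<open>defect_integral_le\<close>. \<open>d3\<close>
    allows passing from the mollified \<open>z\<close> back to \<open>z\<close> on the box under
    consideration.\<close>
  obtain d1 where d1: "d1 > 0" "\<And>\<delta> k k1 k2. mollifier \<delta> k k1 k2 \<Longrightarrow> \<delta> \<le> d1 \<Longrightarrow>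
    (\<integral>\<^sup>+p. ennreal \<bar>conv k k q p - q p\<bar> * indicator (cbox (-R, -1) (R, T)) p \<partial>lborel) \<le> ennreal (\<eta> / C)"
    by (rule mollifier_L1_convergence[OF q.g_meas q.g_bound \<eta>C, where \<alpha>="-R" and s="-1" and \<beta>=R and t=T]) blast
  obtain d2 where d2: "d2 > 0" "\<And>\<delta> k k1 k2. mollifier \<delta> k k1 k2 \<Longrightarrow> \<delta> \<le> d2 \<Longrightarrow>
    (\<integral>\<^sup>+p. ennreal \<bar>conv k k z p - z p\<bar> * indicator (cbox (-R, -1) (R, T)) p \<partial>lborel) \<le> ennreal (\<eta> / C)"
    by (rule mollifier_L1_convergence[OF z.g_meas z.g_bound \<eta>C, where \<alpha>="-R" and s="-1" and \<beta>=R and t=T]) blast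
  obtain d3 where d3: "d3 > 0" "\<And>\<delta> k k1 k2. mollifier \<delta> k k1 k2 \<Longrightarrow> \<delta> \<le> d3 \<Longrightarrow>
    (\<integral>\<^sup>+p. ennreal \<bar>conv k k z p - z p\<bar> * indicator (cbox (\<alpha>, s) (\<beta>, t)) p \<partial>lborel) \<le> ennreal e"
    by (rule mollifier_L1_convergence[OF z.g_meas z.g_bound e, where \<alpha>=\<alpha> and s=s and \<beta>=\<beta> and t=t]) blast
  define \<delta> where "\<delta> = min 1 (min d1 (min d2 d3))"
  have \<delta>: "0 < \<delta>" "\<delta> \<le> 1" "\<delta> \<le> d1" "\<delta> \<le> d2" "\<delta> \<le> d3" unfolding \<delta>_def using d1 d2 d3 by auto
  obtain k k1 k2 where moll: "mollifier \<delta> k k1 k2"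
    using mollifier_exists[OF \<delta>(1,2)] by blast
  interpret m: mollified_difference z q M A c \<delta> k k1 k2
    by (intro mollified_difference.intro moll weak_difference_axioms)
  have "integral (cbox (-R, -1) (R, T)) m.defect \<le> C * (\<eta> / C)"
    unfolding C_def using \<eta>C
    by (intro m.defect_integral_le d1(2)[OF moll \<delta>(3), unfolded C_def] d2(2)[OF moll \<delta>(4), unfolded C_def]) (simp add: C_def)
  then have def: "integral (cbox (-R, -1) (R, T)) m.defect \<le> \<eta>" using C by simp
  have P: "\<bar>m.P (x, \<tau>)\<bar> \<le> e" if "\<bar>x\<bar> \<le> X" "\<tau> \<le> t" for x \<tau>
  proof -
    have "\<bar>m.P (x, \<tau>)\<bar> ^ 3 \<le> 8 * M * (1 + (X + B / M)\<^sup>2) * (2 * exp ((T + 1) / (2 * c)) * (2 * A * B / (1 + R\<^sup>2) * (T + 1) + \<eta>))"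
      unfolding B_def by (rule m.P_cube_le) (use that R T def in \<open>auto simp: B_def\<close>)
    also have "\<dots> = K * (2 * A * B / (1 + R\<^sup>2) * (T + 1) + \<eta>)" unfolding K_def by (simp only: mult.assoc)
    also have "\<dots> \<le> e ^ 3" using bd K\<eta> by simp
    finally show ?thesis using e by (subst (asm) power_mono_iff) auto
  qed
  have "\<bar>integral (cbox (\<alpha>, s) (\<beta>, t)) (conv k k z)\<bar> \<le> 2 * e * (t - s)"
    by (rule m.conv_box_integral_le[OF assms(1,2)]) (use e P in \<open>auto simp: X_def\<close>)
  moreover have "\<bar>(LINT p:cbox (\<alpha>, s) (\<beta>, t)|lborel. z p) - integral (cbox (\<alpha>, s) (\<beta>, t)) (conv k k z)\<bar> \<le> e"
    by (rule m.box_integral_diff_le[OF d3(2)[OF moll \<delta>(5)]]) (use e in simp)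
  ultimately show ?thesis by linarith
qed

lemma box_integral_zero:
  assumes "\<alpha> \<le> \<beta>" "s \<le> t"
  shows "(LINT p:cbox (\<alpha>, s) (\<beta>, t)|lborel. z p) = 0"
proof (rule ccontr)
  let ?I = "LINT p:cbox (\<alpha>, s) (\<beta>, t)|lborel. z p"
  assume "?I \<noteq> 0"
  \<comment> \<open>With this \<open>e\<close> the bound of \<open>box_integral_small\<close> is
    half of the integral that it bounds.\<close>
  define e where "e = \<bar>?I\<bar> / (2 * (2 * (t - s) + 1))"
  have pos: "2 * (t - s) + 1 > 0" using assms by simp
  have e: "e > 0" unfolding e_def using \<open>?I \<noteq> 0\<close> pos by simp
  have "\<bar>?I\<bar> \<le> e * (2 * (t - s) + 1)"
    using box_integral_small[OF assms e] by (simp add: algebra_simps)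
  also have "\<dots> = \<bar>?I\<bar> / 2" unfolding e_def using pos by (simp add: field_simps)
  finally show False using \<open>?I \<noteq> 0\<close> by simp
qed

text \<open>The densities \<open>1 + z / M\<close> and \<open>1\<close> define measures that agree on boxes.\<close>

lemma z_AE_zero: "AE p in lborel. z p = 0"
proof -
  have "lborel = density lborel (\<lambda>p. ennreal (1 + z p / M))"
  proof (rule lborel_eqI)
    fix l u :: "real \<times> real" assume "\<And>b. b \<in> Basis \<Longrightarrow> l \<bullet> b \<le> u \<bullet> b"
    then have lu: "fst l \<le> fst u" "snd l \<le> snd u"
      by (force simp: Basis_prod_def inner_prod_def)+
    have nn: "0 \<le> 1 + z p / M" for p
      using z.g_bound[of p] M_pos by (auto simp: field_simps abs_le_iff)
    have iz: "set_integrable lborel (cbox l u) z"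
      by (rule set_integrable_cbox_bounded[OF z.g_meas z.g_bound])
    have i1: "set_integrable lborel (cbox l u) (\<lambda>p. 1 :: real)"
      unfolding set_integrable_def using emeasure_lborel_cbox_finite[of l u] by simp
    have i2: "set_integrable lborel (cbox l u) (\<lambda>p. z p / M)"
      using iz by (rule set_integrable_divide)
    have i: "set_integrable lborel (cbox l u) (\<lambda>p. 1 + z p / M)"
      using set_integral_add(1)[OF i1 i2] .
    have "(LINT p:cbox l u|lborel. 1 + z p / M) = (LINT p:cbox l u|lborel. 1) + (LINT p:cbox l u|lborel. z p) / M"
      using set_integral_add(2)[OF i1 i2] by simp
    also have "(LINT p:cbox l u|lborel. z p) = 0"
      using box_integral_zero[OF lu] by simp
    also have "(LINT p:cbox l u|lborel. (1::real)) = measure lborel (cbox l u)"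
      by (simp add: set_lebesgue_integral_def)
    finally have L: "(LINT p:cbox l u|lborel. 1 + z p / M) = measure lborel (cbox l u)" by simp
    \<comment> \<open>The measures are compared on open boxes, while the vanishing integrals are
      over closed ones.\<close>
    have AE: "AE p in lborel. indicator (box l u) p = (indicator (cbox l u) p :: ennreal)"
    proof -
      have "cbox l u - box l u \<in> null_sets lborel"
        using emeasure_lborel_cbox_finite[of l u] box_subset_cbox[of l u] lu
        by (intro null_setsI) (auto simp: emeasure_Diff emeasure_lborel_box_eq emeasure_lborel_cbox_eq)
      then show ?thesis
        by (rule AE_I') (use box_subset_cbox[of l u] in \<open>auto simp: indicator_def\<close>)
    qed
    have "emeasure (density lborel (\<lambda>p. ennreal (1 + z p / M))) (box l u)
      = (\<integral>\<^sup>+p. ennreal (1 + z p / M) * indicator (box l u) p \<partial>lborel)"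
      by (rule emeasure_density) auto
    also have "\<dots> = (\<integral>\<^sup>+p. ennreal (1 + z p / M) * indicator (cbox l u) p \<partial>lborel)"
      by (rule nn_integral_cong_AE) (use AE in eventually_elim, simp)
    also have "\<dots> = (\<integral>\<^sup>+p. ennreal (indicator (cbox l u) p *\<^sub>R (1 + z p / M)) \<partial>lborel)"
      by (intro nn_integral_cong) (auto simp: indicator_def)
    also have "\<dots> = ennreal (LINT p:cbox l u|lborel. 1 + z p / M)"
      unfolding set_lebesgue_integral_def
      by (rule nn_integral_eq_integral) (use i nn in \<open>auto simp: set_integrable_def\<close>)
    also have "\<dots> = emeasure lborel (cbox l u)"
      unfolding L using emeasure_lborel_cbox_finite[of l u]
      by (intro emeasure_eq_ennreal_measure[symmetric]) auto
    also have "\<dots> = emeasure lborel (box l u)"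
      by (simp add: emeasure_lborel_cbox_eq emeasure_lborel_box_eq)
    also have "\<dots> = (\<Prod>b\<in>Basis. (u - l) \<bullet> b)"
      using \<open>\<And>b. b \<in> Basis \<Longrightarrow> l \<bullet> b \<le> u \<bullet> b\<close> by (rule emeasure_lborel_box)
    finally show "emeasure (density lborel (\<lambda>p. ennreal (1 + z p / M))) (box l u) = (\<Prod>b\<in>Basis. (u - l) \<bullet> b)" .
  qed simp
  then have "density lborel (\<lambda>p. ennreal (1 + z p / M)) = density lborel (\<lambda>_. 1)"
    by (simp add: density_1)
  then have "AE p in lborel. ennreal (1 + z p / M) = 1"
    by (intro sigma_finite_measure.density_unique[OF sigma_finite_lborel]) auto
  then show ?thesis
    by eventually_elim (use M_pos in simp)
qed

end

section \<open>Test functions and Borel representatives\<close>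

lemma test_function_bounds:
  assumes tf: "test_function T \<psi> \<psi>x \<psi>xx \<psi>t" and T: "T > 0"
  obtains J C where "J > 0" "C \<ge> 0"
    "\<And>x t. t \<in> {0..T} \<Longrightarrow> \<bar>x\<bar> > J \<Longrightarrow> \<psi> (x, t) = 0"
    "\<And>x t. t \<in> {0..T} \<Longrightarrow> \<bar>x\<bar> > J \<Longrightarrow> \<psi>x (x, t) = 0"
    "\<And>x t. t \<in> {0..T} \<Longrightarrow> \<bar>x\<bar> > J \<Longrightarrow> \<psi>xx (x, t) = 0"
    "\<And>x t. t \<in> {0<..<T} \<Longrightarrow> \<bar>x\<bar> > J \<Longrightarrow> \<psi>t (x, t) = 0"
    "\<And>x t g. g \<in> {\<psi>, \<psi>x, \<psi>xx, \<psi>t} \<Longrightarrow> t \<in> {0..T} \<Longrightarrow> \<bar>x\<bar> \<le> J \<Longrightarrow> \<bar>g (x, t)\<bar> \<le> C"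
proof -
  have d: "\<And>x t. t \<in> {0..T} \<Longrightarrow> ((\<lambda>y. \<psi> (y, t)) has_real_derivative \<psi>x (x, t)) (at x)"
    "\<And>x t. t \<in> {0..T} \<Longrightarrow> ((\<lambda>y. \<psi>x (y, t)) has_real_derivative \<psi>xx (x, t)) (at x)"
    "\<And>x t. t \<in> {0..T} \<Longrightarrow> ((\<lambda>\<tau>. \<psi> (x, \<tau>)) has_real_derivative \<psi>t (x, t)) (at t within {0..T})"
    and cont: "\<And>g. g \<in> {\<psi>, \<psi>x, \<psi>xx, \<psi>t} \<Longrightarrow> continuous_on (UNIV \<times> {0..T}) g"
    using tf unfolding test_function_def C21_def by blast+
  obtain J where J: "J > 0" "closure {p \<in> UNIV \<times> {0..T}. \<psi> p \<noteq> 0} \<subseteq> {-J..J} \<times> {0..T}"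
    using tf unfolding test_function_def by blast
  have z: "\<psi> (x, t) = 0" if "t \<in> {0..T}" "\<bar>x\<bar> > J" for x t
  proof (rule ccontr)
    assume "\<psi> (x, t) \<noteq> 0"
    then have "(x, t) \<in> closure {p \<in> UNIV \<times> {0..T}. \<psi> p \<noteq> 0}"
      using that by (intro subsetD[OF closure_subset]) auto
    then show False using J(2) that by (auto simp: abs_if split: if_splits)
  qed
  have op: "open {x. \<bar>x\<bar> > J}" by (intro open_Collect_less continuous_intros)
  have zx: "\<psi>x (x, t) = 0" if "t \<in> {0..T}" "\<bar>x\<bar> > J" for x t
  proof -
    have "((\<lambda>y. 0) has_real_derivative \<psi>x (x, t)) (at x)"
      by (rule has_field_derivative_transform_within_open[OF d(1)[OF that(1)] op]) (use that z in auto)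
    then show ?thesis using DERIV_unique[OF _ DERIV_const] by blast
  qed
  have zxx: "\<psi>xx (x, t) = 0" if "t \<in> {0..T}" "\<bar>x\<bar> > J" for x t
  proof -
    have "((\<lambda>y. 0) has_real_derivative \<psi>xx (x, t)) (at x)"
      by (rule has_field_derivative_transform_within_open[OF d(2)[OF that(1)] op]) (use that zx in auto)
    then show ?thesis using DERIV_unique[OF _ DERIV_const] by blast
  qed
  have zt: "\<psi>t (x, t) = 0" if "t \<in> {0<..<T}" "\<bar>x\<bar> > J" for x t
  proof -
    have "((\<lambda>\<tau>. \<psi> (x, \<tau>)) has_real_derivative \<psi>t (x, t)) (at t)"
      using d(3)[of t x] that at_within_Icc_at[of 0 t T] by auto
    then have "((\<lambda>y. 0) has_real_derivative \<psi>t (x, t)) (at t)"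
      by (rule has_field_derivative_transform_within_open[where S="{0<..<T}"]) (use that z in auto)
    then show ?thesis using DERIV_unique[OF _ DERIV_const] by blast
  qed
  have "\<exists>C. \<forall>x t. t \<in> {0..T} \<longrightarrow> \<bar>x\<bar> \<le> J \<longrightarrow> \<bar>g (x, t)\<bar> \<le> C" if "g \<in> {\<psi>, \<psi>x, \<psi>xx, \<psi>t}" for g
  proof -
    have "compact (g ` ({-J..J} \<times> {0..T}))"
      by (intro compact_continuous_image compact_Times continuous_on_subset[OF cont[OF that]]) auto
    then obtain C where "\<forall>p\<in>g ` ({-J..J} \<times> {0..T}). \<bar>p\<bar> \<le> C"
      by (meson bounded_real compact_imp_bounded)
    then show ?thesis by (intro exI[of _ C]) (auto simp: abs_le_iff)
  qed
  then obtain C where C: "\<And>g x t. g \<in> {\<psi>, \<psi>x, \<psi>xx, \<psi>t} \<Longrightarrow> t \<in> {0..T} \<Longrightarrow> \<bar>x\<bar> \<le> J \<Longrightarrow> \<bar>g (x, t)\<bar> \<le> C g"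
    by metis
  define D where "D = Max (C ` {\<psi>, \<psi>x, \<psi>xx, \<psi>t})"
  have CD: "C g \<le> D" if "g \<in> {\<psi>, \<psi>x, \<psi>xx, \<psi>t}" for g
    unfolding D_def by (intro Max_ge imageI that) auto
  have Cf: "\<bar>g (x, t)\<bar> \<le> D" if "g \<in> {\<psi>, \<psi>x, \<psi>xx, \<psi>t}" "t \<in> {0..T}" "\<bar>x\<bar> \<le> J" for x t g
    using order_trans[OF C[OF that] CD[OF that(1)]] .
  have D0: "D \<ge> 0" using Cf[of \<psi> 0 0] T J(1) by simp
  show thesis
    by (rule that[of J D], fact J(1), fact D0, fact z, fact zx, fact zxx, fact zt, fact Cf)
qed

lemma Q_measurable [measurable]: "Q T \<in> sets borel"
  by (auto simp: Q_def intro!: borel_open open_Times)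

lemma test_function_measurable:
  assumes "test_function T \<psi> \<psi>x \<psi>xx \<psi>t" "g \<in> {\<psi>xx, \<psi>t}"
  shows "(\<lambda>p. indicator (Q T) p * g p) \<in> borel_measurable borel"
proof -
  have "continuous_on (UNIV \<times> {0..T}) g"
    using assms unfolding test_function_def C21_def by blast
  then have "continuous_on (Q T) g"
    by (rule continuous_on_subset) (auto simp: Q_def)
  from borel_measurable_continuous_on_indicator[OF Q_measurable this] show ?thesis
    by (simp only: real_scaleR_def)
qed

lemma test_function_integrable:
  assumes tf: "test_function T \<psi> \<psi>x \<psi>xx \<psi>t" and T: "T > 0" and g: "g \<in> {\<psi>xx, \<psi>t}"
    and [measurable]: "w \<in> borel_measurable borel" and w: "\<And>p. \<bar>w p\<bar> \<le> M"
  shows "integrable lborel (\<lambda>p. w p * (indicator (Q T) p * g p))"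
proof -
  obtain J C where J: "J > 0" "C \<ge> 0"
    "\<And>x t. t \<in> {0..T} \<Longrightarrow> \<bar>x\<bar> > J \<Longrightarrow> \<psi>xx (x, t) = 0"
    "\<And>x t. t \<in> {0<..<T} \<Longrightarrow> \<bar>x\<bar> > J \<Longrightarrow> \<psi>t (x, t) = 0"
    "\<And>x t g. g \<in> {\<psi>, \<psi>x, \<psi>xx, \<psi>t} \<Longrightarrow> t \<in> {0..T} \<Longrightarrow> \<bar>x\<bar> \<le> J \<Longrightarrow> \<bar>g (x, t)\<bar> \<le> C"
    by (rule test_function_bounds[OF tf T]) blast
  have g0: "g (x, t) = 0" if "t \<in> {0<..<T}" "\<bar>x\<bar> > J" for x t
    using g J(3)[of t x] J(4)[of t x] that by auto
  have gC: "\<bar>g (x, t)\<bar> \<le> C" if "t \<in> {0..T}" "\<bar>x\<bar> \<le> J" for x t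
    by (rule J(5)) (use g that in auto)
  have M: "M \<ge> 0" using w[of 0] by linarith
  let ?K = "cbox (-J, 0) (J, T)"
  show ?thesis
  proof (rule integrable_bounded_support[where C="M * C" and a="(-J, 0)" and b="(J, T)"])
    show "(\<lambda>p. w p * (indicator (Q T) p * g p)) \<in> borel_measurable borel"
      by (intro borel_measurable_times[OF assms(4) test_function_measurable[OF tf g]])
    fix p :: "real \<times> real"
    obtain x t where p: "p = (x, t)" by (metis surj_pair)
    show "\<bar>w p * (indicator (Q T) p * g p)\<bar> \<le> M * C * indicator ?K p"
    proof (cases "p \<in> Q T \<and> \<bar>x\<bar> \<le> J")
      case True
      then have "p \<in> ?K" "\<bar>g p\<bar> \<le> C" using gC[of t x] by (auto simp: p Q_def abs_le_iff)
      then show ?thesis using True w[of p] M J(2) by (simp add: abs_mult mult_mono)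
    next
      case False
      then have "indicator (Q T) p * g p = 0" using g0[of t x] by (auto simp: p Q_def indicator_def)
      then show ?thesis using M J(2) by (simp only: mult_zero_right abs_zero) simp
    qed
  qed
qed

lemma diffusion_measurable [measurable]: "diffusion du dv \<in> borel_measurable borel"
  unfolding diffusion_def[abs_def] by measurable

lemma AE_snd_nonzero: "AE p in (lborel :: (real \<times> real) measure). snd p \<noteq> 0"
proof -
  have "emeasure (lborel \<Otimes>\<^sub>M lborel) ((UNIV :: real set) \<times> {0::real}) = emeasure lborel (UNIV :: real set) * emeasure lborel {0::real}"
    by (rule lborel.emeasure_pair_measure_Times) auto
  then have "UNIV \<times> {0} \<in> null_sets (lborel :: (real \<times> real) measure)"
    by (intro null_setsI) (auto simp: lborel_prod intro!: borel_closed closed_Times)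
  then show ?thesis by (rule AE_I') auto
qed

text \<open>A weak solution is only Lebesgue measurable on a half-plane and only essentially
  bounded. The convolutions above call for a Borel function on the whole plane that is bounded
  everywhere and zero up to time 0. A change on a null set and a continuation to earlier times are
  invisible to the integrals over \<open>Q T\<close>.\<close>

lemma weak_solution_borel_representative:
  assumes "weak_solution du dv U V w"
  obtains w' M where "w' \<in> borel_measurable borel" "\<And>p. \<bar>w' p\<bar> \<le> M" "\<And>p. snd p \<le> 0 \<Longrightarrow> w' p = 0"
    "AE p in lborel. snd p \<ge> 0 \<longrightarrow> w p = w' p"
    "\<And>T \<psi> \<psi>x \<psi>xx \<psi>t. T > 0 \<Longrightarrow> test_function T \<psi> \<psi>x \<psi>xx \<psi>t \<Longrightarrow>
      (LINT p|lborel. indicator (Q T) p * (w' p * \<psi>t p + diffusion du dv (w' p) * \<psi>xx p))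
        = - (LINT x|lebesgue. initial_datum U V x * \<psi> (x, 0))"
proof -
  let ?S = "UNIV \<times> {0..} :: (real \<times> real) set"
  have S: "closed ?S" by (intro closed_Times) auto
  then have [measurable]: "?S \<in> sets borel" "?S \<in> sets lebesgue" by auto
  obtain C where w: "w \<in> borel_measurable (lebesgue_on ?S)" and C: "AE p in lebesgue_on ?S. \<bar>w p\<bar> \<le> C"
    using assms unfolding weak_solution_def L_infinity_def by blast
  define v where "v = (\<lambda>p. if p \<in> ?S then w p else 0)"
  have v [measurable]: "v \<in> borel_measurable lebesgue"
    unfolding v_def using w by (subst borel_measurable_if) auto
  obtain g where g [measurable]: "g \<in> borel_measurable borel" and vg: "AE p in lborel. v p = g p"
    using completion_ex_borel_measurable_real[OF v] by auto
  have C': "AE p in lborel. p \<in> ?S \<longrightarrow> \<bar>w p\<bar> \<le> C"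
    using C by (simp add: AE_restrict_space_iff AE_completion_iff)
  \<comment> \<open>\<open>g\<close> inherits the bound \<open>C\<close> only almost everywhere, so
    the bound is enforced by a cut-off. The line of time 0 is dropped as a null set.\<close>
  define w' where "w' = (\<lambda>p. g p * (indicator (UNIV \<times> {0<..}) p * indicator {p. \<bar>g p\<bar> \<le> C} p))"
  have w' [measurable]: "w' \<in> borel_measurable borel"
  proof -
    have "UNIV \<times> {0<..} \<in> sets (borel :: (real \<times> real) measure)"
      by (auto intro!: borel_open open_Times)
    moreover have "{p. \<bar>g p\<bar> \<le> C} \<in> sets borel" by measurable
    ultimately show ?thesis
      unfolding w'_def by (intro borel_measurable_times borel_measurable_indicator g)
  qed
  have vw': "AE p in lborel. v p = w' p"
    using vg C' AE_snd_nonzero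
  proof eventually_elim
    case (elim p)
    then show ?case by (cases p) (auto simp: v_def w'_def indicator_def split: if_splits)
  qed
  show thesis
  proof (rule that[OF w', of "max C 0"])
    show "\<bar>w' p\<bar> \<le> max C 0" for p by (auto simp: w'_def indicator_def)
    show "w' p = 0" if "snd p \<le> 0" for p using that by (cases p) (simp add: w'_def)
    show "AE p in lborel. snd p \<ge> 0 \<longrightarrow> w p = w' p"
      using vw' by eventually_elim (auto simp: v_def)
    fix T \<psi> \<psi>x \<psi>xx \<psi>t assume T: "(T::real) > 0" and tf: "test_function T \<psi> \<psi>x \<psi>xx \<psi>t"
    note m = test_function_measurable[OF tf]
    let ?F = "\<lambda>u p. u p * (indicator (Q T) p * \<psi>t p) + diffusion du dv (u p) * (indicator (Q T) p * \<psi>xx p)"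
    have Fw': "?F w' \<in> borel_measurable borel"
      by (intro borel_measurable_add borel_measurable_times[OF w' m]
        borel_measurable_times[OF measurable_compose[OF w' diffusion_measurable] m]) auto
    have "(LINT p|lborel. indicator (Q T) p * (w' p * \<psi>t p + diffusion du dv (w' p) * \<psi>xx p)) = (LINT p|lborel. ?F w' p)"
      by (simp add: algebra_simps)
    also have "\<dots> = (LINT p|lebesgue. ?F w' p)"
      by (rule integral_completion[symmetric]) (use Fw' in simp)
    also have "\<dots> = (LINT p|lebesgue. ?F v p)"
    proof (rule integral_cong_AE)
      show "?F w' \<in> borel_measurable lebesgue" using Fw' by (intro measurable_completion) simp
      have b: "(\<lambda>p. indicator (Q T) p * \<psi>t p) \<in> borel_measurable lebesgue" "(\<lambda>p. indicator (Q T) p * \<psi>xx p) \<in> borel_measurable lebesgue"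
        using m by (auto intro!: measurable_completion)
      show "?F v \<in> borel_measurable lebesgue"
        by (intro borel_measurable_add borel_measurable_times[OF v b(1)]
          borel_measurable_times[OF measurable_compose[OF v diffusion_measurable] b(2)])
      show "AE p in lebesgue. ?F w' p = ?F v p"
        unfolding AE_completion_iff using vw' by eventually_elim simp
    qed
    also have "\<dots> = (LINT p:Q T|lebesgue. w p * \<psi>t p + diffusion du dv (w p) * \<psi>xx p)"
      unfolding set_lebesgue_integral_def
      by (rule Bochner_Integration.integral_cong) (auto simp: indicator_def v_def Q_def)
    also have "\<dots> = - (LINT x|lebesgue. initial_datum U V x * \<psi> (x, 0))"
      using assms T tf unfolding weak_solution_def by blast
    finally show "(LINT p|lborel. indicator (Q T) p * (w' p * \<psi>t p + diffusion du dv (w' p) * \<psi>xx p))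
        = - (LINT x|lebesgue. initial_datum U V x * \<psi> (x, 0))" .
  qed
qed

text \<open>By monotonicity the two differences have the same sign, so the Lipschitz bound times the
  modulus of the second difference is already the second claim. Only the largest slope enters, so
  the constant survives \<open>dv = 0\<close>.\<close>

lemma diffusion_monotone_lipschitz:
  assumes "du > 0" "dv \<ge> 0"
  defines "L \<equiv> max du dv"
  shows "\<bar>diffusion du dv a - diffusion du dv b\<bar> \<le> L * \<bar>a - b\<bar>"
    and "1 / L * (diffusion du dv a - diffusion du dv b)\<^sup>2 \<le> (a - b) * (diffusion du dv a - diffusion du dv b)"
proof -
  have L: "L > 0" unfolding L_def using assms by simp
  have ordered: "0 \<le> diffusion du dv y - diffusion du dv x \<and> diffusion du dv y - diffusion du dv x \<le> L * (y - x)"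
    if "x \<le> y" for x y
  proof -
    have l: "du * r \<le> L * r" "dv * r \<le> L * r" if "r \<ge> 0" for r
      using that unfolding L_def by (auto intro!: mult_right_mono)
    consider "0 \<le> x" | "x < 0" "0 \<le> y" | "y < 0" using that by linarith
    then show ?thesis
    proof cases
      case 1
      then show ?thesis using that assms(1,2) l(1)[of "y - x"] by (auto simp: diffusion_def algebra_simps)
    next
      case 2
      have "dv * - x \<le> L * - x" by (rule l(2)) (use 2 in simp)
      then have "L * x \<le> dv * x" by (simp only: mult_minus_right neg_le_iff_le)
      moreover have "0 \<le> du * y" "dv * x \<le> 0" "du * y \<le> L * y"
        using assms(1,2) l(1)[of y] 2 by (auto intro: mult_nonneg_nonpos)
      ultimately have "0 \<le> du * y - dv * x \<and> du * y - dv * x \<le> L * (y - x)"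
        unfolding right_diff_distrib by linarith
      then show ?thesis using 2 by (simp add: diffusion_def)
    next
      case 3
      then show ?thesis using that assms(1,2) l(2)[of "y - x"] by (auto simp: diffusion_def algebra_simps mult_left_mono)
    qed
  qed
  show 1: "\<bar>diffusion du dv a - diffusion du dv b\<bar> \<le> L * \<bar>a - b\<bar>"
    using ordered[of a b] ordered[of b a] by (cases "a \<le> b") auto
  let ?D = "diffusion du dv a - diffusion du dv b"
  have "?D\<^sup>2 = \<bar>?D\<bar> * \<bar>?D\<bar>" by (simp add: power2_eq_square)
  also have "\<dots> \<le> L * \<bar>a - b\<bar> * \<bar>?D\<bar>" by (intro mult_right_mono 1) auto
  also have "L * \<bar>a - b\<bar> * \<bar>?D\<bar> = L * ((a - b) * ?D)"
  proof -
    have "0 \<le> (a - b) * ?D"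
      using ordered[of a b] ordered[of b a] by (cases "a \<le> b") (auto simp: zero_le_mult_iff)
    then show ?thesis by (simp add: mult.assoc flip: abs_mult)
  qed
  finally show "1 / L * ?D\<^sup>2 \<le> (a - b) * ?D"
    using L by (simp add: divide_le_eq mult.commute)
qed

lemma weak_solution_unique:
  assumes "du > 0" "dv \<ge> 0" "weak_solution du dv U V w1" "weak_solution du dv U V w2"
  shows "AE p in lebesgue_on (UNIV \<times> {0..}). w1 p = w2 p"
proof -
  obtain v1 M1 where v1: "v1 \<in> borel_measurable borel" "\<And>p. \<bar>v1 p\<bar> \<le> M1" "\<And>p. snd p \<le> 0 \<Longrightarrow> v1 p = 0"
    "AE p in lborel. snd p \<ge> 0 \<longrightarrow> w1 p = v1 p"
    "\<And>T \<psi> \<psi>x \<psi>xx \<psi>t. T > 0 \<Longrightarrow> test_function T \<psi> \<psi>x \<psi>xx \<psi>t \<Longrightarrow>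
      (LINT p|lborel. indicator (Q T) p * (v1 p * \<psi>t p + diffusion du dv (v1 p) * \<psi>xx p))
        = - (LINT x|lebesgue. initial_datum U V x * \<psi> (x, 0))"
    by (rule weak_solution_borel_representative[OF assms(3)]) blast
  obtain v2 M2 where v2: "v2 \<in> borel_measurable borel" "\<And>p. \<bar>v2 p\<bar> \<le> M2" "\<And>p. snd p \<le> 0 \<Longrightarrow> v2 p = 0"
    "AE p in lborel. snd p \<ge> 0 \<longrightarrow> w2 p = v2 p"
    "\<And>T \<psi> \<psi>x \<psi>xx \<psi>t. T > 0 \<Longrightarrow> test_function T \<psi> \<psi>x \<psi>xx \<psi>t \<Longrightarrow>
      (LINT p|lborel. indicator (Q T) p * (v2 p * \<psi>t p + diffusion du dv (v2 p) * \<psi>xx p))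
        = - (LINT x|lebesgue. initial_datum U V x * \<psi> (x, 0))"
    by (rule weak_solution_borel_representative[OF assms(4)]) blast
  note [measurable] = v1(1) v2(1)
  let ?D = "diffusion du dv"
  define L where "L = max du dv"
  \<comment> \<open>The \<open>+ 1\<close> provides the strict positivity of the bound that
    \<open>weak_difference\<close> asks for.\<close>
  define M where "M = M1 + M2 + 1"
  have L: "L > 0" unfolding L_def using assms by simp
  have M: "M > 0" unfolding M_def using v1(2)[of 0] v2(2)[of 0] by linarith
  have D0: "?D 0 = 0" by (simp add: diffusion_def)
  have vM: "\<bar>v1 p - v2 p\<bar> \<le> M" for p unfolding M_def using v1(2)[of p] v2(2)[of p] by linarith
  have Db: "\<bar>?D a\<bar> \<le> L * \<bar>a\<bar>" for a
    using diffusion_monotone_lipschitz(1)[OF assms(1,2), of a 0] D0 by (simp add: L_def)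
  interpret weak_difference "\<lambda>p. v1 p - v2 p" "\<lambda>p. ?D (v1 p) - ?D (v2 p)" M "L * M" "1 / L"
  proof unfold_locales
    show "\<bar>?D (v1 p) - ?D (v2 p)\<bar> \<le> L * M" for p
      using diffusion_monotone_lipschitz(1)[OF assms(1,2), of "v1 p" "v2 p"] mult_left_mono[OF vM[of p], of L] L
      unfolding L_def by linarith
    show "1 / L * (?D (v1 p) - ?D (v2 p))\<^sup>2 \<le> (v1 p - v2 p) * (?D (v1 p) - ?D (v2 p))" for p
      unfolding L_def by (rule diffusion_monotone_lipschitz(2)[OF assms(1,2)])
    fix T \<psi> \<psi>x \<psi>xx \<psi>t assume T: "(T::real) > 0" and tf: "test_function T \<psi> \<psi>x \<psi>xx \<psi>t"
    have i: "integrable lborel (\<lambda>p. indicator (Q T) p * (v p * \<psi>t p + ?D (v p) * \<psi>xx p))"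
      if [measurable]: "v \<in> borel_measurable borel" and v: "\<And>p. \<bar>v p\<bar> \<le> N" for v N
    proof -
      have "\<bar>?D (v p)\<bar> \<le> L * N" for p
        using Db[of "v p"] mult_left_mono[OF v[of p], of L] L by linarith
      then have "integrable lborel (\<lambda>p. v p * (indicator (Q T) p * \<psi>t p) + ?D (v p) * (indicator (Q T) p * \<psi>xx p))"
        by (intro Bochner_Integration.integrable_add test_function_integrable[OF tf T _ _ v] test_function_integrable[OF tf T, where M="L * N"]) auto
      then show ?thesis by (simp add: algebra_simps)
    qed
    have "(LINT p|lborel. indicator (Q T) p * ((v1 p - v2 p) * \<psi>t p + (?D (v1 p) - ?D (v2 p)) * \<psi>xx p))
      = (LINT p|lborel. indicator (Q T) p * (v1 p * \<psi>t p + ?D (v1 p) * \<psi>xx p) - indicator (Q T) p * (v2 p * \<psi>t p + ?D (v2 p) * \<psi>xx p))"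
      by (simp add: algebra_simps)
    also have "\<dots> = 0"
      using Bochner_Integration.integral_diff[OF i[OF v1(1,2)] i[OF v2(1,2)]] v1(5)[OF T tf] v2(5)[OF T tf] by simp
    finally show "(LINT p|lborel. indicator (Q T) p * ((v1 p - v2 p) * \<psi>t p + (?D (v1 p) - ?D (v2 p)) * \<psi>xx p)) = 0" .
  qed (use L M vM v1 v2 in auto)
  have "AE p in lborel. snd p \<ge> 0 \<longrightarrow> w1 p = w2 p"
    using v1(4) v2(4) z_AE_zero by eventually_elim auto
  moreover have "UNIV \<times> {0..} \<in> sets (lebesgue :: (real \<times> real) measure)"
    by (intro sets_completionI_sets) (auto intro!: borel_closed closed_Times)
  ultimately show ?thesis
    by (simp add: AE_restrict_space_iff AE_completion_iff mem_Times_iff)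
qed

section \<open>Self-similar solutions\<close>

text \<open>\<open>C21\<close> supplies partial derivatives only. Joint differentiability follows
  from the time derivative at the one point together with the space derivative near it and its
  continuity; the proof puts time first, so that the continuous partial derivative is the one in the
  second variable.\<close>

lemma test_function_chain_rule:
  assumes tf: "test_function T \<psi> \<psi>x \<psi>xx \<psi>t" and t: "t \<in> {0<..<T}"
    and x: "(x has_real_derivative x') (at t)"
  shows "((\<lambda>t. \<psi> (x t, t)) has_real_derivative \<psi>t (x t, t) + \<psi>x (x t, t) * x') (at t)"
proof -
  have d: "\<And>x t. t \<in> {0..T} \<Longrightarrow> ((\<lambda>y. \<psi> (y, t)) has_real_derivative \<psi>x (x, t)) (at x)"
    "\<And>x t. t \<in> {0..T} \<Longrightarrow> ((\<lambda>\<tau>. \<psi> (x, \<tau>)) has_real_derivative \<psi>t (x, t)) (at t within {0..T})"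
    and cont: "continuous_on (UNIV \<times> {0..T}) \<psi>x"
    using tf unfolding test_function_def C21_def by blast+
  let ?X = "{0<..<T}"
  have "((\<lambda>(t, y). \<psi> (y, t)) has_derivative (\<lambda>(dt, dy). \<psi>t (x t, t) * dt + blinfun_apply (blinfun_mult_right (\<psi>x (x t, t))) dy))
    (at (t, x t) within ?X \<times> UNIV)"
  proof (rule has_derivative_partialsI)
    show "((\<lambda>\<tau>. \<psi> (x t, \<tau>)) has_derivative (*) (\<psi>t (x t, t))) (at t within ?X)"
      unfolding has_field_derivative_def[symmetric] by (rule DERIV_subset[OF d(2)]) (use t in auto)
    show "((\<lambda>y. \<psi> (y, \<tau>)) has_derivative blinfun_apply (blinfun_mult_right (\<psi>x (y, \<tau>)))) (at y within UNIV)"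
      if "\<tau> \<in> ?X" "y \<in> UNIV" for \<tau> y
      using d(1)[of \<tau> y] that by (simp add: has_field_derivative_def blinfun_mult_right.rep_eq)
    have "continuous_on (?X \<times> UNIV) (\<lambda>p. \<psi>x (snd p, fst p))"
      by (intro continuous_on_compose2[OF cont] continuous_intros) auto
    then have "continuous (at (t, x t) within ?X \<times> UNIV) (\<lambda>p. \<psi>x (snd p, fst p))"
      using t by (simp add: continuous_on_eq_continuous_within)
    from bounded_linear.continuous[OF bounded_linear_blinfun_mult_right this]
    show "continuous (at (t, x t) within ?X \<times> UNIV) (\<lambda>(\<tau>, y). blinfun_mult_right (\<psi>x (y, \<tau>)))"
      by (simp add: split_beta')
  qed auto
  moreover have "at (t, x t) within ?X \<times> UNIV = at (t, x t)"
    using t by (intro at_within_open open_Times) auto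
  ultimately have D: "((\<lambda>(t, y). \<psi> (y, t)) has_derivative (\<lambda>(dt, dy). \<psi>t (x t, t) * dt + \<psi>x (x t, t) * dy)) (at (t, x t))"
    by (simp add: blinfun_mult_right.rep_eq)
  have "((\<lambda>t. (t, x t)) has_derivative (\<lambda>h. (h, x' * h))) (at t)"
    using x by (auto intro!: derivative_eq_intros simp: has_field_derivative_def)
  from has_derivative_compose[OF this D]
  have "((\<lambda>t. \<psi> (x t, t)) has_derivative (\<lambda>h. \<psi>t (x t, t) * h + \<psi>x (x t, t) * (x' * h))) (at t)"
    by simp
  then show ?thesis
    unfolding has_field_derivative_def
    by (rule has_derivative_eq_rhs) (auto simp: fun_eq_iff algebra_simps)
qed

text \<open>
  The equation for \<open>fr\<close> is multiplied by \<open>dv\<close>, so that \<open>dv = 0\<close> is covered with a constant \<open>fr\<close>.  The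
  last condition in \<open>interface\<close> is the Rankine-Hugoniot condition at the free boundary.
\<close>

locale self_similar_profile =
  fixes du dv a U V M :: real and f fl fl1 fl2 fr fr1 fr2 :: "real \<Rightarrow> real"
  assumes fl: "\<And>\<eta>. (fl has_real_derivative fl1 \<eta>) (at \<eta>)" "\<And>\<eta>. (fl1 has_real_derivative fl2 \<eta>) (at \<eta>)"
      "\<And>\<eta>. du * fl2 \<eta> = - (\<eta> / 2 * fl1 \<eta>)"
    and fr: "\<And>\<eta>. (fr has_real_derivative fr1 \<eta>) (at \<eta>)" "\<And>\<eta>. (fr1 has_real_derivative fr2 \<eta>) (at \<eta>)"
      "\<And>\<eta>. dv * fr2 \<eta> = - (\<eta> / 2 * fr1 \<eta>)"
    and f: "\<And>\<eta>. f \<eta> = (if \<eta> \<le> a then fl \<eta> else fr \<eta>)"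
    and F: "\<And>\<eta>. diffusion du dv (f \<eta>) = (if \<eta> \<le> a then du * fl \<eta> else dv * fr \<eta>)"
    and interface: "fl a = 0" "dv * fr a = 0" "du * fl1 a = a / 2 * fr a + dv * fr1 a"
    and bound: "\<And>\<eta>. \<bar>f \<eta>\<bar> \<le> M"
    and limits: "(f \<longlongrightarrow> U) at_bot" "(f \<longlongrightarrow> - V) at_top"
begin

lemma f_measurable [measurable]: "f \<in> borel_measurable borel"
proof -
  have "continuous_on UNIV fl" "continuous_on UNIV fr"
    using DERIV_continuous_on[OF has_field_derivative_at_within[OF fl(1)]]
      DERIV_continuous_on[OF has_field_derivative_at_within[OF fr(1)]] by auto
  then have [measurable]: "fl \<in> borel_measurable borel" "fr \<in> borel_measurable borel"
    by (auto intro: borel_measurable_continuous_onI)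
  show ?thesis unfolding f[abs_def] by measurable
qed

abbreviation D where "D \<eta> \<equiv> diffusion du dv (f \<eta>)"

lemma D_bound: "\<bar>D \<eta>\<bar> \<le> (\<bar>du\<bar> + \<bar>dv\<bar>) * M"
proof -
  have M: "M \<ge> 0" using bound[of 0] by linarith
  have "\<bar>D \<eta>\<bar> \<le> (\<bar>du\<bar> + \<bar>dv\<bar>) * \<bar>f \<eta>\<bar>"
    by (simp add: diffusion_def abs_mult mult_right_mono)
  also have "\<dots> \<le> (\<bar>du\<bar> + \<bar>dv\<bar>) * M" by (intro mult_left_mono bound) auto
  finally show ?thesis .
qed

text \<open>
  On either side of \<open>a\<close> the integrand is the derivative of
  \<open>1/2 f \<eta> \<phi> - D(f) \<phi>' + D(f)' \<phi>\<close>, and the Rankine-Hugoniot condition makes the two boundary terms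
  at \<open>a\<close> cancel.
\<close>

lemma profile_weak_identity:
  assumes \<phi>: "\<And>\<eta>. (\<phi> has_real_derivative \<phi>1 \<eta>) (at \<eta>)" "\<And>\<eta>. (\<phi>1 has_real_derivative \<phi>2 \<eta>) (at \<eta>)"
    and supp: "\<And>\<eta>. \<bar>\<eta>\<bar> > N \<Longrightarrow> \<phi> \<eta> = 0" "\<And>\<eta>. \<bar>\<eta>\<bar> > N \<Longrightarrow> \<phi>1 \<eta> = 0" "\<And>\<eta>. \<bar>\<eta>\<bar> > N \<Longrightarrow> \<phi>2 \<eta> = 0"
  shows "((\<lambda>\<eta>. f \<eta> * (\<phi> \<eta> + \<eta> * \<phi>1 \<eta>) / 2 - D \<eta> * \<phi>2 \<eta>) has_integral 0) UNIV"
proof -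
  define R where "R = max \<bar>a\<bar> \<bar>N\<bar> + 1"
  have R: "-R \<le> a" "a \<le> R" "\<bar>R\<bar> > N" "\<bar>-R\<bar> > N" unfolding R_def by auto
  let ?h = "\<lambda>\<eta>. f \<eta> * (\<phi> \<eta> + \<eta> * \<phi>1 \<eta>) / 2 - D \<eta> * \<phi>2 \<eta>"
  have gen: "((\<lambda>\<eta>. g \<eta> * \<eta> * \<phi> \<eta> / 2 - d * g \<eta> * \<phi>1 \<eta> + d * g1 \<eta> * \<phi> \<eta>) has_vector_derivative
      g \<eta> * (\<phi> \<eta> + \<eta> * \<phi>1 \<eta>) / 2 - d * g \<eta> * \<phi>2 \<eta>) (at \<eta> within S)"
    if g: "\<And>\<eta>. (g has_real_derivative g1 \<eta>) (at \<eta>)" "\<And>\<eta>. (g1 has_real_derivative g2 \<eta>) (at \<eta>)"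
      "\<And>\<eta>. d * g2 \<eta> = - (\<eta> / 2 * g1 \<eta>)" for g g1 g2 d \<eta> S
  proof -
    have "((\<lambda>\<eta>. g \<eta> * \<eta> * \<phi> \<eta> / 2 - d * g \<eta> * \<phi>1 \<eta> + d * g1 \<eta> * \<phi> \<eta>) has_real_derivative
      ((g1 \<eta> * \<eta> + g \<eta>) * \<phi> \<eta> + g \<eta> * \<eta> * \<phi>1 \<eta>) / 2 - (d * g1 \<eta> * \<phi>1 \<eta> + d * g \<eta> * \<phi>2 \<eta>)
       + (d * g2 \<eta> * \<phi> \<eta> + d * g1 \<eta> * \<phi>1 \<eta>)) (at \<eta>)"
      by (auto intro!: derivative_eq_intros g \<phi>)
    also have "((g1 \<eta> * \<eta> + g \<eta>) * \<phi> \<eta> + g \<eta> * \<eta> * \<phi>1 \<eta>) / 2 - (d * g1 \<eta> * \<phi>1 \<eta> + d * g \<eta> * \<phi>2 \<eta>)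
       + (d * g2 \<eta> * \<phi> \<eta> + d * g1 \<eta> * \<phi>1 \<eta>) = g \<eta> * (\<phi> \<eta> + \<eta> * \<phi>1 \<eta>) / 2 - d * g \<eta> * \<phi>2 \<eta>"
      unfolding g(3) by (simp add: field_simps)
    finally show ?thesis
      by (auto simp: has_real_derivative_iff_has_vector_derivative intro: has_vector_derivative_at_within)
  qed
  have 1: "((\<lambda>\<eta>. fl \<eta> * (\<phi> \<eta> + \<eta> * \<phi>1 \<eta>) / 2 - du * fl \<eta> * \<phi>2 \<eta>) has_integral du * fl1 a * \<phi> a) {-R..a}"
    using fundamental_theorem_of_calculus[OF R(1) gen[OF fl]] supp R(4) interface(1) by simp
  have "(?h has_integral du * fl1 a * \<phi> a) {-R..a}"
    by (rule has_integral_eq[OF _ 1]) (unfold F, simp add: f)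
  moreover have 2: "((\<lambda>\<eta>. fr \<eta> * (\<phi> \<eta> + \<eta> * \<phi>1 \<eta>) / 2 - dv * fr \<eta> * \<phi>2 \<eta>) has_integral - (a / 2 * fr a + dv * fr1 a) * \<phi> a) {a..R}"
    using fundamental_theorem_of_calculus[OF R(2) gen[OF fr]] supp R(3) interface(2) by (simp add: algebra_simps)
  have "(?h has_integral - (a / 2 * fr a + dv * fr1 a) * \<phi> a) {a..R}"
    by (rule has_integral_spike_finite[OF _ _ 2, of "{a}"]) (unfold F, auto simp: f)
  ultimately have "(?h has_integral (du * fl1 a * \<phi> a + - (a / 2 * fr a + dv * fr1 a) * \<phi> a)) {-R..R}"
    by (rule has_integral_combine[OF R(1,2)])
  then have "(?h has_integral 0) {-R..R}" by (simp add: interface(3) algebra_simps)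
  moreover have "?h x = 0" if "x \<notin> {-R..R}" for x
  proof -
    have "\<bar>x\<bar> > N" using that unfolding R_def by auto
    then show ?thesis using supp by simp
  qed
  ultimately show ?thesis
    by (rule has_integral_on_superset) auto
qed

text \<open>After substituting x = \<eta> sqrt t, the identity \<open>profile_weak_identity\<close>
  for the rescaled test function removes the term with \<open>\<psi>xx\<close>. The factor left
  beside \<open>f \<eta>\<close> is the time derivative of
  \<open>sqrt t * \<psi> (\<eta> * sqrt t, t)\<close>, which \<open>late_time_identity\<close> then
  integrates.\<close>

lemma slice_identity:
  assumes tf: "test_function T \<psi> \<psi>x \<psi>xx \<psi>t" and t: "t \<in> {0<..<T}"
  shows "(LINT x|lborel. f (x / sqrt t) * \<psi>t (x, t) + D (x / sqrt t) * \<psi>xx (x, t))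
    = (LINT \<eta>|lborel. f \<eta> * (\<psi> (\<eta> * sqrt t, t) / (2 * sqrt t) + \<eta> / 2 * \<psi>x (\<eta> * sqrt t, t) + sqrt t * \<psi>t (\<eta> * sqrt t, t)))"
proof -
  define r where "r = sqrt t"
  have r: "r > 0" "r * r = t" unfolding r_def using t by auto
  have T: "T > 0" "t \<in> {0..T}" using t by auto
  obtain J C where J: "J > 0" "C \<ge> 0"
    "\<And>x t. t \<in> {0..T} \<Longrightarrow> \<bar>x\<bar> > J \<Longrightarrow> \<psi> (x, t) = 0"
    "\<And>x t. t \<in> {0..T} \<Longrightarrow> \<bar>x\<bar> > J \<Longrightarrow> \<psi>x (x, t) = 0"
    "\<And>x t. t \<in> {0..T} \<Longrightarrow> \<bar>x\<bar> > J \<Longrightarrow> \<psi>xx (x, t) = 0"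
    "\<And>x t. t \<in> {0<..<T} \<Longrightarrow> \<bar>x\<bar> > J \<Longrightarrow> \<psi>t (x, t) = 0"
    "\<And>x t g. g \<in> {\<psi>, \<psi>x, \<psi>xx, \<psi>t} \<Longrightarrow> t \<in> {0..T} \<Longrightarrow> \<bar>x\<bar> \<le> J \<Longrightarrow> \<bar>g (x, t)\<bar> \<le> C"
    by (rule test_function_bounds[OF tf T(1)]) blast
  have d: "\<And>x. ((\<lambda>y. \<psi> (y, t)) has_real_derivative \<psi>x (x, t)) (at x)"
    "\<And>x. ((\<lambda>y. \<psi>x (y, t)) has_real_derivative \<psi>xx (x, t)) (at x)"
    and cont: "\<And>g. g \<in> {\<psi>, \<psi>x, \<psi>xx, \<psi>t} \<Longrightarrow> continuous_on (UNIV \<times> {0..T}) g"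
    using tf T unfolding test_function_def C21_def by blast+
  define N where "N = J / r"
  have N: "\<bar>\<eta> * r\<bar> > J" if "\<bar>\<eta>\<bar> > N" for \<eta>
    using that r unfolding N_def by (simp add: abs_mult divide_less_eq)
  have N': "\<bar>\<eta> * r\<bar> \<le> J" if "\<bar>\<eta>\<bar> \<le> N" for \<eta>
    using that r unfolding N_def by (simp add: abs_mult le_divide_eq)
  have gm [measurable]: "(\<lambda>\<eta>. g (\<eta> * r, t)) \<in> borel_measurable borel" if "g \<in> {\<psi>, \<psi>x, \<psi>xx, \<psi>t}" for g
    by (rule borel_measurable_continuous_onI) (use T in \<open>auto intro!: continuous_on_compose2[OF cont[OF that]] continuous_intros\<close>)
  have g0: "g (\<eta> * r, t) = 0" if "g \<in> {\<psi>, \<psi>x, \<psi>xx, \<psi>t}" "\<bar>\<eta>\<bar> > N" for g \<eta>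
    using J(3)[OF T(2) N[OF that(2)]] J(4)[OF T(2) N[OF that(2)]] J(5)[OF T(2) N[OF that(2)]] J(6)[OF t N[OF that(2)]] that(1) by auto
  have int: "integrable lborel (\<lambda>\<eta>. h \<eta> * (c \<eta> * g (\<eta> * r, t)))"
    if "h \<in> borel_measurable borel" "\<And>\<eta>. \<bar>h \<eta>\<bar> \<le> K" "c \<in> {\<lambda>_. 1, \<lambda>\<eta>. \<eta>}" "g \<in> {\<psi>, \<psi>x, \<psi>xx, \<psi>t}" for h c g K
  proof (rule integrable_bounded_support[where a="-N" and b="N" and C="K * ((1 + \<bar>N\<bar>) * C)"])
    have "c \<in> borel_measurable borel" using that(3) by auto
    then show "(\<lambda>\<eta>. h \<eta> * (c \<eta> * g (\<eta> * r, t))) \<in> borel_measurable borel"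
      by (intro borel_measurable_times that(1) gm that(4))
    fix \<eta>
    show "\<bar>h \<eta> * (c \<eta> * g (\<eta> * r, t))\<bar> \<le> K * ((1 + \<bar>N\<bar>) * C) * indicator (cbox (-N) N) \<eta>"
    proof (cases "\<bar>\<eta>\<bar> \<le> N")
      case True
      have K: "K \<ge> 0" using that(2)[of 0] by linarith
      have "\<bar>c \<eta>\<bar> \<le> 1 + \<bar>N\<bar>" using that(3) True by auto
      moreover have "\<bar>g (\<eta> * r, t)\<bar> \<le> C" using J(7)[OF that(4) T(2) N'[OF True]] .
      ultimately have "\<bar>h \<eta>\<bar> * (\<bar>c \<eta>\<bar> * \<bar>g (\<eta> * r, t)\<bar>) \<le> K * ((1 + \<bar>N\<bar>) * C)"
        using J(2) K by (intro mult_mono that(2)) auto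
      then show ?thesis using True by (simp add: abs_mult abs_le_iff indicator_def)
    next
      case False
      then have "g (\<eta> * r, t) = 0" "\<eta> \<notin> cbox (-N) N" using g0[OF that(4)] by auto
      then show ?thesis by simp
    qed
  qed
  have Dm [measurable]: "D \<in> borel_measurable borel" by measurable
  note i1 = int[OF f_measurable bound, of "\<lambda>_. 1" \<psi>, simplified]
    and i2 = int[OF f_measurable bound, of "\<lambda>\<eta>. \<eta>" \<psi>x, simplified]
    and i3 = int[OF f_measurable bound, of "\<lambda>_. 1" \<psi>t, simplified]
    and i4 = int[OF Dm D_bound, of "\<lambda>_. 1" \<psi>xx, simplified]
  have sc: "((\<lambda>\<eta>. \<eta> * r) has_real_derivative r) (at \<eta>)" for \<eta>
    by (auto intro!: derivative_eq_intros)
  have \<phi>1: "((\<lambda>\<eta>. \<psi> (\<eta> * r, t)) has_real_derivative r * \<psi>x (\<eta> * r, t)) (at \<eta>)" for \<eta>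
    using DERIV_chain2[OF d(1) sc] by (simp add: mult.commute)
  have \<phi>2: "((\<lambda>\<eta>. r * \<psi>x (\<eta> * r, t)) has_real_derivative t * \<psi>xx (\<eta> * r, t)) (at \<eta>)" for \<eta>
    by (rule DERIV_cong[OF DERIV_cmult[OF DERIV_chain2[OF d(2) sc]]]) (unfold r(2)[symmetric], simp add: mult_ac)
  let ?A = "\<lambda>\<eta>. f \<eta> * (\<psi> (\<eta> * r, t) + \<eta> * (r * \<psi>x (\<eta> * r, t))) / 2 - D \<eta> * (t * \<psi>xx (\<eta> * r, t))"
  have "(?A has_integral 0) UNIV"
    by (rule profile_weak_identity[OF \<phi>1 \<phi>2, of N]) (use g0 in auto)
  moreover have iA: "integrable lborel ?A"
  proof -
    have "integrable lborel (\<lambda>\<eta>. f \<eta> * \<psi> (\<eta> * r, t) / 2 + r / 2 * (f \<eta> * (\<eta> * \<psi>x (\<eta> * r, t))) - t * (D \<eta> * \<psi>xx (\<eta> * r, t)))"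
      by (intro Bochner_Integration.integrable_add Bochner_Integration.integrable_diff integrable_mult_right integrable_divide i1 i2 i4)
    then show ?thesis by (rule back_subst[of "integrable lborel"]) (auto simp: fun_eq_iff field_simps)
  qed
  ultimately have A0: "(LINT \<eta>|lborel. ?A \<eta>) = 0"
    using has_integral_integral_lborel[OF iA] has_integral_unique by blast
  have iB: "integrable lborel (\<lambda>\<eta>. f \<eta> * \<psi>t (\<eta> * r, t) + D \<eta> * \<psi>xx (\<eta> * r, t))"
    by (intro Bochner_Integration.integrable_add i3 i4)
  \<comment> \<open>The multiple \<open>1 / r\<close> of the vanishing integral is the one for which
    the two terms with \<open>u\<close>, that is \<open>\<psi>xx\<close>, cancel, because
    \<open>r * r = t\<close>.\<close>
  have alg: "r * (F * s + d * u) + (1 / r) * (F * (p + e * (r * q)) / 2 - d * (t * u)) = F * (p / (2 * r) + e / 2 * q + r * s)"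
    for F s d u p q e
    unfolding r(2)[symmetric] using r(1) by (simp add: field_simps)
  have "(LINT x|lborel. f (x / r) * \<psi>t (x, t) + D (x / r) * \<psi>xx (x, t))
      = r * (LINT \<eta>|lborel. f \<eta> * \<psi>t (\<eta> * r, t) + D \<eta> * \<psi>xx (\<eta> * r, t))"
    using lborel_integral_real_affine[of r "\<lambda>x. f (x / r) * \<psi>t (x, t) + D (x / r) * \<psi>xx (x, t)" 0] r
    by (simp add: mult.commute)
  also have "\<dots> = r * (LINT \<eta>|lborel. f \<eta> * \<psi>t (\<eta> * r, t) + D \<eta> * \<psi>xx (\<eta> * r, t)) + (1 / r) * (LINT \<eta>|lborel. ?A \<eta>)"
    using A0 by simp
  also have "\<dots> = (LINT \<eta>|lborel. r * (f \<eta> * \<psi>t (\<eta> * r, t) + D \<eta> * \<psi>xx (\<eta> * r, t)) + (1 / r) * ?A \<eta>)"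
    unfolding Bochner_Integration.integral_add[OF integrable_mult_right[OF iB, of r] integrable_mult_right[OF iA, of "1 / r"]]
      integral_mult_right_zero ..
  also have "\<dots> = (LINT \<eta>|lborel. f \<eta> * (\<psi> (\<eta> * r, t) / (2 * r) + \<eta> / 2 * \<psi>x (\<eta> * r, t) + r * \<psi>t (\<eta> * r, t)))"
    by (rule Bochner_Integration.integral_cong[OF refl], rule alg)
  finally show ?thesis unfolding r_def .
qed

end

section \<open>The weak formulation for the self-similar function\<close>

lemma snd_measurable: "snd \<in> borel_measurable (borel :: (real \<times> real) measure)"
  by (intro borel_measurable_continuous_onI continuous_intros)

lemma indicator_snd_measurable:
  assumes "A \<in> sets borel"
  shows "(\<lambda>p::real \<times> real. indicator A (snd p) :: real) \<in> borel_measurable borel"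
  by (rule measurable_compose[OF snd_measurable borel_measurable_indicator[OF assms]])

context self_similar_profile
begin

definition w :: "real \<times> real \<Rightarrow> real" where
  "w p = f (fst p / sqrt (snd p))"

lemma w_measurable: "w \<in> borel_measurable borel"
proof -
  have "fst \<in> borel_measurable (borel :: (real \<times> real) measure)" "(\<lambda>p. sqrt (snd p)) \<in> borel_measurable (borel :: (real \<times> real) measure)"
    by (intro borel_measurable_continuous_onI continuous_intros)+
  then show ?thesis
    unfolding w_def[abs_def] by (intro measurable_compose[OF _ f_measurable] borel_measurable_divide)
qed

lemma weak_integrand_integrable:
  assumes tf: "test_function T \<psi> \<psi>x \<psi>xx \<psi>t" and T: "T > 0"
  shows "integrable lborel (\<lambda>p. indicator (Q T) p * (w p * \<psi>t p + diffusion du dv (w p) * \<psi>xx p))"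
proof -
  have "integrable lborel (\<lambda>p. w p * (indicator (Q T) p * \<psi>t p) + diffusion du dv (w p) * (indicator (Q T) p * \<psi>xx p))"
    by (intro Bochner_Integration.integrable_add test_function_integrable[OF tf T _ w_measurable, where M=M]
        test_function_integrable[OF tf T _ measurable_compose[OF w_measurable diffusion_measurable], where M="(\<bar>du\<bar> + \<bar>dv\<bar>) * M"])
      (auto simp: w_def bound D_bound)
  then show ?thesis by (simp add: algebra_simps)
qed

text \<open>In the variables \<eta> and t the profile does not depend on time. So Fubini and the
  fundamental theorem of calculus leave only boundary terms, and the one at \<open>T\<close>
  vanishes with the test function. Starting at \<open>s > 0\<close> keeps 1 / sqrt t bounded and the
  support bounded in \<eta>.\<close>

lemma late_time_identity:
  assumes tf: "test_function T \<psi> \<psi>x \<psi>xx \<psi>t" and s: "0 < s" "s < T"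
  shows "(LINT p|lborel. indicator {s..<T} (snd p) * (indicator (Q T) p * (w p * \<psi>t p + diffusion du dv (w p) * \<psi>xx p)))
    = - (LINT x|lborel. f (x / sqrt s) * \<psi> (x, s))"
proof -
  have T: "T > 0" using s by auto
  obtain J C where J: "J > 0" "C \<ge> 0"
    "\<And>x t. t \<in> {0..T} \<Longrightarrow> \<bar>x\<bar> > J \<Longrightarrow> \<psi> (x, t) = 0"
    "\<And>x t. t \<in> {0..T} \<Longrightarrow> \<bar>x\<bar> > J \<Longrightarrow> \<psi>x (x, t) = 0"
    "\<And>x t. t \<in> {0..T} \<Longrightarrow> \<bar>x\<bar> > J \<Longrightarrow> \<psi>xx (x, t) = 0"
    "\<And>x t. t \<in> {0<..<T} \<Longrightarrow> \<bar>x\<bar> > J \<Longrightarrow> \<psi>t (x, t) = 0"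
    "\<And>x t g. g \<in> {\<psi>, \<psi>x, \<psi>xx, \<psi>t} \<Longrightarrow> t \<in> {0..T} \<Longrightarrow> \<bar>x\<bar> \<le> J \<Longrightarrow> \<bar>g (x, t)\<bar> \<le> C"
    by (rule test_function_bounds[OF tf T(1)]) blast
  have cont: "\<And>g. g \<in> {\<psi>, \<psi>x, \<psi>xx, \<psi>t} \<Longrightarrow> continuous_on (UNIV \<times> {0..T}) g"
    and \<psi>T: "\<And>x. \<psi> (x, T) = 0"
    using tf unfolding test_function_def C21_def by blast+
  define N where "N = J / sqrt s"
  have N: "\<bar>\<eta> * sqrt t\<bar> > J" if "\<bar>\<eta>\<bar> > N" "t \<ge> s" for \<eta> t
  proof -
    have "J < \<bar>\<eta>\<bar> * sqrt s" using that(1) s unfolding N_def by (simp add: divide_less_eq)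
    also have "\<dots> \<le> \<bar>\<eta>\<bar> * sqrt t" using that(2) by (intro mult_left_mono) auto
    finally show ?thesis using that s by (simp add: abs_mult)
  qed
  define k where "k = (\<lambda>\<eta> t. \<psi> (\<eta> * sqrt t, t) / (2 * sqrt t) + \<eta> / 2 * \<psi>x (\<eta> * sqrt t, t) + sqrt t * \<psi>t (\<eta> * sqrt t, t))"
  have k0: "k \<eta> t = 0" if "\<bar>\<eta>\<bar> > N" "t \<in> {s..<T}" for \<eta> t
    using N[OF that(1), of t] that(2) J(3,4,6) s unfolding k_def by simp
  have kc: "continuous_on (UNIV \<times> {s..T}) (\<lambda>p. k (fst p) (snd p))"
    unfolding k_def using s
    by (intro continuous_intros continuous_on_compose2[OF cont[of \<psi>]] continuous_on_compose2[OF cont[of \<psi>x]]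
        continuous_on_compose2[OF cont[of \<psi>t]]) auto
  let ?K = "cbox (-N, s) (N, T)"
  have kK: "continuous_on ?K (\<lambda>p. k (fst p) (snd p))"
    by (rule continuous_on_subset[OF kc]) auto
  \<comment> \<open>The indicator of \<open>?K\<close> does not change the values
    (\<open>G_eq\<close>), but it makes measurability and a bound follow from continuity on a
    compact box.\<close>
  define G where "G = (\<lambda>\<eta> t. indicator {s..<T} t * (f \<eta> * (indicator ?K (\<eta>, t) * k \<eta> t)))"
  have G_eq: "G \<eta> t = indicator {s..<T} t * (f \<eta> * k \<eta> t)" for \<eta> t
  proof (cases "\<bar>\<eta>\<bar> > N")
    case True
    then show ?thesis using k0[OF True] by (auto simp: G_def indicator_def)
  next
    case False
    then have "t \<in> {s..<T} \<Longrightarrow> (\<eta>, t) \<in> ?K" by auto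
    then show ?thesis by (auto simp: G_def indicator_def)
  qed
  obtain B where B: "\<And>p. p \<in> ?K \<Longrightarrow> \<bar>k (fst p) (snd p)\<bar> \<le> B"
  proof -
    have "compact ((\<lambda>p. k (fst p) (snd p)) ` ?K)" by (intro compact_continuous_image kK) auto
    then obtain B where "\<forall>y\<in>(\<lambda>p. k (fst p) (snd p)) ` ?K. \<bar>y\<bar> \<le> B"
      by (meson bounded_real compact_imp_bounded)
    then show thesis by (intro that[of B]) blast
  qed
  have iG: "integrable (lborel \<Otimes>\<^sub>M lborel) (case_prod G)"
  proof -
    have m1: "(\<lambda>p. indicator ?K p *\<^sub>R k (fst p) (snd p)) \<in> borel_measurable borel"
      by (rule borel_measurable_continuous_on_indicator[OF _ kK]) auto
    have m2: "(\<lambda>p::real\<times>real. f (fst p)) \<in> borel_measurable borel" 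
      by (intro measurable_compose[OF _ f_measurable] borel_measurable_continuous_onI continuous_intros)
    have m3: "(\<lambda>p::real\<times>real. indicator {s..<T} (snd p) :: real) \<in> borel_measurable borel"
      by (rule indicator_snd_measurable) simp
    have M: "M \<ge> 0" using bound[of 0] by linarith
    have "integrable lborel (\<lambda>p. indicator {s..<T} (snd p) * (f (fst p) * (indicator ?K p *\<^sub>R k (fst p) (snd p))))"
    proof (rule integrable_bounded_support[where a="(-N, s)" and b="(N, T)" and C="M * \<bar>B\<bar>"])
      show "(\<lambda>p. indicator {s..<T} (snd p) * (f (fst p) * (indicator ?K p *\<^sub>R k (fst p) (snd p)))) \<in> borel_measurable borel"
        by (intro borel_measurable_times m1 m2 m3)
      fix p
      show "\<bar>indicator {s..<T} (snd p) * (f (fst p) * (indicator ?K p *\<^sub>R k (fst p) (snd p)))\<bar> \<le> M * \<bar>B\<bar> * indicator ?K p"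
      proof (cases "p \<in> ?K")
        case True
        have "\<bar>indicator {s..<T} (snd p)\<bar> * (\<bar>f (fst p)\<bar> * \<bar>k (fst p) (snd p)\<bar>) \<le> 1 * (M * \<bar>B\<bar>)"
          using B[OF True] bound[of "fst p"] M by (intro mult_mono) (auto simp: indicator_def)
        then show ?thesis using True by (simp add: abs_mult)
      qed simp
    qed
    then show ?thesis unfolding lborel_prod G_def by (simp add: split_beta')
  qed
  let ?I = "\<lambda>p. indicator (Q T) p * (w p * \<psi>t p + diffusion du dv (w p) * \<psi>xx p)"
  have iI: "integrable lborel (\<lambda>p. indicator {s..<T} (snd p) * ?I p)"
  proof -
    have "integrable lborel (\<lambda>p. indicator (UNIV \<times> {s..<T}) p *\<^sub>R ?I p)"
    proof (rule integrable_mult_indicator[OF _ weak_integrand_integrable[OF tf T]])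
      have "snd -` {s..<T} = (UNIV :: real set) \<times> {s..<T}" by auto
      then show "UNIV \<times> {s..<T} \<in> sets (lborel :: (real \<times> real) measure)"
        using measurable_sets[OF snd_measurable, of "{s..<T}"] by simp
    qed
    then show ?thesis by (rule back_subst[of "integrable lborel"]) (auto simp: fun_eq_iff indicator_def)
  qed
  have "(LINT p|lborel. indicator {s..<T} (snd p) * ?I p)
     = (LINT t|lborel. LINT x|lborel. indicator {s..<T} t * ?I (x, t))"
    using lborel_pair.integral_snd[of "\<lambda>x t. indicator {s..<T} t * ?I (x, t)"] iI
    by (simp add: lborel_prod split_beta')
  also have "\<dots> = (LINT t|lborel. LINT \<eta>|lborel. G \<eta> t)"
  proof (rule Bochner_Integration.integral_cong[OF refl])
    fix t :: real
    show "(LINT x|lborel. indicator {s..<T} t * ?I (x, t)) = (LINT \<eta>|lborel. G \<eta> t)"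
    proof (cases "t \<in> {s..<T}")
      case True
      then have t: "t \<in> {0<..<T}" using s by auto
      then have "(x, t) \<in> Q T" for x by (simp add: Q_def)
      then have "(LINT x|lborel. indicator {s..<T} t * ?I (x, t)) = (LINT x|lborel. f (x / sqrt t) * \<psi>t (x, t) + D (x / sqrt t) * \<psi>xx (x, t))"
        using True by (simp add: w_def)
      also have "\<dots> = (LINT \<eta>|lborel. G \<eta> t)"
        unfolding slice_identity[OF tf t] G_eq k_def using True by simp
      finally show ?thesis .
    qed (simp add: G_def)
  qed
  also have "\<dots> = (LINT \<eta>|lborel. LINT t|lborel. G \<eta> t)"
    by (rule lborel_pair.Fubini_integral[OF iG])
  also have "\<dots> = (LINT \<eta>|lborel. - (f \<eta> * (sqrt s * \<psi> (\<eta> * sqrt s, s))))"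
  proof (rule Bochner_Integration.integral_cong[OF refl])
    fix \<eta> :: real
    have kct: "continuous_on {s..T} (k \<eta>)"
      by (rule continuous_on_compose2[OF kc, of "{s..T}" "\<lambda>t. (\<eta>, t)", simplified]) (auto intro!: continuous_intros)
    have "(k \<eta> has_integral sqrt T * \<psi> (\<eta> * sqrt T, T) - sqrt s * \<psi> (\<eta> * sqrt s, s)) {s..T}"
    proof (rule fundamental_theorem_of_calculus_interior)
      show "continuous_on {s..T} (\<lambda>t. sqrt t * \<psi> (\<eta> * sqrt t, t))"
        using s by (intro continuous_intros continuous_on_compose2[OF cont[of \<psi>]]) auto
      fix t assume "t \<in> {s<..<T}"
      then have t: "t \<in> {0<..<T}" using s by auto
      then have sq: "(sqrt has_real_derivative 1 / (2 * sqrt t)) (at t)"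
        by (auto intro!: derivative_eq_intros simp: field_simps)
      have "((\<lambda>t. \<psi> (\<eta> * sqrt t, t)) has_real_derivative \<psi>t (\<eta> * sqrt t, t) + \<psi>x (\<eta> * sqrt t, t) * (\<eta> * (1 / (2 * sqrt t)))) (at t)"
        by (rule test_function_chain_rule[OF tf t DERIV_cmult[OF sq]])
      from DERIV_mult[OF sq this]
      have "((\<lambda>t. sqrt t * \<psi> (\<eta> * sqrt t, t)) has_real_derivative k \<eta> t) (at t)"
        by (rule DERIV_cong) (use t in \<open>simp add: k_def field_simps\<close>)
      then show "((\<lambda>t. sqrt t * \<psi> (\<eta> * sqrt t, t)) has_vector_derivative k \<eta> t) (at t)"
        by (simp add: has_real_derivative_iff_has_vector_derivative)
    qed (use s in simp)
    then have h: "integral {s..T} (k \<eta>) = - (sqrt s * \<psi> (\<eta> * sqrt s, s))"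
      using \<psi>T by (simp add: integral_unique)
    have ik: "set_integrable lborel {s..T} (k \<eta>)"
      by (rule borel_integrable_atLeastAtMost'[OF kct])
    have "(LINT t|lborel. G \<eta> t) = (LINT t|lborel. f \<eta> * (indicator {s..T} t * k \<eta> t))"
    proof (rule integral_cong_AE)
      have "(\<lambda>t. indicator {s..T} t * k \<eta> t) \<in> borel_measurable lborel"
        using ik unfolding set_integrable_def by (auto dest: borel_measurable_integrable)
      then have m: "(\<lambda>t. f \<eta> * (indicator {s..T} t * k \<eta> t)) \<in> borel_measurable lborel"
        by (rule borel_measurable_times[OF borel_measurable_const])
      then show "(\<lambda>t. f \<eta> * (indicator {s..T} t * k \<eta> t)) \<in> borel_measurable lborel" .
      have "(\<lambda>t. indicator {s..<T} t * (f \<eta> * (indicator {s..T} t * k \<eta> t))) \<in> borel_measurable lborel"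
        by (rule borel_measurable_times[OF _ m]) simp
      then show "G \<eta> \<in> borel_measurable lborel"
        by (rule back_subst[of "\<lambda>g. g \<in> borel_measurable lborel"]) (auto simp: G_eq fun_eq_iff indicator_def)
      show "AE t in lborel. G \<eta> t = f \<eta> * (indicator {s..T} t * k \<eta> t)"
        using AE_lborel_singleton[of T] by eventually_elim (auto simp: G_eq indicator_def)
    qed
    also have "\<dots> = f \<eta> * integral {s..T} (k \<eta>)"
      using set_borel_integral_eq_integral(2)[OF ik] by (simp add: set_lebesgue_integral_def)
    finally show "(LINT t|lborel. G \<eta> t) = - (f \<eta> * (sqrt s * \<psi> (\<eta> * sqrt s, s)))"
      by (simp add: h)
  qed
  also have "\<dots> = - (LINT x|lborel. f (x / sqrt s) * \<psi> (x, s))"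
    using lborel_integral_real_affine[of "sqrt s" "\<lambda>x. f (x / sqrt s) * \<psi> (x, s)" 0] s
    by (simp add: mult.commute mult.left_commute)
  finally show ?thesis .
qed

text \<open>Let the starting time in \<open>late_time_identity\<close> tend to 0: the similarity
  variable then runs to -infinity for x < 0 and to +infinity for x > 0, and the limits of the
  profile reproduce the initial datum.\<close>

lemma weak_identity:
  assumes tf: "test_function T \<psi> \<psi>x \<psi>xx \<psi>t" and T: "T > 0"
  shows "(LINT p|lborel. indicator (Q T) p * (w p * \<psi>t p + diffusion du dv (w p) * \<psi>xx p))
    = - (LINT x|lborel. initial_datum U V x * \<psi> (x, 0))"
proof -
  obtain J C where J: "J > 0" "C \<ge> 0"
    "\<And>x t. t \<in> {0..T} \<Longrightarrow> \<bar>x\<bar> > J \<Longrightarrow> \<psi> (x, t) = 0"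
    "\<And>x t g. g \<in> {\<psi>, \<psi>x, \<psi>xx, \<psi>t} \<Longrightarrow> t \<in> {0..T} \<Longrightarrow> \<bar>x\<bar> \<le> J \<Longrightarrow> \<bar>g (x, t)\<bar> \<le> C"
    by (rule test_function_bounds[OF tf T(1)]) blast
  have cont: "continuous_on (UNIV \<times> {0..T}) \<psi>"
    using tf unfolding test_function_def C21_def by blast
  have \<psi>m: "(\<lambda>x. \<psi> (x, t)) \<in> borel_measurable borel" if "t \<in> {0..T}" for t
    by (rule borel_measurable_continuous_onI) (use that in \<open>auto intro!: continuous_on_compose2[OF cont] continuous_intros\<close>)
  have M: "M \<ge> 0" using bound[of 0] by linarith
  \<comment> \<open>The shift by 2 keeps \<open>s n\<close> strictly below \<open>T\<close> already
    for \<open>n = 0\<close>.\<close>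
  define s where "s = (\<lambda>n::nat. T / (real n + 2))"
  have s: "0 < s n" "s n < T" for n using T by (auto simp: s_def field_simps add_pos_nonneg)
  have s0: "s \<longlonglongrightarrow> 0"
  proof -
    have "filterlim (\<lambda>n. real n + 2) at_top sequentially"
      by (rule filterlim_at_top_mono[OF filterlim_real_sequentially]) simp
    then show ?thesis
      unfolding s_def by (intro tendsto_divide_0[OF tendsto_const] filterlim_at_top_imp_at_infinity)
  qed
  have sqrt0: "filterlim (\<lambda>n. sqrt (s n)) (at_right 0) sequentially"
    using tendsto_real_sqrt[OF s0] s less_imp_neq[OF s(1), symmetric]
    by (auto simp: filterlim_at intro!: always_eventually)
  let ?I = "\<lambda>p. indicator (Q T) p * (w p * \<psi>t p + diffusion du dv (w p) * \<psi>xx p)"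
  have iI: "integrable lborel ?I" by (rule weak_integrand_integrable[OF tf T])
  have "(\<lambda>n. LINT p|lborel. indicator {s n..<T} (snd p) * ?I p) \<longlonglongrightarrow> (LINT p|lborel. ?I p)"
  proof (rule integral_dominated_convergence[OF _ _ integrable_norm[OF iI]])
    show m: "?I \<in> borel_measurable lborel" by (rule borel_measurable_integrable[OF iI])
    have ind: "(\<lambda>p::real\<times>real. indicator {s n..<T} (snd p) :: real) \<in> borel_measurable lborel" for n
      using indicator_snd_measurable[of "{s n..<T}"] by simp
    show "(\<lambda>p. indicator {s n..<T} (snd p) * ?I p) \<in> borel_measurable lborel" for n
      by (rule borel_measurable_times[OF ind m])
    show "AE p in lborel. norm (indicator {s n..<T} (snd p) * ?I p) \<le> norm (?I p)" for n
      by (rule AE_I2) (simp add: indicator_def)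
    show "AE p in lborel. (\<lambda>n. indicator {s n..<T} (snd p) * ?I p) \<longlonglongrightarrow> ?I p"
    proof (rule AE_I2)
      fix p :: "real \<times> real"
      show "(\<lambda>n. indicator {s n..<T} (snd p) * ?I p) \<longlonglongrightarrow> ?I p"
      proof (cases "p \<in> Q T")
        case True
        then have "0 < snd p" "snd p < T" by (auto simp: Q_def)
        have "\<forall>\<^sub>F n in sequentially. indicator {s n..<T} (snd p) * ?I p = ?I p"
          using order_tendstoD(2)[OF s0 \<open>0 < snd p\<close>] by eventually_elim (use \<open>snd p < T\<close> in simp)
        then show ?thesis by (rule tendsto_eventually)
      qed simp
    qed
  qed
  moreover have "(\<lambda>n. LINT x|lborel. f (x / sqrt (s n)) * \<psi> (x, s n)) \<longlonglongrightarrow> (LINT x|lborel. initial_datum U V x * \<psi> (x, 0))"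
  proof (rule integral_dominated_convergence[where w="\<lambda>x. M * C * indicator {-J..J} x"])
    show "integrable lborel (\<lambda>x. M * C * indicator {-J..J} x)"
      using emeasure_lborel_cbox_finite[of "-J" J]
      by (intro integrable_mult_right integrable_real_indicator) auto
    have "initial_datum U V \<in> borel_measurable borel" unfolding initial_datum_def[abs_def] by measurable
    then show "(\<lambda>x. initial_datum U V x * \<psi> (x, 0)) \<in> borel_measurable lborel"
      using \<psi>m[of 0] T by (auto intro!: borel_measurable_times)
    show "(\<lambda>x. f (x / sqrt (s n)) * \<psi> (x, s n)) \<in> borel_measurable lborel" for n
      using \<psi>m[of "s n"] s[of n] by (auto intro!: borel_measurable_times measurable_compose[OF _ f_measurable])
    show "AE x in lborel. norm (f (x / sqrt (s n)) * \<psi> (x, s n)) \<le> M * C * indicator {-J..J} x" for n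
    proof (rule AE_I2)
      fix x
      have sn: "s n \<in> {0..T}" using s[of n] by auto
      show "norm (f (x / sqrt (s n)) * \<psi> (x, s n)) \<le> M * C * indicator {-J..J} x"
      proof (cases "\<bar>x\<bar> \<le> J")
        case True
        then have "\<bar>f (x / sqrt (s n))\<bar> * \<bar>\<psi> (x, s n)\<bar> \<le> M * C"
          using J(4)[of \<psi>, OF _ sn True] M by (intro mult_mono bound) auto
        then show ?thesis using True by (simp add: abs_mult indicator_def abs_le_iff)
      next
        case False
        then show ?thesis using J(3)[OF sn, of x] J M by simp
      qed
    qed
    show "AE x in lborel. (\<lambda>n. f (x / sqrt (s n)) * \<psi> (x, s n)) \<longlonglongrightarrow> initial_datum U V x * \<psi> (x, 0)"
      using AE_lborel_singleton[of 0]
    proof eventually_elim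
      case (elim x)
      have "continuous_on {0..T} (\<lambda>t. \<psi> (x, t))"
        by (intro continuous_on_compose2[OF cont] continuous_intros) auto
      then have 1: "(\<lambda>n. \<psi> (x, s n)) \<longlonglongrightarrow> \<psi> (x, 0)"
        by (rule continuous_on_tendsto_compose[OF _ s0]) (use s T in \<open>auto intro!: always_eventually less_imp_le\<close>)
      have inv: "filterlim (\<lambda>n. inverse (sqrt (s n))) at_top sequentially"
        by (rule filterlim_compose[OF filterlim_inverse_at_top_right sqrt0])
      have "(\<lambda>n. f (x / sqrt (s n))) \<longlonglongrightarrow> initial_datum U V x"
      proof (cases "x < 0")
        case True
        have "filterlim (\<lambda>n. x * inverse (sqrt (s n))) at_bot sequentially"
          by (rule filterlim_tendsto_neg_mult_at_bot[OF tendsto_const True inv])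
        from filterlim_compose[OF limits(1) this] show ?thesis
          using True by (simp add: initial_datum_def divide_inverse)
      next
        case False
        then have "x > 0" using elim by simp
        then have "filterlim (\<lambda>n. x * inverse (sqrt (s n))) at_top sequentially"
          by (rule filterlim_tendsto_pos_mult_at_top[OF tendsto_const _ inv])
        from filterlim_compose[OF limits(2) this] show ?thesis
          using False by (simp add: initial_datum_def divide_inverse)
      qed
      then show ?case by (intro tendsto_mult 1)
    qed
  qed
  then have "(\<lambda>n. - (LINT x|lborel. f (x / sqrt (s n)) * \<psi> (x, s n))) \<longlonglongrightarrow> - (LINT x|lborel. initial_datum U V x * \<psi> (x, 0))"
    by (rule tendsto_minus)
  ultimately show ?thesis
    unfolding late_time_identity[OF tf s] by (rule LIMSEQ_unique)
qed

lemma self_similar_weak_solution: "weak_solution du dv U V w"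
  unfolding weak_solution_def
proof (intro conjI allI impI)
  show "w \<in> L_infinity (UNIV \<times> {0..})"
    unfolding L_infinity_def mem_Collect_eq
  proof
    show "w \<in> borel_measurable (lebesgue_on (UNIV \<times> {0..}))"
      using w_measurable by (intro measurable_restrict_space1 measurable_completion) simp
    show "\<exists>C. AE p in lebesgue_on (UNIV \<times> {0..}). \<bar>w p\<bar> \<le> C"
      by (intro exI[of _ M] AE_I2) (simp add: w_def bound)
  qed
  fix T \<psi> \<psi>x \<psi>xx \<psi>t assume T: "(T::real) > 0" and tf: "test_function T \<psi> \<psi>x \<psi>xx \<psi>t"
  have "(LINT p:Q T|lebesgue. w p * \<psi>t p + diffusion du dv (w p) * \<psi>xx p)
    = (LINT p|lborel. indicator (Q T) p * (w p * \<psi>t p + diffusion du dv (w p) * \<psi>xx p))"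
    unfolding set_lebesgue_integral_def real_scaleR_def
    by (rule integral_completion) (rule borel_measurable_integrable[OF weak_integrand_integrable[OF tf T]])
  also have "\<dots> = - (LINT x|lborel. initial_datum U V x * \<psi> (x, 0))"
    by (rule weak_identity[OF tf T])
  also have "(LINT x|lborel. initial_datum U V x * \<psi> (x, 0)) = (LINT x|lebesgue. initial_datum U V x * \<psi> (x, 0))"
  proof (rule integral_completion[symmetric])
    have "continuous_on (UNIV \<times> {0..T}) \<psi>"
      using tf unfolding test_function_def C21_def by blast
    then have "continuous_on UNIV (\<lambda>x. \<psi> (x, 0))"
      by (rule continuous_on_compose2) (use T in \<open>auto intro!: continuous_intros\<close>)
    then have [measurable]: "(\<lambda>x. \<psi> (x, 0)) \<in> borel_measurable borel"
      by (rule borel_measurable_continuous_onI)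
    have [measurable]: "initial_datum U V \<in> borel_measurable borel" unfolding initial_datum_def[abs_def] by measurable
    show "(\<lambda>x. initial_datum U V x * \<psi> (x, 0)) \<in> borel_measurable lborel"
      by simp
  qed
  finally show "(LINT p:Q T|lebesgue. w p * \<psi>t p + diffusion du dv (w p) * \<psi>xx p)
    = - (LINT x|lebesgue. initial_datum U V x * \<psi> (x, 0))" .
qed

end

section \<open>The profiles and the free boundary\<close>

lemma left_profile_gauss_tail: "left_profile d U a \<eta> = U * (1 - gauss_tail d \<eta> / gauss_tail d a)"
  by (simp add: left_profile_def gauss_tail_def)

lemma right_profile_gauss_tail: "right_profile d V a \<eta> = - V * (1 - gauss_tail d (- \<eta>) / gauss_tail d (- a))"
  unfolding right_profile_def gauss_tail_reflect ..

lemma gauss_tail_ratio: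
  assumes "d > 0" "\<eta> \<le> a"
  shows "gauss_tail d \<eta> / gauss_tail d a \<in> {0<..1}" "\<eta> < a \<Longrightarrow> gauss_tail d \<eta> / gauss_tail d a < 1"
  using assms gauss_tail_pos[OF assms(1)] strict_mono_less_eq[OF gauss_tail_strict_mono[OF assms(1)], of \<eta> a]
    strict_mono_less[OF gauss_tail_strict_mono[OF assms(1)], of \<eta> a]
  by (auto simp: divide_le_eq divide_less_eq)

lemma left_profile_bounds:
  assumes "d > 0" "U > 0" "\<eta> \<le> a"
  shows "0 \<le> left_profile d U a \<eta>" "left_profile d U a \<eta> \<le> U" "\<eta> < a \<Longrightarrow> 0 < left_profile d U a \<eta>"
    "left_profile d U a a = 0"
  using gauss_tail_ratio[OF assms(1,3)] assms gauss_tail_pos[OF assms(1), of a]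
  by (auto simp: left_profile_gauss_tail)

lemma right_profile_bounds:
  assumes "d > 0" "V > 0" "a < \<eta>"
  shows "right_profile d V a \<eta> < 0" "- V \<le> right_profile d V a \<eta>"
  using gauss_tail_ratio[of d "- \<eta>" "- a"] assms
  by (auto simp: right_profile_gauss_tail mult_less_0_iff)

lemma left_profile_deriv:
  assumes "d > 0"
  shows "(left_profile d U a has_real_derivative - U * exp (- \<eta>\<^sup>2 / (4 * d)) / gauss_tail d a) (at \<eta>)"
  unfolding left_profile_gauss_tail[abs_def]
  using gauss_tail_pos[OF assms, of a]
  by (auto intro!: derivative_eq_intros gauss_tail_deriv[OF assms])

lemma right_profile_deriv:
  assumes "d > 0"
  shows "(right_profile d V a has_real_derivative - V * exp (- \<eta>\<^sup>2 / (4 * d)) / gauss_tail d (- a)) (at \<eta>)"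
proof -
  have "(uminus has_real_derivative - 1) (at \<eta>)"
    by (auto intro!: derivative_eq_intros)
  from DERIV_chain2[OF gauss_tail_deriv[OF assms] this]
  have "((\<lambda>\<eta>. gauss_tail d (- \<eta>)) has_real_derivative - exp (- \<eta>\<^sup>2 / (4 * d))) (at \<eta>)"
    by simp
  then show ?thesis
    unfolding right_profile_gauss_tail[abs_def]
    using gauss_tail_pos[OF assms, of "- a"]
    by (auto intro!: derivative_eq_intros)
qed

lemma gauss_deriv:
  assumes "d > 0"
  shows "((\<lambda>\<eta>. c * exp (- \<eta>\<^sup>2 / (4 * d)) / b) has_real_derivative - (\<eta> / 2 * (c * exp (- \<eta>\<^sup>2 / (4 * d)) / b)) / d) (at \<eta>)"
proof -
  have "((\<lambda>\<eta>. - \<eta>\<^sup>2 / (4 * d)) has_real_derivative - (\<eta> / (2 * d))) (at \<eta>)"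
    using assms by (auto intro!: derivative_eq_intros)
  from DERIV_cdivide[OF DERIV_cmult[OF DERIV_chain2[OF DERIV_exp this], of c], of b]
  show ?thesis by (rule DERIV_cong) (simp add: field_simps)
qed

lemma left_profile_at_bot:
  assumes "d > 0"
  shows "(left_profile d U a \<longlongrightarrow> U) at_bot"
  unfolding left_profile_gauss_tail[abs_def]
  using gauss_tail_pos[OF assms, of a] by (auto intro!: tendsto_eq_intros gauss_tail_at_bot[OF assms])

lemma right_profile_at_top:
  assumes "d > 0"
  shows "(right_profile d V a \<longlongrightarrow> - V) at_top"
proof -
  have "((\<lambda>\<eta>. gauss_tail d (- \<eta>)) \<longlongrightarrow> 0) at_top"
    using gauss_tail_at_bot[OF assms] by (simp add: filterlim_at_bot_mirror)
  then show ?thesis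
    unfolding right_profile_gauss_tail[abs_def]
    using gauss_tail_pos[OF assms, of "- a"] by (auto intro!: tendsto_eq_intros)
qed

lemma self_similar_profile_nondegenerate:
  assumes "du > 0" "dv > 0" "U > 0" "V > 0" "interface_eq du dv U V a"
  shows "self_similar_profile du dv a U V (U + V) (\<lambda>\<eta>. if \<eta> \<le> a then left_profile du U a \<eta> else right_profile dv V a \<eta>)
    (left_profile du U a) (\<lambda>\<eta>. - U * exp (- \<eta>\<^sup>2 / (4 * du)) / gauss_tail du a)
      (\<lambda>\<eta>. - (\<eta> / 2 * (- U * exp (- \<eta>\<^sup>2 / (4 * du)) / gauss_tail du a)) / du)
    (right_profile dv V a) (\<lambda>\<eta>. - V * exp (- \<eta>\<^sup>2 / (4 * dv)) / gauss_tail dv (- a))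
      (\<lambda>\<eta>. - (\<eta> / 2 * (- V * exp (- \<eta>\<^sup>2 / (4 * dv)) / gauss_tail dv (- a))) / dv)"
    (is "self_similar_profile _ _ _ _ _ _ ?f _ _ _ _ _ _")
proof unfold_locales
  note gp = gauss_tail_pos[OF assms(1), of a] gauss_tail_pos[OF assms(2), of "- a"]
  show "diffusion du dv (?f \<eta>) = (if \<eta> \<le> a then du * left_profile du U a \<eta> else dv * right_profile dv V a \<eta>)" for \<eta>
    using left_profile_bounds(1)[OF assms(1,3), of \<eta> a] right_profile_bounds(1)[OF assms(2,4), of a \<eta>]
    by (auto simp: diffusion_def)
  show "\<bar>?f \<eta>\<bar> \<le> U + V" for \<eta>
    using left_profile_bounds(1,2)[OF assms(1,3), of \<eta> a] right_profile_bounds[OF assms(2,4), of a \<eta>] assms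
    by auto
  show "(?f \<longlongrightarrow> U) at_bot"
    by (rule Lim_transform_eventually[OF left_profile_at_bot[OF assms(1)]])
      (use eventually_le_at_bot[of a] in eventually_elim, simp)
  show "(?f \<longlongrightarrow> - V) at_top"
    by (rule Lim_transform_eventually[OF right_profile_at_top[OF assms(2)]])
      (use eventually_gt_at_top[of a] in eventually_elim, simp)
  show "left_profile du U a a = 0" by (rule left_profile_bounds(4)[OF assms(1,3) order_refl])
  show r0: "dv * right_profile dv V a a = 0" using gp by (simp add: right_profile_gauss_tail)
  \<comment> \<open>Both one-sided values of the profile at \<open>a\<close> are 0, so the
    Rankine-Hugoniot condition reduces to equality of the two fluxes. That is the interface equation
    divided by the Gaussian tails and exponentials.\<close>
  have "du * U * (exp (a\<^sup>2 / (4 * dv)) * gauss_tail dv (- a)) = dv * V * (exp (a\<^sup>2 / (4 * du)) * gauss_tail du a)"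
    using assms(5) by (simp add: interface_eq_mills mills_def)
  then have "du * U / (exp (a\<^sup>2 / (4 * du)) * gauss_tail du a) = dv * V / (exp (a\<^sup>2 / (4 * dv)) * gauss_tail dv (- a))"
    using gp by (simp add: frac_eq_eq mult_ac)
  then show "du * (- U * exp (- a\<^sup>2 / (4 * du)) / gauss_tail du a)
    = a / 2 * right_profile dv V a a + dv * (- V * exp (- a\<^sup>2 / (4 * dv)) / gauss_tail dv (- a))"
    using r0 assms(2) by (simp add: exp_minus field_simps)
  show "(left_profile du U a has_real_derivative - U * exp (- \<eta>\<^sup>2 / (4 * du)) / gauss_tail du a) (at \<eta>)" for \<eta>
    by (rule left_profile_deriv[OF assms(1)])
  show "((\<lambda>\<eta>. - U * exp (- \<eta>\<^sup>2 / (4 * du)) / gauss_tail du a) has_real_derivative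
      - (\<eta> / 2 * (- U * exp (- \<eta>\<^sup>2 / (4 * du)) / gauss_tail du a)) / du) (at \<eta>)" for \<eta>
    by (rule gauss_deriv[OF assms(1)])
  show "(right_profile dv V a has_real_derivative - V * exp (- \<eta>\<^sup>2 / (4 * dv)) / gauss_tail dv (- a)) (at \<eta>)" for \<eta>
    by (rule right_profile_deriv[OF assms(2)])
  show "((\<lambda>\<eta>. - V * exp (- \<eta>\<^sup>2 / (4 * dv)) / gauss_tail dv (- a)) has_real_derivative
      - (\<eta> / 2 * (- V * exp (- \<eta>\<^sup>2 / (4 * dv)) / gauss_tail dv (- a))) / dv) (at \<eta>)" for \<eta>
    by (rule gauss_deriv[OF assms(2)])
qed (use assms in simp_all)

lemma self_similar_profile_degenerate:
  assumes "du > 0" "U > 0" "V > 0" "interface_eq_degenerate du U V a"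
  shows "self_similar_profile du 0 a U V (U + V) (\<lambda>\<eta>. if \<eta> \<le> a then left_profile du U a \<eta> else - V)
    (left_profile du U a) (\<lambda>\<eta>. - U * exp (- \<eta>\<^sup>2 / (4 * du)) / gauss_tail du a)
      (\<lambda>\<eta>. - (\<eta> / 2 * (- U * exp (- \<eta>\<^sup>2 / (4 * du)) / gauss_tail du a)) / du)
    (\<lambda>_. - V) (\<lambda>_. 0) (\<lambda>_. 0)"
    (is "self_similar_profile _ _ _ _ _ _ ?f _ _ _ _ _ _")
proof unfold_locales
  note gp = gauss_tail_pos[OF assms(1), of a]
  show "diffusion du 0 (?f \<eta>) = (if \<eta> \<le> a then du * left_profile du U a \<eta> else 0 * - V)" for \<eta>
    using left_profile_bounds(1)[OF assms(1,2), of \<eta> a] assms(3)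
    by (auto simp: diffusion_def)
  show "\<bar>?f \<eta>\<bar> \<le> U + V" for \<eta>
    using left_profile_bounds(1,2)[OF assms(1,2), of \<eta> a] assms by auto
  show "(?f \<longlongrightarrow> U) at_bot"
    by (rule Lim_transform_eventually[OF left_profile_at_bot[OF assms(1)]])
      (use eventually_le_at_bot[of a] in eventually_elim, simp)
  show "(?f \<longlongrightarrow> - V) at_top"
    by (rule Lim_transform_eventually[OF tendsto_const])
      (use eventually_gt_at_top[of a] in eventually_elim, simp)
  show "left_profile du U a a = 0" by (rule left_profile_bounds(4)[OF assms(1,2) order_refl])
  \<comment> \<open>Here the profile jumps from 0 to \<open>- V\<close> and the flux on the right is
    0, so the flux on the left has to balance the jump times \<open>a / 2\<close>, the speed of the
    interface in similarity variables.\<close>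
  have "U = V * a / (2 * du) * (exp (a\<^sup>2 / (4 * du)) * gauss_tail du a)"
    using assms(4) by (simp add: interface_eq_degenerate_mills mills_def)
  then have "du * U / (exp (a\<^sup>2 / (4 * du)) * gauss_tail du a) = a / 2 * V"
    using gp assms(1) by (simp add: divide_eq_eq)
  then show "du * (- U * exp (- a\<^sup>2 / (4 * du)) / gauss_tail du a) = a / 2 * - V + 0 * 0"
    by (simp add: exp_minus field_simps)
  show "(left_profile du U a has_real_derivative - U * exp (- \<eta>\<^sup>2 / (4 * du)) / gauss_tail du a) (at \<eta>)" for \<eta>
    by (rule left_profile_deriv[OF assms(1)])
  show "((\<lambda>\<eta>. - U * exp (- \<eta>\<^sup>2 / (4 * du)) / gauss_tail du a) has_real_derivative
      - (\<eta> / 2 * (- U * exp (- \<eta>\<^sup>2 / (4 * du)) / gauss_tail du a)) / du) (at \<eta>)" for \<eta>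
    by (rule gauss_deriv[OF assms(1)])
qed (use assms in simp_all)

section \<open>The free boundary from signs almost everywhere\<close>

lemma Q_sets_lebesgue: "Q T \<in> sets lebesgue"
  using Q_measurable by (simp add: sets_completionI_sets)

text \<open>If two continuous curves differ at an interior time, the points strictly between them
  near that time form a nonempty open set (\<open>W\<close>), which is not negligible. On it the two
  descriptions of the sign of \<open>w\<close> contradict each other. So the curves agree at
  interior times, and continuity carries this to 0 and \<open>T\<close>.\<close>

lemma free_boundary_iff:
  assumes sign: "\<And>\<eta>. f \<eta> > 0 \<longleftrightarrow> \<eta> < a" "\<And>\<eta>. f \<eta> < 0 \<longleftrightarrow> \<eta> > (a::real)" and T: "T > 0"
    and w: "AE (x, t) in lebesgue_on (Q T). w (x, t) = f (x / sqrt t)"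
  shows "free_boundary T w \<xi> \<longleftrightarrow> (\<forall>t\<in>{0..T}. \<xi> t = a * sqrt t)"
proof -
  have scale: "x / sqrt t < a \<longleftrightarrow> x < a * sqrt t" "x / sqrt t > a \<longleftrightarrow> x > a * sqrt t" if "t > 0" for x t
    using that by (auto simp: divide_less_eq less_divide_eq)
  have w': "AE p in lborel. p \<in> Q T \<longrightarrow> (w p > 0 \<longleftrightarrow> fst p < a * sqrt (snd p)) \<and> (w p < 0 \<longleftrightarrow> fst p > a * sqrt (snd p))"
  proof -
    have "AE p in lborel. p \<in> Q T \<longrightarrow> (case p of (x, t) \<Rightarrow> w (x, t) = f (x / sqrt t))"
      using w Q_sets_lebesgue by (simp add: AE_restrict_space_iff AE_completion_iff)
    then show ?thesis
      by eventually_elim (auto simp: sign scale Q_def)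
  qed
  have fb: "free_boundary T w \<xi> \<longleftrightarrow> continuous_on {0..T} \<xi> \<and>
     (AE p in lborel. p \<in> Q T \<longrightarrow> (w p > 0 \<longleftrightarrow> fst p < \<xi> (snd p)) \<and> (w p < 0 \<longleftrightarrow> fst p > \<xi> (snd p)))"
  proof -
    have "Q T \<inter> space lebesgue \<in> sets lebesgue" using Q_sets_lebesgue by simp
    from AE_restrict_space_iff[OF this] show ?thesis
      unfolding free_boundary_def by (simp only: AE_completion_iff split_beta' prod.collapse)
  qed
  show ?thesis
  proof
    assume *: "\<forall>t\<in>{0..T}. \<xi> t = a * sqrt t"
    have "continuous_on {0..T} (\<lambda>t. a * sqrt t)" by (intro continuous_intros)
    then have "continuous_on {0..T} \<xi>" by (rule continuous_on_eq) (use * in simp)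
    moreover have "AE p in lborel. p \<in> Q T \<longrightarrow> (w p > 0 \<longleftrightarrow> fst p < \<xi> (snd p)) \<and> (w p < 0 \<longleftrightarrow> fst p > \<xi> (snd p))"
      using w' by eventually_elim (use * in \<open>auto simp: Q_def\<close>)
    ultimately show "free_boundary T w \<xi>" unfolding fb by blast
  next
    assume "free_boundary T w \<xi>"
    then have c: "continuous_on {0..T} \<xi>"
      and ae: "AE p in lborel. p \<in> Q T \<longrightarrow> (w p > 0 \<longleftrightarrow> fst p < \<xi> (snd p)) \<and> (w p < 0 \<longleftrightarrow> fst p > \<xi> (snd p))"
      unfolding fb by auto
    let ?d = "\<lambda>t. \<xi> t - a * sqrt t"
    have cd: "continuous_on {0..T} ?d" by (intro continuous_intros c)
    have dz: "?d t = 0" if t: "t \<in> {0<..<T}" for t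
    proof (rule ccontr)
      assume "?d t \<noteq> 0"
      define W where "W = {p \<in> Q T. (fst p - a * sqrt (snd p)) * (fst p - \<xi> (snd p)) < 0}"
      have "continuous_on (Q T) (\<lambda>p. (fst p - a * sqrt (snd p)) * (fst p - \<xi> (snd p)))"
        by (intro continuous_intros continuous_on_compose2[OF c]) (auto simp: Q_def)
      moreover have "open (Q T)" by (auto simp: Q_def intro!: open_Times)
      ultimately have "open (Q T \<inter> (\<lambda>p. (fst p - a * sqrt (snd p)) * (fst p - \<xi> (snd p))) -` {..<0})"
        by (rule continuous_open_preimage) simp
      moreover have "W = Q T \<inter> (\<lambda>p. (fst p - a * sqrt (snd p)) * (fst p - \<xi> (snd p))) -` {..<0}"
        unfolding W_def by blast
      ultimately have "open W" by simp
      define x where "x = (\<xi> t + a * sqrt t) / 2"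
      have "(x - a * sqrt t) * (x - \<xi> t) = - (?d t / 2)\<^sup>2"
        unfolding x_def by (simp add: field_simps power2_eq_square)
      also have "\<dots> < 0" using \<open>?d t \<noteq> 0\<close> by simp
      finally have "(x, t) \<in> W" unfolding W_def using t by (auto simp: Q_def)
      then have "\<not> negligible W"
        using open_not_negligible[OF \<open>open W\<close>] by blast
      moreover have "AE p in lborel. p \<notin> W"
        using ae w' by eventually_elim (auto simp: W_def mult_less_0_iff)
      then have "W \<in> null_sets lborel"
        using \<open>open W\<close> by (subst AE_iff_null_sets) auto
      then have "negligible W"
        by (simp add: negligible_iff_null_sets null_sets_completionI)
      ultimately show False by blast
    qed
    have cl: "closure {0<..<T} = {0..T}" using T by (simp add: closure_greaterThanLessThan)
    show "\<forall>t\<in>{0..T}. \<xi> t = a * sqrt t"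
    proof
      fix t assume "t \<in> {0..T}"
      then have "?d t = 0"
        using continuous_constant_on_closure[of "{0<..<T}" ?d 0 t] cd dz unfolding cl by blast
      then show "\<xi> t = a * sqrt t" by simp
    qed
  qed
qed

lemma self_similar_conclusion:
  assumes "self_similar_profile du dv a U V M f fl fl1 fl2 fr fr1 fr2" "du > 0" "dv \<ge> 0"
    and sign: "\<And>\<eta>. f \<eta> > 0 \<longleftrightarrow> \<eta> < a" "\<And>\<eta>. f \<eta> < 0 \<longleftrightarrow> \<eta> > a"
  shows "\<exists>w. weak_solution du dv U V w \<and>
           (\<forall>w'. weak_solution du dv U V w' \<longrightarrow> (AE p in lebesgue_on (UNIV \<times> {0..}). w' p = w p))"
    and "\<forall>w. weak_solution du dv U V w \<longrightarrow> (\<forall>T>0.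
           (AE (x, t) in lebesgue_on (Q T). w (x, t) = f (x / sqrt t)) \<and>
           (\<forall>\<xi>. free_boundary T w \<xi> \<longleftrightarrow> (\<forall>t\<in>{0..T}. \<xi> t = a * sqrt t)))"
proof -
  interpret self_similar_profile du dv a U V M f fl fl1 fl2 fr fr1 fr2 by (rule assms(1))
  note unique = weak_solution_unique[OF assms(2,3)]
  show "\<exists>w. weak_solution du dv U V w \<and>
           (\<forall>w'. weak_solution du dv U V w' \<longrightarrow> (AE p in lebesgue_on (UNIV \<times> {0..}). w' p = w p))"
    using self_similar_weak_solution unique by blast
  show "\<forall>w. weak_solution du dv U V w \<longrightarrow> (\<forall>T>0.
           (AE (x, t) in lebesgue_on (Q T). w (x, t) = f (x / sqrt t)) \<and>
           (\<forall>\<xi>. free_boundary T w \<xi> \<longleftrightarrow> (\<forall>t\<in>{0..T}. \<xi> t = a * sqrt t)))"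
  proof (intro allI impI)
    fix v and T :: real assume v: "weak_solution du dv U V v" and T: "T > 0"
    have S: "UNIV \<times> {0..} \<in> sets (lebesgue :: (real \<times> real) measure)"
      by (intro sets_completionI_sets) (auto intro!: borel_closed closed_Times)
    have "AE p in lborel. p \<in> UNIV \<times> {0..} \<longrightarrow> v p = w p"
      using unique[OF v self_similar_weak_solution] S by (simp add: AE_restrict_space_iff AE_completion_iff)
    then have "AE p in lborel. p \<in> Q T \<longrightarrow> (case p of (x, t) \<Rightarrow> v (x, t) = f (x / sqrt t))"
      by eventually_elim (auto simp: Q_def w_def)
    then have *: "AE (x, t) in lebesgue_on (Q T). v (x, t) = f (x / sqrt t)"
      using Q_sets_lebesgue by (simp add: AE_restrict_space_iff AE_completion_iff)
    then show "(AE (x, t) in lebesgue_on (Q T). v (x, t) = f (x / sqrt t)) \<and>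
           (\<forall>\<xi>. free_boundary T v \<xi> \<longleftrightarrow> (\<forall>t\<in>{0..T}. \<xi> t = a * sqrt t))"
      using free_boundary_iff[OF sign T *] by blast
  qed
qed

theorem theorem2p26:
  fixes d\<^sub>u d\<^sub>v U\<^sub>0 V\<^sub>0 :: real
  assumes "d\<^sub>u > 0" and "d\<^sub>v \<ge> 0" and "U\<^sub>0 > 0" and "V\<^sub>0 > 0"
  shows "(\<exists>w. weak_solution d\<^sub>u d\<^sub>v U\<^sub>0 V\<^sub>0 w \<and>
              (\<forall>w'. weak_solution d\<^sub>u d\<^sub>v U\<^sub>0 V\<^sub>0 w' \<longrightarrow>
                    (AE p in lebesgue_on (UNIV \<times> {0..}). w' p = w p))) \<and>
         (\<exists>(f :: real \<Rightarrow> real) (a :: real).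
            (\<forall>w. weak_solution d\<^sub>u d\<^sub>v U\<^sub>0 V\<^sub>0 w \<longrightarrow>
               (\<forall>T>0.
                  (AE (x, t) in lebesgue_on (Q T). w (x, t) = f (x / sqrt t)) \<and>
                  (\<forall>\<xi>. free_boundary T w \<xi> \<longleftrightarrow> (\<forall>t\<in>{0..T}. \<xi> t = a * sqrt t)))) \<and>
            (d\<^sub>v > 0 \<longrightarrow>
               interface_eq d\<^sub>u d\<^sub>v U\<^sub>0 V\<^sub>0 a \<and>
               (\<forall>b. interface_eq d\<^sub>u d\<^sub>v U\<^sub>0 V\<^sub>0 b \<longrightarrow> b = a) \<and>
               (\<forall>\<eta>. f \<eta> = (if \<eta> \<le> a then left_profile d\<^sub>u U\<^sub>0 a \<eta>
                                  else right_profile d\<^sub>v V\<^sub>0 a \<eta>))) \<and>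
            (d\<^sub>v = 0 \<longrightarrow>
               a > 0 \<and>
               interface_eq_degenerate d\<^sub>u U\<^sub>0 V\<^sub>0 a \<and>
               (\<forall>b. interface_eq_degenerate d\<^sub>u U\<^sub>0 V\<^sub>0 b \<longrightarrow> b = a) \<and>
               (\<forall>\<eta>. f \<eta> = (if \<eta> \<le> a then left_profile d\<^sub>u U\<^sub>0 a \<eta> else - V\<^sub>0))))"
proof (cases "d\<^sub>v > 0")
  case True
  obtain a where a: "interface_eq d\<^sub>u d\<^sub>v U\<^sub>0 V\<^sub>0 a" "\<And>b. interface_eq d\<^sub>u d\<^sub>v U\<^sub>0 V\<^sub>0 b \<Longrightarrow> b = a"
    using interface_eq_ex1[OF assms(1) True assms(3,4)] by blast
  define f where "f = (\<lambda>\<eta>. if \<eta> \<le> a then left_profile d\<^sub>u U\<^sub>0 a \<eta> else right_profile d\<^sub>v V\<^sub>0 a \<eta>)"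
  have sign: "f \<eta> > 0 \<longleftrightarrow> \<eta> < a" "f \<eta> < 0 \<longleftrightarrow> \<eta> > a" for \<eta>
    using left_profile_bounds[OF assms(1,3), of \<eta> a] right_profile_bounds(1)[OF True assms(4), of a \<eta>]
    by (cases "\<eta> = a"; force simp: f_def)+
  note concl = self_similar_conclusion[OF self_similar_profile_nondegenerate[OF assms(1) True assms(3,4) a(1), folded f_def] assms(1,2) sign]
  have "d\<^sub>v \<noteq> 0" "\<forall>\<eta>. f \<eta> = (if \<eta> \<le> a then left_profile d\<^sub>u U\<^sub>0 a \<eta> else right_profile d\<^sub>v V\<^sub>0 a \<eta>)"
    using True by (auto simp: f_def)
  then show ?thesis
    by (intro conjI[OF concl(1)], intro exI[of _ f] exI[of _ a] conjI[OF concl(2)]) (use a in blast)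
next
  case False
  then have dv: "d\<^sub>v = 0" using assms by simp
  obtain a where a: "a > 0" "interface_eq_degenerate d\<^sub>u U\<^sub>0 V\<^sub>0 a" "\<And>b. interface_eq_degenerate d\<^sub>u U\<^sub>0 V\<^sub>0 b \<Longrightarrow> b = a"
    using interface_eq_degenerate_ex1[OF assms(1,3,4)] by blast
  define f where "f = (\<lambda>\<eta>. if \<eta> \<le> a then left_profile d\<^sub>u U\<^sub>0 a \<eta> else - V\<^sub>0)"
  \<comment> \<open>The left branch owns the point \<open>a\<close> and vanishes there, so both
    equivalences hold at the jump as well.\<close>
  have sign: "f \<eta> > 0 \<longleftrightarrow> \<eta> < a" "f \<eta> < 0 \<longleftrightarrow> \<eta> > a" for \<eta>
    using left_profile_bounds[OF assms(1,3), of \<eta> a] assms(4)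
    by (cases "\<eta> = a"; force simp: f_def)+
  note concl = self_similar_conclusion[OF self_similar_profile_degenerate[OF assms(1,3,4) a(2), folded f_def] assms(1) order_refl sign]
  have "\<not> (0::real) < 0" "\<forall>\<eta>. f \<eta> = (if \<eta> \<le> a then left_profile d\<^sub>u U\<^sub>0 a \<eta> else - V\<^sub>0)"
    by (auto simp: f_def)
  then show ?thesis unfolding dv
    by (intro conjI[OF concl(1)], intro exI[of _ f] exI[of _ a] conjI[OF concl(2)]) (use a in blast)
qed

end
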